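(* Let $d\ge2$. The Euclidean clustering tendency $\overline p_d$ and the hyperbolic clustering tendency $\breve p_d(\alpha)$, $\alpha>0$, satisfy: (i) $\breve p_d(\alpha)<\overline p_d$ for all $\alpha>0$; (ii) $\alpha\mapsto\breve p_d(\alpha)$ is strictly decreasing on $(0,\infty)$; (iii) $\breve p_2(\alpha)=\overline p_2-\frac{\sqrt3}{16\pi}\alpha^2+O(\alpha^4)$ as $\alpha\to0^+$; (iv) $\breve p_2(\alpha)=\frac{8}{\pi}e^{-\alpha/2}+o(e^{-\alpha/2})$ as $\alpha\to\infty$.
   Context: For a connected homogeneous Riemannian manifold $(M,g)$ (isometry group acting transitively) with Riemannian distance $d_g$ and volume measure $\lambda_g$, the clustering tendency at radius $t>0$ is the probability that two independent random points, each with law $\lambda_g(B_t(x_0))^{-1}\lambda_g|_{B_t(x_0)}$ on the closed ball $B_t(x_0)$, are at distance $d_g$ at most $t$ from each other; it does not depend on $x_0\in M$. $\overline p_d$ is the clustering tendency of Euclidean space $\mathbb{R}^d$ at radius $t$ (independent of $t$ by dilation). For $\kappa>0$, $\mathbb{H}^d_\kappa$ denotes $d$-dimensional hyperbolic space of constant sectional curvature $-\kappa^2$. Its clustering tendency at radius $t$ depends only on the product $\alpha=\kappa t$ (by rescaling) and is denoted $\breve p_d(\alpha)$; equivalently, $\breve p_d(\alpha)$ is the clustering tendency of $\mathbb{H}^d_1$ at radius $\alpha$. *)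

theory Defs
  imports "HOL-Analysis.Analysis" "HOL-Library.Landau_Symbols"
begin

(* The law of one random point is the normalised restriction of \<mu> to the closed D-ball of radius t. *)

definition clustering_tendency ::
    "('a \<Rightarrow> 'a \<Rightarrow> real) \<Rightarrow> 'a measure \<Rightarrow> 'a \<Rightarrow> real \<Rightarrow> real" where
  "clustering_tendency D \<mu> x0 t =
     (let P = uniform_measure \<mu> {x \<in> space \<mu>. D x0 x \<le> t}
      in measure (P \<Otimes>\<^sub>M P) {z \<in> space (P \<Otimes>\<^sub>M P). D (fst z) (snd z) \<le> t})"

(* Riemannian geometry in a single global chart: U is an open connected subset of Euclidean space
   and g x is the inner product on the tangent space at x. *)

definition riemannian_speed ::
    "(real^'n \<Rightarrow> real^'n \<Rightarrow> real^'n \<Rightarrow> real) \<Rightarrow> (real \<Rightarrow> real^'n) \<Rightarrow> real \<Rightarrow> real" where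
  "riemannian_speed g \<gamma> s =
     sqrt (g (\<gamma> s) (vector_derivative \<gamma> (at s)) (vector_derivative \<gamma> (at s)))"

definition riemannian_length ::
    "(real^'n \<Rightarrow> real^'n \<Rightarrow> real^'n \<Rightarrow> real) \<Rightarrow> (real \<Rightarrow> real^'n) \<Rightarrow> real" where
  "riemannian_length g \<gamma> = integral {0..1} (riemannian_speed g \<gamma>)"

(* A valid_path may have an unbounded derivative near its finitely many exceptional points, and
   integral is 0 for non-integrable functions; hence paths of infinite length are excluded
   explicitly. *)

definition riemannian_dist ::
    "(real^'n) set \<Rightarrow> (real^'n \<Rightarrow> real^'n \<Rightarrow> real^'n \<Rightarrow> real) \<Rightarrow> real^'n \<Rightarrow> real^'n \<Rightarrow> real" where
  "riemannian_dist U g x y =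
     Inf {riemannian_length g \<gamma> | \<gamma>.
            valid_path \<gamma> \<and> path_image \<gamma> \<subseteq> U \<and> pathstart \<gamma> = x \<and> pathfinish \<gamma> = y \<and>
            riemannian_speed g \<gamma> integrable_on {0..1}}"

definition riemannian_volume ::
    "(real^'n) set \<Rightarrow> (real^'n \<Rightarrow> real^'n \<Rightarrow> real^'n \<Rightarrow> real) \<Rightarrow> (real^'n) measure" where
  "riemannian_volume U g =
     density (restrict_space lborel U)
       (\<lambda>x. ennreal (sqrt (det (\<chi> i j. g x (axis i 1) (axis j 1)))))"

(* Poincare ball model on ball 0 1, with constant sectional curvature - \<kappa>^2. *)

definition hyperbolic_metric :: "real \<Rightarrow> real^'n \<Rightarrow> real^'n \<Rightarrow> real^'n \<Rightarrow> real" where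
  "hyperbolic_metric \<kappa> x u v = 4 / (\<kappa>\<^sup>2 * (1 - (norm x)\<^sup>2)\<^sup>2) * (u \<bullet> v)"

definition hyperbolic_dist :: "real \<Rightarrow> real^'n \<Rightarrow> real^'n \<Rightarrow> real" where
  "hyperbolic_dist \<kappa> = riemannian_dist (ball 0 1) (hyperbolic_metric \<kappa>)"

definition hyperbolic_volume :: "real \<Rightarrow> (real^'n) measure" where
  "hyperbolic_volume \<kappa> = riemannian_volume (ball 0 1) (hyperbolic_metric \<kappa>)"

(* Both spaces are homogeneous, so their clustering tendencies may be taken at the origin.
   By dilation the Euclidean one may be taken at radius 1, and the hyperbolic one at radius t and
   curvature - \<kappa>^2 depends only on \<alpha> = \<kappa> * t, so \<kappa> = 1 and t = \<alpha> may be taken. The dimension is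
   CARD('n). *)

definition euclidean_p :: "'n::finite itself \<Rightarrow> real" where
  "euclidean_p _ = clustering_tendency dist (lborel :: (real^'n) measure) 0 1"

definition hyperbolic_p :: "'n::finite itself \<Rightarrow> real \<Rightarrow> real" where
  "hyperbolic_p _ \<alpha> =
     clustering_tendency (hyperbolic_dist 1) (hyperbolic_volume 1 :: (real^'n) measure) 0 \<alpha>"

end

theory Submission
  imports Defs "HOL-Probability.Giry_Monad" "HOL-Real_Asymp.Real_Asymp"
begin

text \<open>
  Write a point of a ball of radius \<open>\<alpha>\<close> by its direction \<open>\<sigma>\<close> from the centre and by its distance to the
  centre, measured as a fraction \<open>u\<close> of \<open>\<alpha>\<close>. For a uniformly distributed point, \<open>\<sigma>\<close> and \<open>u\<close> are
  independent and \<open>u\<close> has density proportional to \<open>s u ^ (d - 1)\<close>, where \<open>s u = u\<close> in Euclidean space and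
  \<open>s u = sinh (\<alpha> * u) / \<alpha>\<close> in hyperbolic space. In both geometries the law of cosines says that the points
  with coordinates \<open>(\<sigma>, u)\<close> and \<open>(\<tau>, v)\<close> are at distance at most the radius of the ball iff
  \<open>(dist \<sigma> \<tau>)\<^sup>2 \<le> 4 * (s p * s q) / (s u * s v)\<close> with \<open>p = (1 + u - v) / 2\<close> and \<open>q = (1 + v - u) / 2\<close>.
  So the two clustering tendencies are values of one functional of \<open>s\<close>, the \<open>cluster_integral\<close>
  (\<open>euclidean_p_eq_cluster_integral\<close>, \<open>hyperbolic_p_eq_cluster_integral\<close>).

  This functional decreases when \<open>s\<close> is replaced by some \<open>s'\<close> for which \<open>s' / s\<close> is strictly increasing
  (\<open>cluster_integral_less\<close>), for two reasons. If \<open>u + v > 1\<close>, then \<open>p < u\<close> and \<open>q < v\<close>, so the bound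
  \<open>(s p / s u) * (s q / s v)\<close> gets smaller; otherwise every pair of directions qualifies for both. And the
  radial law moves towards the boundary sphere, in the likelihood ratio order, while the bound is decreasing in each of
  \<open>u\<close> and \<open>v\<close>. The hypothesis holds for \<open>s u = u\<close> against every hyperbolic \<open>s\<close>, and for \<open>sinh (\<alpha> * u) / \<alpha>\<close>
  against \<open>sinh (\<beta> * u) / \<beta>\<close> with \<open>\<alpha> < \<beta>\<close>. This gives the first two claims in every dimension \<open>d \<ge> 2\<close>.

  In the plane the probability that two random directions satisfy the bound is an angle divided by \<open>\<pi>\<close>, and the
  double integral is elementary: the inner integral is half the area of the intersection of two discs, which is
  found from the angles of a triangle, and it has an elementary primitive in turn. The result
  (\<open>hyperbolic_p_plane\<close>) is a function of \<open>cosh \<alpha>\<close> and of the angle of the equilateral triangle of side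
  \<open>\<alpha>\<close>, and both asymptotic claims are read off from it. The Euclidean constant is its limit at \<open>0\<close>, by
  dominated convergence in the double integral.

  The geometric input is the distance formula of the ball model (\<open>hyperbolic_dist_eq_arcosh\<close>), where lengths
  of paths are bounded below by a gradient estimate and the bound is attained by an explicit geodesic, together with
  polar coordinates for Lebesgue measure (\<open>nn_integral_polar\<close>).
\<close>

section \<open>A comparison inequality for radial double integrals\<close>

text \<open>Chebyshev's trick: \<open>(W2 x * W1 y - W1 x * W2 y) * (f x - f y)\<close> is never positive, because the two factors have
opposite signs on both sides of the diagonal. Integrating over \<open>x\<close> and \<open>y\<close> gives twice the claim.\<close>

lemma chebyshev_likelihood_ratio:
  fixes M :: "real measure" and W1 W2 f :: "real \<Rightarrow> real"
  assumes int: "integrable M W1" "integrable M W2"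
      "integrable M (\<lambda>x. W1 x * f x)" "integrable M (\<lambda>x. W2 x * f x)"
    and pos: "0 < (\<integral>x. W1 x \<partial>M)" "0 < (\<integral>x. W2 x \<partial>M)"
    and ratio: "\<And>x y. x \<in> space M \<Longrightarrow> y \<in> space M \<Longrightarrow> x < y \<Longrightarrow> W2 x * W1 y \<le> W1 x * W2 y"
    and anti: "\<And>x y. x \<in> space M \<Longrightarrow> y \<in> space M \<Longrightarrow> x < y \<Longrightarrow> f y \<le> f x"
  shows "(\<integral>x. W2 x * f x \<partial>M) / (\<integral>x. W2 x \<partial>M) \<le> (\<integral>x. W1 x * f x \<partial>M) / (\<integral>x. W1 x \<partial>M)"
proof -
  define I1 I2 J1 J2 where "I1 = (\<integral>x. W1 x \<partial>M)" and "I2 = (\<integral>x. W2 x \<partial>M)"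
    and "J1 = (\<integral>x. W1 x * f x \<partial>M)" and "J2 = (\<integral>x. W2 x * f x \<partial>M)"
  have pt: "(W2 x * W1 y - W1 x * W2 y) * (f x - f y) \<le> 0" if "x \<in> space M" "y \<in> space M" for x y
  proof (cases x y rule: linorder_cases)
    case less
    show ?thesis
      using ratio[OF that less] anti[OF that less] by (intro mult_nonpos_nonneg) auto
  next
    case greater
    show ?thesis
      using ratio[OF that(2,1) greater] anti[OF that(2,1) greater]
      by (intro mult_nonneg_nonpos) (auto simp: mult.commute)
  qed simp
  have inner: "W2 x * f x * I1 - W2 x * J1 - W1 x * f x * I2 + W1 x * J2 \<le> 0" if x: "x \<in> space M" for x
  proof -
    have "W2 x * f x * I1 - W2 x * J1 - W1 x * f x * I2 + W1 x * J2
       = (\<integral>y. W2 x * f x * W1 y - W2 x * (W1 y * f y) - W1 x * f x * W2 y + W1 x * (W2 y * f y) \<partial>M)"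
      using int by (simp add: I1_def I2_def J1_def J2_def)
    also have "\<dots> \<le> (\<integral>y. 0 \<partial>M)"
    proof (intro integral_mono)
      show "integrable M (\<lambda>y. W2 x * f x * W1 y - W2 x * (W1 y * f y) - W1 x * f x * W2 y + W1 x * (W2 y * f y))"
        using int by simp
    qed (use pt[OF x] in \<open>auto simp: algebra_simps\<close>)
    finally show ?thesis by simp
  qed
  have "J2 * I1 - I2 * J1 - J1 * I2 + I1 * J2
     = (\<integral>x. W2 x * f x * I1 - W2 x * J1 - W1 x * f x * I2 + W1 x * J2 \<partial>M)"
    using int by (simp add: I1_def I2_def J1_def J2_def)
  also have "\<dots> \<le> (\<integral>x. 0 \<partial>M)"
    using int inner by (intro integral_mono) auto
  finally have "J2 * I1 \<le> J1 * I2" by (simp add: algebra_simps)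
  thus ?thesis
    using pos by (simp add: I1_def I2_def J1_def J2_def field_simps)
qed

definition unif01 :: "real measure" where
  "unif01 = restrict_space lborel {0<..<1}"

lemma space_unif01 [simp]: "space unif01 = {0<..<1}"
  by (simp add: unif01_def space_restrict_space)

lemma prob_space_unif01: "prob_space unif01"
  by (rule prob_spaceI) (simp add: unif01_def space_restrict_space emeasure_restrict_space)

lemma measurable_unif01:
  "f \<in> borel_measurable borel \<Longrightarrow> f \<in> borel_measurable unif01"
  unfolding unif01_def by (intro measurable_restrict_space1) simp

text \<open>Measurability of the inner integral on the whole real line, not only on the open interval, so that it can
be combined with Borel measurable functions.\<close>

lemma borel_measurable_integral_unif01:
  fixes f :: "real \<Rightarrow> real \<Rightarrow> real"
  assumes "(\<lambda>(u, v). f u v) \<in> borel_measurable (borel \<Otimes>\<^sub>M borel)"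
  shows "(\<lambda>u. \<integral>v. f u v \<partial>unif01) \<in> borel_measurable borel"
proof -
  interpret U: prob_space unif01 by (rule prob_space_unif01)
  show ?thesis
  proof (rule U.borel_measurable_lebesgue_integral)
    have "(\<lambda>x. x) \<in> unif01 \<rightarrow>\<^sub>M borel"
      by (rule measurable_unif01) simp
    hence "(\<lambda>p. (fst p, snd p)) \<in> borel \<Otimes>\<^sub>M unif01 \<rightarrow>\<^sub>M borel \<Otimes>\<^sub>M borel"
      by (intro measurable_Pair measurable_fst measurable_compose[OF measurable_snd])
    from measurable_compose[OF this assms]
    show "(\<lambda>(u, v). f u v) \<in> borel_measurable (borel \<Otimes>\<^sub>M unif01)"
      by (simp add: split_beta')
  qed
qed

text \<open>The squared sine of half the angle opposite to a side of length \<open>1\<close> in a triangle whose other sides are \<open>u\<close> and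
\<open>v\<close>, if \<open>s\<close> is the sine function of the geometry. The two arguments in the numerator are the half perimeter minus
\<open>v\<close> and minus \<open>u\<close>.\<close>

definition sine_ratio :: "(real \<Rightarrow> real) \<Rightarrow> real \<Rightarrow> real \<Rightarrow> real" where
  "sine_ratio s u v = s ((1 + u - v) / 2) * s ((1 + v - u) / 2) / (s u * s v)"

text \<open>The probability that two independent points are within the radius of the ball, when \<open>m + 1\<close> is the dimension and
\<open>G k\<close> is the probability that the angle between two random directions has half-angle sine squared at most \<open>k\<close>.\<close>

definition cluster_integral :: "nat \<Rightarrow> (real \<Rightarrow> real) \<Rightarrow> (real \<Rightarrow> real) \<Rightarrow> real" where
  "cluster_integral m G s =
     (\<integral>u. (\<integral>v. s u ^ m * (s v ^ m * G (sine_ratio s u v)) \<partial>unif01) \<partial>unif01)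
       / (\<integral>u. s u ^ m \<partial>unif01)\<^sup>2"

text \<open>The antitone condition says that the angle opposite to the longest side of a triangle decreases when another side
grows.\<close>

definition sine_like :: "(real \<Rightarrow> real) \<Rightarrow> bool" where
  "sine_like s \<longleftrightarrow> s \<in> borel_measurable borel \<and> (\<forall>x\<in>{0<..1}. 0 < s x) \<and> strict_mono_on {0<..1} s
     \<and> (\<forall>v\<in>{0<..<1}. antimono_on {0<..<1} (\<lambda>u. sine_ratio s u v))"

lemma
  assumes "sine_like s"
  shows sine_like_measurable: "s \<in> borel_measurable borel"
    and sine_like_pos: "\<And>x. 0 < x \<Longrightarrow> x \<le> 1 \<Longrightarrow> 0 < s x"
    and sine_like_less: "\<And>x y. 0 < x \<Longrightarrow> x < y \<Longrightarrow> y \<le> 1 \<Longrightarrow> s x < s y"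
    and sine_like_antimono: "\<And>u u' v. 0 < v \<Longrightarrow> v < 1 \<Longrightarrow> 0 < u \<Longrightarrow> u \<le> u' \<Longrightarrow> u' < 1 \<Longrightarrow>
          sine_ratio s u' v \<le> sine_ratio s u v"
proof -
  have pos: "\<forall>x\<in>{0<..1}. 0 < s x" and mono: "strict_mono_on {0<..1} s"
    and anti: "\<forall>v\<in>{0<..<1}. antimono_on {0<..<1} (\<lambda>u. sine_ratio s u v)"
    using assms unfolding sine_like_def by blast+
  show "s \<in> borel_measurable borel" using assms unfolding sine_like_def by blast
  show "0 < s x" if "0 < x" "x \<le> 1" for x using pos that by simp
  show "s x < s y" if "0 < x" "x < y" "y \<le> 1" for x y
    by (rule strict_mono_onD[OF mono]) (use that in simp_all)
  show "sine_ratio s u' v \<le> sine_ratio s u v" if "0 < v" "v < 1" "0 < u" "u \<le> u'" "u' < 1" for u u' v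
  proof -
    have "antimono_on {0<..<1} (\<lambda>u. sine_ratio s u v)" by (rule bspec[OF anti]) (use that in simp)
    from monotone_onD[OF this, of u u'] that show ?thesis by simp
  qed
qed

lemma sine_ratio_commute: "sine_ratio s u v = sine_ratio s v u"
  by (simp add: sine_ratio_def mult_ac)

text \<open>The properties of the distribution function of the half-angle sine squared that hold in every dimension.\<close>

locale link_law =
  fixes G :: "real \<Rightarrow> real"
  assumes mono: "mono G" and nonneg: "0 \<le> G k" and le_1: "G k \<le> 1"
    and eq_1: "1 \<le> k \<Longrightarrow> G k = 1" 
begin

lemma G_measurable [measurable]: "G \<in> borel_measurable borel"
  by (rule borel_measurable_mono[OF mono])

end

lemma bounded_integrable:
  fixes f :: "real \<Rightarrow> real"
  assumes "f \<in> borel_measurable unif01" "\<And>x. 0 < x \<Longrightarrow> x < 1 \<Longrightarrow> \<bar>f x\<bar> \<le> B"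
  shows "integrable unif01 f"
proof -
  interpret prob_space unif01 by (rule prob_space_unif01)
  show ?thesis
  proof (rule integrable_const_bound)
    show "AE x in unif01. norm (f x) \<le> B"
      by (rule AE_I2) (use assms(2) in simp)
  qed (rule assms(1))
qed

text \<open>Strictness in the comparison comes only from pairs with \<open>u + v > 1\<close>, for fixed \<open>u\<close> a final segment of the interval.\<close>

lemma integral_unif01_pos:
  fixes f :: "real \<Rightarrow> real"
  assumes int: "integrable unif01 f" and nonneg: "\<And>x. 0 < x \<Longrightarrow> x < 1 \<Longrightarrow> 0 \<le> f x"
    and a: "0 \<le> a" "a < 1" and pos: "\<And>x. a < x \<Longrightarrow> x < 1 \<Longrightarrow> 0 < f x"
  shows "0 < (\<integral>x. f x \<partial>unif01)"
proof -
  have ae: "AE x in unif01. 0 \<le> f x"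
    by (rule AE_I2) (simp add: nonneg)
  have "(\<integral>x. f x \<partial>unif01) \<noteq> 0"
  proof
    assume "(\<integral>x. f x \<partial>unif01) = 0"
    hence "AE x in unif01. f x = 0"
      using integral_nonneg_eq_0_iff_AE[OF int ae] by blast
    hence "AE x in lborel. x \<in> {0<..<1} \<longrightarrow> f x = 0"
      unfolding unif01_def by (subst (asm) AE_restrict_space_iff) simp_all
    moreover have "x \<notin> {a<..<1}" if "x \<in> {0<..<1} \<longrightarrow> f x = 0" for x
      using pos[of x] a that by fastforce
    ultimately have "AE x in lborel. x \<notin> {a<..<1}"
      by (rule eventually_mono)
    hence "emeasure lborel {a<..<1} = 0"
      by (subst (asm) AE_iff_measurable[of "{a<..<1}"]) auto
    thus False using a by simp
  qed
  moreover have "(\<integral>x. f x \<partial>unif01) \<ge> 0"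
    by (rule integral_nonneg_AE[OF ae])
  ultimately show ?thesis by simp
qed

lemma sine_like_power:
  assumes s: "sine_like s"
  shows "\<And>u. 0 < u \<Longrightarrow> u < 1 \<Longrightarrow> 0 < s u ^ m" "\<And>u. 0 < u \<Longrightarrow> u < 1 \<Longrightarrow> s u ^ m \<le> s 1 ^ m"
    and "integrable unif01 (\<lambda>u. s u ^ m)" "0 < (\<integral>u. s u ^ m \<partial>unif01)"
    and "(\<integral>\<^sup>+ u. ennreal (s u ^ m) \<partial>unif01) = ennreal (\<integral>u. s u ^ m \<partial>unif01)"
proof -
  have [measurable]: "s \<in> borel_measurable borel" by (rule sine_like_measurable[OF s])
  show bnd: "0 < s u ^ m" "s u ^ m \<le> s 1 ^ m" if "0 < u" "u < 1" for u
    using sine_like_pos[OF s, of u] sine_like_less[OF s, of u 1] that by (auto intro!: power_mono)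
  show int: "integrable unif01 (\<lambda>u. s u ^ m)"
    by (rule bounded_integrable[of _ "s 1 ^ m"], rule measurable_unif01, measurable)
       (use bnd in \<open>auto simp: abs_of_pos\<close>)
  show "0 < (\<integral>u. s u ^ m \<partial>unif01)"
    by (rule integral_unif01_pos[OF int, of 0]) (use bnd in \<open>auto intro: less_imp_le\<close>)
  show "(\<integral>\<^sup>+ u. ennreal (s u ^ m) \<partial>unif01) = ennreal (\<integral>u. s u ^ m \<partial>unif01)"
    by (rule nn_integral_eq_integral[OF int], rule AE_I2, use bnd in \<open>auto intro: less_imp_le\<close>)
qed

text \<open>Since \<open>u + v > 1\<close> means \<open>p < u\<close> and \<open>q < v\<close>, both factors of \<open>(s p / s u) * (s q / s v)\<close> are smaller for \<open>s2\<close> than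
for \<open>s1\<close>, and less than \<open>1\<close>.\<close>

lemma sine_ratio_less:
  assumes s1: "sine_like s1" and s2: "sine_like s2"
    and ratio: "\<And>x y. 0 < x \<Longrightarrow> x < y \<Longrightarrow> y < 1 \<Longrightarrow> s2 x * s1 y < s1 x * s2 y"
    and uv: "0 < u" "u < 1" "0 < v" "v < 1" "u + v > 1"
  shows "sine_ratio s2 u v < sine_ratio s1 u v" "sine_ratio s1 u v < 1" "0 < sine_ratio s2 u v"
proof -
  define p q where "p = (1 + u - v) / 2" and "q = (1 + v - u) / 2"
  have pq: "0 < p" "p < u" "0 < q" "q < v" using uv by (auto simp: p_def q_def)
  have pos: "0 < s1 x" "0 < s2 x" if "0 < x" "x < 1" for x
    using sine_like_pos[OF s1, of x] sine_like_pos[OF s2, of x] that by auto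
  have less: "s1 x < s1 y" if "0 < x" "x < y" "y < 1" for x y
    using sine_like_less[OF s1, of x y] that by auto
  have P: "0 < s1 p" "0 < s1 q" "0 < s1 u" "0 < s1 v" "0 < s2 p" "0 < s2 q" "0 < s2 u" "0 < s2 v"
    using pq uv by (auto intro!: pos)
  have "s2 p / s2 u < s1 p / s1 u" "s2 q / s2 v < s1 q / s1 v"
    using ratio[of p u] ratio[of q v] pq uv P by (auto simp: field_simps)
  hence "(s2 p / s2 u) * (s2 q / s2 v) < (s1 p / s1 u) * (s1 q / s1 v)"
    using P by (intro mult_strict_mono) auto
  thus "sine_ratio s2 u v < sine_ratio s1 u v"
    by (simp add: sine_ratio_def p_def q_def)
  have "s1 p / s1 u < 1" "s1 q / s1 v < 1"
    using less[of p u] less[of q v] pq uv P by auto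
  hence "(s1 p / s1 u) * (s1 q / s1 v) < 1 * 1"
    using P by (intro mult_strict_mono) auto
  thus "sine_ratio s1 u v < 1"
    by (simp add: sine_ratio_def p_def q_def)
  show "0 < sine_ratio s2 u v"
    using P by (simp add: sine_ratio_def p_def q_def)
qed

text \<open>The triangle inequality is violated or degenerate, and every pair of directions gives points within distance \<open>1\<close>.\<close>

lemma sine_ratio_ge_1:
  assumes s1: "sine_like s" and uv: "0 < u" "u < 1" "0 < v" "v < 1" "u + v \<le> 1"
  shows "1 \<le> sine_ratio s u v"
proof -
  define p q where "p = (1 + u - v) / 2" and "q = (1 + v - u) / 2"
  have pq: "u \<le> p" "p < 1" "v \<le> q" "q < 1" using uv by (auto simp: p_def q_def)
  have "s u \<le> s p" "s v \<le> s q" "0 < s u" "0 < s v"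
    using sine_like_less[OF s1, of u p] sine_like_less[OF s1, of v q] sine_like_pos[OF s1, of u]
      sine_like_pos[OF s1, of v] uv pq
    by (cases "u = p"; cases "v = q"; simp)+
  hence "s u * s v \<le> s p * s q" by (intro mult_mono) auto
  with \<open>0 < s u\<close> \<open>0 < s v\<close> show ?thesis by (simp add: sine_ratio_def p_def q_def)
qed

text \<open>Three changes lead from \<open>s2\<close> to \<open>s1\<close>: first the angle bound is changed, strictly, under the radial law of \<open>s2\<close> for
both points; then the law of the second point and then that of the first point is changed, each time by the likelihood
ratio comparison, because the probability of success is antitone in either radius.\<close>

theorem (in link_law) cluster_integral_less:
  assumes strict: "\<And>k l. 0 \<le> k \<Longrightarrow> k < l \<Longrightarrow> l \<le> 1 \<Longrightarrow> G k < G l"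
    and s1: "sine_like s1" and s2: "sine_like s2"
    and ratio: "\<And>x y. 0 < x \<Longrightarrow> x < y \<Longrightarrow> y < 1 \<Longrightarrow> s2 x * s1 y < s1 x * s2 y"
  shows "cluster_integral m G s2 < cluster_integral m G s1"
proof -
  interpret U: prob_space unif01 by (rule prob_space_unif01)
  let ?U = unif01
  have [measurable]: "s1 \<in> borel_measurable borel" "s2 \<in> borel_measurable borel"
    by (rule sine_like_measurable[OF s1], rule sine_like_measurable[OF s2])
  define W1 W2 where "W1 u = s1 u ^ m" and "W2 u = s2 u ^ m" for u
  define g1 g2 where "g1 u v = G (sine_ratio s1 u v)" and "g2 u v = G (sine_ratio s2 u v)" for u v
  have [measurable]: "W1 \<in> borel_measurable borel" "W2 \<in> borel_measurable borel"
    unfolding W1_def[abs_def] W2_def[abs_def]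
    by measurable
  have [measurable]: "(\<lambda>(u, v). g1 u v) \<in> borel_measurable (borel \<Otimes>\<^sub>M borel)"
      "(\<lambda>(u, v). g2 u v) \<in> borel_measurable (borel \<Otimes>\<^sub>M borel)"
    unfolding g1_def g2_def sine_ratio_def by measurable
  have g_bounds: "0 \<le> g1 u v" "g1 u v \<le> 1" "0 \<le> g2 u v" "g2 u v \<le> 1" for u v
    by (auto simp: g1_def g2_def nonneg le_1)
  have pos: "0 < W1 x" "0 < W2 x" and bound: "W1 x \<le> s1 1 ^ m" "W2 x \<le> s2 1 ^ m"
    if "0 < x" "x < 1" for x
    unfolding W1_def W2_def using sine_like_power(1,2)[OF s1 that] sine_like_power(1,2)[OF s2 that] by auto
  have Wg: "\<bar>W1 x * h\<bar> \<le> s1 1 ^ m" "\<bar>W2 x * h\<bar> \<le> s2 1 ^ m"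
    if "0 < x" "x < 1" "0 \<le> h" "h \<le> 1" for x h
  proof -
    have "W1 x * h \<le> W1 x * 1" "W2 x * h \<le> W2 x * 1" "0 \<le> W1 x * h" "0 \<le> W2 x * h"
      using pos[OF that(1,2)] that(3,4) by (auto intro!: mult_left_mono)
    thus "\<bar>W1 x * h\<bar> \<le> s1 1 ^ m" "\<bar>W2 x * h\<bar> \<le> s2 1 ^ m"
      using bound[OF that(1,2)] by linarith+
  qed
  have intW: "integrable ?U (\<lambda>x. W1 x * h x)" "integrable ?U (\<lambda>x. W2 x * h x)"
    if h: "h \<in> borel_measurable ?U" "\<And>x. 0 \<le> h x" "\<And>x. h x \<le> 1" for h
    by (rule bounded_integrable, intro borel_measurable_times measurable_unif01[of W1]
          measurable_unif01[of W2] h(1), measurable, erule (1) Wg, rule h, rule h)+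
  have intW0: "integrable ?U W1" "integrable ?U W2"
    using intW[of "\<lambda>_. 1"] by auto
  define I1 I2 where "I1 = (\<integral>x. W1 x \<partial>?U)" and "I2 = (\<integral>x. W2 x \<partial>?U)"
  have Ipos: "0 < I1" "0 < I2"
    unfolding I1_def I2_def
    by (rule integral_unif01_pos[of _ 0]; use intW0 pos in \<open>simp add: less_imp_le\<close>)+
  have ratioW: "W2 x * W1 y \<le> W1 x * W2 y" if "x \<in> space ?U" "y \<in> space ?U" "x < y" for x y
    using ratio[of x y] that sine_like_pos[OF s1, of y] sine_like_pos[OF s2, of x]
    unfolding W1_def W2_def power_mult_distrib[symmetric]
    by (intro power_mono) auto
  have cheb: "(\<integral>x. W2 x * h x \<partial>?U) / I2 \<le> (\<integral>x. W1 x * h x \<partial>?U) / I1"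
    if h: "h \<in> borel_measurable ?U" "\<And>x. 0 \<le> h x" "\<And>x. h x \<le> 1"
      and anti: "\<And>x y. 0 < x \<Longrightarrow> x < y \<Longrightarrow> y < 1 \<Longrightarrow> h y \<le> h x" for h
    unfolding I1_def I2_def
  proof (rule chebyshev_likelihood_ratio)
    show "0 < (\<integral>x. W1 x \<partial>?U)" "0 < (\<integral>x. W2 x \<partial>?U)"
      using Ipos by (simp_all add: I1_def I2_def)
    show "h y \<le> h x" if "x \<in> space ?U" "y \<in> space ?U" "x < y" for x y
      using that anti by simp
  qed (rule intW0 intW h | erule (2) ratioW)+
  have avg: "0 \<le> (\<integral>x. W1 x * h x \<partial>?U)" "0 \<le> (\<integral>x. W2 x * h x \<partial>?U)"
    "(\<integral>x. W1 x * h x \<partial>?U) \<le> I1" "(\<integral>x. W2 x * h x \<partial>?U) \<le> I2"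
    if h: "h \<in> borel_measurable ?U" "\<And>x. 0 \<le> h x" "\<And>x. h x \<le> 1" for h
  proof -
    have p: "0 \<le> W1 x" "0 \<le> W2 x" if "x \<in> space ?U" for x
      using pos[of x] that by auto
    show "0 \<le> (\<integral>x. W1 x * h x \<partial>?U)" "0 \<le> (\<integral>x. W2 x * h x \<partial>?U)"
      by (rule integral_nonneg_AE, rule AE_I2, rule mult_nonneg_nonneg, erule p, rule h)+
    show "(\<integral>x. W1 x * h x \<partial>?U) \<le> I1" "(\<integral>x. W2 x * h x \<partial>?U) \<le> I2"
      unfolding I1_def I2_def
      by (rule integral_mono, rule intW[OF h], rule intW0, rule mult_left_le, rule h, erule p)+
  qed
  define h2 h1 where "h2 u = (\<integral>v. W2 v * g1 u v \<partial>?U) / I2"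
    and "h1 u = (\<integral>v. W1 v * g1 u v \<partial>?U) / I1" for u
  have gsec: "g1 u \<in> borel_measurable ?U" "g2 u \<in> borel_measurable ?U" for u
    by (rule measurable_unif01, measurable)+
  have g1_anti: "g1 u' v \<le> g1 u v" "g1 v u' \<le> g1 v u"
    if "0 < v" "v < 1" "0 < u" "u < u'" "u' < 1" for u u' v
  proof -
    show "g1 u' v \<le> g1 u v"
      using sine_like_antimono[OF s1] that unfolding g1_def
      by (intro monoD[OF mono]) auto
    thus "g1 v u' \<le> g1 v u" by (simp add: g1_def sine_ratio_commute)
  qed
  have h_le: "h2 u \<le> h1 u" if u: "0 < u" "u < 1" for u
    unfolding h2_def h1_def
    by (rule cheb) (rule gsec g_bounds | use g1_anti(2)[of u] u in simp)+
  have [measurable]: "(\<lambda>u. \<integral>v. W1 v * g1 u v \<partial>?U) \<in> borel_measurable borel"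
    by (rule borel_measurable_integral_unif01) measurable
  have [measurable]: "(\<lambda>u. \<integral>v. W2 v * g1 u v \<partial>?U) \<in> borel_measurable borel"
    by (rule borel_measurable_integral_unif01) measurable
  have [measurable]: "(\<lambda>u. \<integral>v. W2 v * g2 u v \<partial>?U) \<in> borel_measurable borel"
    by (rule borel_measurable_integral_unif01) measurable
  have hmeas: "h1 \<in> borel_measurable borel" "h2 \<in> borel_measurable borel"
    unfolding h1_def[abs_def] h2_def[abs_def] by measurable
  have sec_le: "(\<integral>v. W1 v * g1 u v \<partial>?U) \<le> I1" "(\<integral>v. W2 v * g1 u v \<partial>?U) \<le> I2"
     "(\<integral>v. W2 v * g2 u v \<partial>?U) \<le> I2"
     "0 \<le> (\<integral>v. W1 v * g1 u v \<partial>?U)" "0 \<le> (\<integral>v. W2 v * g1 u v \<partial>?U)"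
     "0 \<le> (\<integral>v. W2 v * g2 u v \<partial>?U)" for u
    by (rule avg, rule gsec, rule g_bounds, rule g_bounds)+
  have h_bounds: "0 \<le> h1 u" "h1 u \<le> 1" "0 \<le> h2 u" "h2 u \<le> 1" for u
    using sec_le[of u] Ipos by (auto simp: h1_def h2_def)
  have h1_anti: "h1 y \<le> h1 x" if "0 < x" "x < y" "y < 1" for x y
  proof -
    have "(\<integral>v. W1 v * g1 y v \<partial>?U) \<le> (\<integral>v. W1 v * g1 x v \<partial>?U)"
    proof (rule integral_mono)
      fix v assume "v \<in> space ?U"
      hence "0 < v" "v < 1" by auto
      with pos[of v] g1_anti(1)[OF this that] show "W1 v * g1 y v \<le> W1 v * g1 x v"
        by (intro mult_left_mono) auto
    qed (rule intW gsec g_bounds)+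
    thus ?thesis unfolding h1_def using Ipos by (intro divide_right_mono) auto
  qed
  (* Changing the angle bound: the only strict step. *)
  have step1: "(\<integral>u. W2 u * (\<integral>v. W2 v * g2 u v \<partial>?U) \<partial>?U)
             < (\<integral>u. W2 u * (\<integral>v. W2 v * g1 u v \<partial>?U) \<partial>?U)"
  proof -
    have g_le: "g2 u v \<le> g1 u v" if "0 < u" "u < 1" "0 < v" "v < 1" for u v
    proof (cases "u + v > 1")
      case True
      thus ?thesis unfolding g1_def g2_def
        using sine_ratio_less[OF s1 s2 ratio that True] by (intro monoD[OF mono]) auto
    next
      case False
      thus ?thesis using sine_ratio_ge_1[OF s1 that] g_bounds eq_1 by (auto simp: g1_def g2_def)
    qed
    have sec: "0 < (\<integral>v. W2 v * (g1 u v - g2 u v) \<partial>?U)" if u: "0 < u" "u < 1" for u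
    proof (rule integral_unif01_pos[of _ "1 - u"])
      show "integrable ?U (\<lambda>v. W2 v * (g1 u v - g2 u v))"
        unfolding right_diff_distrib by (rule Bochner_Integration.integrable_diff) (rule intW gsec g_bounds)+
      show "0 \<le> W2 x * (g1 u x - g2 u x)" if "0 < x" "x < 1" for x
        using pos[of x] g_le[of u x] u that by auto
      show "0 < W2 x * (g1 u x - g2 u x)" if "1 - u < x" "x < 1" for x
      proof -
        have "g2 u x < g1 u x" unfolding g1_def g2_def
          using sine_ratio_less[OF s1 s2 ratio, of u x] u that by (intro strict) auto
        thus ?thesis using pos[of x] u that by auto
      qed
    qed (use u in auto)
    have diff: "(\<integral>v. W2 v * (g1 u v - g2 u v) \<partial>?U)
       = (\<integral>v. W2 v * g1 u v \<partial>?U) - (\<integral>v. W2 v * g2 u v \<partial>?U)" for u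
      unfolding right_diff_distrib by (rule Bochner_Integration.integral_diff) (rule intW gsec g_bounds)+
    have intO: "integrable ?U (\<lambda>u. W2 u * (\<integral>v. W2 v * g1 u v \<partial>?U))"
       "integrable ?U (\<lambda>u. W2 u * (\<integral>v. W2 v * g2 u v \<partial>?U))"
    proof -
      have "integrable ?U (\<lambda>u. I2 * (W2 u * ((\<integral>v. W2 v * g1 u v \<partial>?U) / I2)))"
         "integrable ?U (\<lambda>u. I2 * (W2 u * ((\<integral>v. W2 v * g2 u v \<partial>?U) / I2)))"
        by (rule integrable_mult_right, rule intW, rule measurable_unif01, measurable,
            use sec_le Ipos in simp, use sec_le Ipos in simp)+
      thus "integrable ?U (\<lambda>u. W2 u * (\<integral>v. W2 v * g1 u v \<partial>?U))"
       "integrable ?U (\<lambda>u. W2 u * (\<integral>v. W2 v * g2 u v \<partial>?U))"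
        using Ipos by simp_all
    qed
    have "0 < (\<integral>u. W2 u * (\<integral>v. W2 v * (g1 u v - g2 u v) \<partial>?U) \<partial>?U)"
    proof (rule integral_unif01_pos[of _ 0])
      show "integrable ?U (\<lambda>u. W2 u * (\<integral>v. W2 v * (g1 u v - g2 u v) \<partial>?U))"
        unfolding diff unfolding right_diff_distrib by (rule Bochner_Integration.integrable_diff[OF intO])
      show p: "0 < W2 x * (\<integral>v. W2 v * (g1 x v - g2 x v) \<partial>?U)" if "0 < x" "x < 1" for x
        by (rule mult_pos_pos[OF pos(2)[OF that] sec[OF that]])
      show "0 \<le> W2 x * (\<integral>v. W2 v * (g1 x v - g2 x v) \<partial>?U)" if "0 < x" "x < 1" for x
        using p[OF that] by simp
    qed simp_all
    thus ?thesis unfolding diff unfolding right_diff_distrib using intO by simp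
  qed
  have step2: "(\<integral>u. W2 u * h2 u \<partial>?U) \<le> (\<integral>u. W2 u * h1 u \<partial>?U)"
  proof (rule integral_mono)
    fix u assume "u \<in> space ?U"
    hence "0 < u" "u < 1" by auto
    with pos[of u] h_le[of u] show "W2 u * h2 u \<le> W2 u * h1 u" by (intro mult_left_mono) auto
  qed (rule intW measurable_unif01 h_bounds hmeas)+
  (* h1 u is the probability of success given the radius u of the first point. *)
  have step3: "(\<integral>u. W2 u * h1 u \<partial>?U) / I2 \<le> (\<integral>u. W1 u * h1 u \<partial>?U) / I1"
    by (rule cheb, rule measurable_unif01) (rule h_bounds hmeas | erule (2) h1_anti)+
  have cl2: "cluster_integral m G s2 = (\<integral>u. W2 u * (\<integral>v. W2 v * g2 u v \<partial>?U) \<partial>?U) / I2\<^sup>2"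
    by (simp add: cluster_integral_def W2_def[symmetric] g2_def[symmetric] I2_def)
  have cl1: "cluster_integral m G s1 = (\<integral>u. W1 u * h1 u \<partial>?U) / I1"
    by (simp add: cluster_integral_def W1_def[symmetric] g1_def[symmetric] I1_def h1_def power2_eq_square)
  have "cluster_integral m G s2 < (\<integral>u. W2 u * (\<integral>v. W2 v * g1 u v \<partial>?U) \<partial>?U) / I2\<^sup>2"
    unfolding cl2 using step1 Ipos by (intro divide_strict_right_mono) auto
  also have "\<dots> = (\<integral>u. W2 u * h2 u \<partial>?U) / I2"
    by (simp add: h2_def power2_eq_square)
  also have "\<dots> \<le> (\<integral>u. W2 u * h1 u \<partial>?U) / I2"
    using step2 Ipos by (intro divide_right_mono) auto
  also note step3
  also note cl1[symmetric]
  finally show ?thesis .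
qed

section \<open>Polar coordinates\<close>

text \<open>The uniform law on the unit sphere, obtained from Lebesgue measure as the law of the direction of a random point of
the unit ball; the value \<open>sgn 0 = 0\<close> has probability \<open>0\<close>.\<close>

definition direction_law :: "'a::euclidean_space measure" where
  "direction_law = distr (uniform_measure lborel (ball 0 1)) borel sgn"

lemma sets_direction_law [simp, measurable_cong]: "sets direction_law = sets borel"
  by (simp add: direction_law_def)

lemma space_direction_law [simp]: "space direction_law = UNIV"
  by (simp add: direction_law_def)

lemma sgn_borel_measurable [measurable]:
  "(sgn :: 'a::euclidean_space \<Rightarrow> 'a) \<in> borel_measurable borel"
  unfolding sgn_div_norm by measurable

lemma ball_borel_measurable [measurable]: "ball (a::'a::euclidean_space) r \<in> sets borel"
  by simp

lemma emeasure_unit_ball: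
  "emeasure lborel (ball (0::'a::euclidean_space) 1) \<noteq> 0" "emeasure lborel (ball (0::'a::euclidean_space) 1) \<noteq> top"
  using open_not_negligible[of "ball (0::'a) 1"] emeasure_lborel_ball_finite[of "0::'a" 1]
  by (auto simp: negligible_iff_emeasure0)

lemma prob_space_direction_law: "prob_space (direction_law :: 'a::euclidean_space measure)"
  unfolding direction_law_def
  by (intro prob_space.prob_space_distr prob_space_uniform_measure)
     (use emeasure_unit_ball[where 'a='a] in auto)

lemma nn_integral_direction_law:
  fixes F :: "'a::euclidean_space \<Rightarrow> ennreal"
  assumes [measurable]: "F \<in> borel_measurable borel"
  shows "emeasure lborel (ball (0::'a) 1) * (\<integral>\<^sup>+ s. F s \<partial>direction_law)
         = (\<integral>\<^sup>+ y. F (sgn y) * indicator (ball 0 1) y \<partial>lborel)"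
  unfolding direction_law_def
  by (simp add: nn_integral_distr nn_integral_uniform_measure ennreal_times_divide
                emeasure_unit_ball mult_divide_eq_ennreal mult.commute[of "emeasure _ _"])

lemma nn_integral_lborel_scaleR:
  fixes g :: "'a::euclidean_space \<Rightarrow> ennreal"
  assumes [measurable]: "g \<in> borel_measurable borel" and "c > 0"
  shows "(\<integral>\<^sup>+ y. g y \<partial>lborel) = ennreal (c ^ DIM('a)) * (\<integral>\<^sup>+ y. g (c *\<^sub>R y) \<partial>lborel)"
  using assms(2)
  by (subst lborel_affine[of c 0])
     (simp_all add: nn_integral_density nn_integral_distr nn_integral_cmult)

lemma nn_integral_radial_tail:
  assumes "a > 0" "n > 0"
  shows "(\<integral>\<^sup>+ \<tau>. ennreal (real n * inverse (\<tau> ^ (n + 1))) * indicator {a..} \<tau> \<partial>lborel)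
         = ennreal (inverse (a ^ n))"
proof -
  define f where "f = (\<lambda>\<tau>::real. real n * inverse (\<tau> ^ (n + 1)))"
  have "(\<integral>\<^sup>+ \<tau>. ennreal (f \<tau>) * indicator {a..} \<tau> \<partial>lborel)
        = ennreal (0 - (- inverse (a ^ n)))"
  proof (rule nn_integral_FTC_atLeast)
    show "f \<in> borel_measurable borel" unfolding f_def by measurable
    fix x :: real assume "a \<le> x"
    with assms have x: "x > 0" by simp
    show "((\<lambda>x. - inverse (x ^ n)) has_real_derivative f x) (at x)"
    proof -
      have "((\<lambda>x. x ^ n) has_real_derivative real n * x ^ (n - 1)) (at x)"
        using DERIV_pow[of n x] by simp
      from DERIV_minus[OF DERIV_inverse_fun[OF this]] x
      have "((\<lambda>x. - inverse (x ^ n)) has_real_derivative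
              real n * x ^ (n - 1) * inverse ((x ^ n)\<^sup>2)) (at x)"
        by (simp add: numeral_2_eq_2)
      moreover have "(x ^ n)\<^sup>2 = x ^ (n - 1) * x ^ (n + 1)"
        unfolding power_add[symmetric] power2_eq_square using assms by (intro arg_cong[where f="power x"]) simp
      moreover have "real n * x ^ (n - 1) * inverse (x ^ (n - 1) * x ^ (n + 1)) = f x"
        using x by (simp add: f_def mult.assoc[symmetric])
      ultimately show ?thesis by metis
    qed
    show "0 \<le> f x" using x by (simp add: f_def)
  next
    show "((\<lambda>x. - inverse (x ^ n)) \<longlongrightarrow> 0) (at_top :: real filter)"
      using tendsto_minus[OF tendsto_inverse_0_at_top[OF
            filterlim_pow_at_top[OF \<open>n > 0\<close> filterlim_ident]]] by simp
  qed
  thus ?thesis by (simp add: f_def)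
qed

text \<open>Polar coordinates by Tonelli's theorem and two substitutions. After unfolding the law of the direction, the right-hand
side is an integral over \<open>r > 0\<close> and over \<open>y\<close> in the unit ball of \<open>n * r ^ (n - 1) * F (r * sgn y)\<close>. The substitution
\<open>r = norm y * \<tau>\<close> for fixed \<open>y\<close>, and then \<open>z = \<tau> y\<close> for fixed \<open>\<tau>\<close>, turns it into the integral of
\<open>norm z ^ n * F z * n / \<tau> ^ (n + 1)\<close> over \<open>\<tau> > norm z\<close>, and the integral over \<open>\<tau>\<close> cancels \<open>norm z ^ n\<close>.\<close>

lemma nn_integral_polar:
  fixes F :: "'a::euclidean_space \<Rightarrow> ennreal"
  assumes [measurable]: "F \<in> borel_measurable borel"
  shows "(\<integral>\<^sup>+ z. F z \<partial>lborel) = emeasure lborel (ball (0::'a) 1) *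
     (\<integral>\<^sup>+ r. ennreal (DIM('a) * r ^ (DIM('a) - 1)) * indicator {0<..} r
        * (\<integral>\<^sup>+ s. F (r *\<^sub>R s) \<partial>direction_law) \<partial>lborel)"
proof -
  let ?n = "DIM('a)"
  define B where "B = ball (0::'a) 1"
  have [measurable]: "B \<in> sets borel" by (simp add: B_def)
  interpret D: prob_space "direction_law :: 'a measure" by (rule prob_space_direction_law)
  have n: "?n > 0" by simp
  let ?k = "\<lambda>r::real. ennreal (?n * r ^ (?n - 1)) * indicator {0<..} r"
  let ?l = "\<lambda>\<tau>::real. ennreal (?n * inverse (\<tau> ^ (?n + 1))) * indicator {0<..} \<tau>"
  let ?f = "\<lambda>\<tau>::real. \<lambda>y. ennreal (norm y ^ ?n) * F (\<tau> *\<^sub>R y) * indicator B y"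
  let ?g = "\<lambda>\<tau>::real. \<lambda>z::'a. ennreal (norm z ^ ?n) * F z * indicator (ball 0 \<tau>) z"
  let ?h = "\<lambda>r::real. \<lambda>y. F (r *\<^sub>R sgn y) * indicator B y"
  have AEnz: "AE z in lborel. z \<noteq> (0::'a)"
    by (rule AE_lborel_singleton)
  have "emeasure lborel B *
     (\<integral>\<^sup>+ r. ?k r
        * (\<integral>\<^sup>+ s. F (r *\<^sub>R s) \<partial>direction_law) \<partial>lborel)
     = (\<integral>\<^sup>+ r. ?k r
        * (emeasure lborel B * (\<integral>\<^sup>+ s. F (r *\<^sub>R s) \<partial>direction_law)) \<partial>lborel)"
    by (subst nn_integral_cmult[symmetric]) (auto intro!: nn_integral_cong simp: mult_ac)
  also have "\<dots> = (\<integral>\<^sup>+ r. (\<integral>\<^sup>+ y. ?k r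
        * ?h r y \<partial>lborel) \<partial>lborel)"
  proof (rule nn_integral_cong)
    fix r :: real
    have [measurable]: "(\<lambda>y::'a. F (r *\<^sub>R sgn y) * indicator B y) \<in> borel_measurable borel"
      by measurable
    show "?k r
        * (emeasure lborel B * (\<integral>\<^sup>+ s. F (r *\<^sub>R s) \<partial>direction_law)) = (\<integral>\<^sup>+ y. ?k r
        * ?h r y \<partial>lborel)"
      by (subst nn_integral_direction_law[of "\<lambda>s. F (r *\<^sub>R s)", folded B_def]) (simp, subst nn_integral_cmult, simp_all)
  qed
  also have "\<dots> = (\<integral>\<^sup>+ y. (\<integral>\<^sup>+ r. ?k r
        * ?h r y \<partial>lborel) \<partial>lborel)"
    by (rule lborel_pair.Fubini') measurable
  also have "\<dots> = (\<integral>\<^sup>+ y. (\<integral>\<^sup>+ \<tau>. ?k \<tau>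
        * ?f \<tau> y \<partial>lborel) \<partial>lborel)"
    \<comment> \<open>The substitution \<open>r = norm y * \<tau>\<close> removes the normalisation from \<open>sgn y\<close>.\<close>
  proof (rule nn_integral_cong_AE, use AEnz in eventually_elim)
    fix y :: 'a assume y: "y \<noteq> 0"
    have pw: "norm y * (norm y) ^ (?n - 1) = norm y ^ ?n"
      using n by (metis power_minus_mult mult.commute)
    show "(\<integral>\<^sup>+ r. ?k r
        * ?h r y \<partial>lborel) = (\<integral>\<^sup>+ \<tau>. ?k \<tau>
        * ?f \<tau> y \<partial>lborel)"
      apply (subst nn_integral_real_affine[where c="norm y" and t=0])
        apply measurable
      using y apply simp
      apply (subst nn_integral_cmult[symmetric])
       apply measurable
      apply (rule nn_integral_cong)
      subgoal for x
      proof (cases "x > 0")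
        case True
        have "ennreal (norm y) * ennreal (?n * (0 + norm y * x) ^ (?n - 1))
               = ennreal (?n * x ^ (?n - 1)) * ennreal (norm y ^ ?n)"
          using True by (simp add: ennreal_mult[symmetric] power_mult_distrib flip: pw)
        moreover have "(norm y * x) *\<^sub>R sgn y = x *\<^sub>R y" using y by (simp add: sgn_div_norm)
        ultimately show ?thesis
          using True y by (simp add: mult.assoc[symmetric])
      qed (use y in \<open>auto simp: indicator_def zero_less_mult_iff\<close>)
      done
  qed
  also have "\<dots> = (\<integral>\<^sup>+ \<tau>. (\<integral>\<^sup>+ y. ?k \<tau>
        * ?f \<tau> y \<partial>lborel) \<partial>lborel)"
    by (rule lborel_pair.Fubini') measurable
  also have "\<dots> = (\<integral>\<^sup>+ \<tau>. (\<integral>\<^sup>+ z. ?l \<tau>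
        * ?g \<tau> z \<partial>lborel) \<partial>lborel)"
    \<comment> \<open>The substitution \<open>z = \<tau> *\<^sub>R y\<close> turns the unit ball into the ball of radius \<open>\<tau>\<close>.\<close>
  proof (rule nn_integral_cong)
    fix \<tau> :: real
    show "(\<integral>\<^sup>+ y. ?k \<tau>
        * ?f \<tau> y \<partial>lborel)
      = (\<integral>\<^sup>+ z. ?l \<tau>
        * ?g \<tau> z \<partial>lborel)"
    proof (cases "\<tau> > 0")
      case True
      have pw: "\<tau> ^ (?n - 1) * \<tau> = \<tau> ^ ?n"
        using n by (metis power_minus_mult)
      have key: "?n * \<tau> ^ (?n - 1) = \<tau> ^ ?n * (?n * inverse (\<tau> ^ (?n + 1)) * \<tau> ^ ?n)"
        using True pw[symmetric] by (simp add: field_simps)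
      define g where "g z = ?l \<tau>
        * ?g \<tau> z" for z :: 'a
      have [measurable]: "g \<in> borel_measurable borel" unfolding g_def by measurable
      have g: "?k \<tau>
        * ?f \<tau> y = ennreal (\<tau> ^ ?n) * g (\<tau> *\<^sub>R y)" for y
      proof -
        have "indicator (ball 0 \<tau>) (\<tau> *\<^sub>R y) = (indicator (ball 0 1) y :: ennreal)"
          using True by (simp add: indicator_def)
        moreover have "ennreal (norm (\<tau> *\<^sub>R y) ^ ?n) = ennreal (\<tau> ^ ?n) * ennreal (norm y ^ ?n)"
          using True by (simp add: power_mult_distrib ennreal_mult)
        moreover have "ennreal (?n * \<tau> ^ (?n - 1)) = ennreal (\<tau> ^ ?n)
            * (ennreal (?n * inverse (\<tau> ^ (?n + 1))) * ennreal (\<tau> ^ ?n))"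
          using True by (subst key) (simp add: ennreal_mult[symmetric] del: power_Suc)
        ultimately show ?thesis by (simp only: g_def B_def mult_ac)
      qed
      show ?thesis
        unfolding g unfolding g_def[symmetric]
        by (simp add: nn_integral_cmult nn_integral_lborel_scaleR[OF _ True, of g])
    qed simp
  qed
  also have "\<dots> = (\<integral>\<^sup>+ z. (\<integral>\<^sup>+ \<tau>. ?l \<tau>
        * ?g \<tau> z \<partial>lborel) \<partial>lborel)"
  proof (rule lborel_pair.Fubini')
    have "Measurable.pred (borel \<Otimes>\<^sub>M borel) (\<lambda>p. norm (fst p :: 'a) < snd p)" by measurable
    then have [measurable]: "(\<lambda>p. indicator (ball 0 (snd p)) (fst p :: 'a) :: ennreal) \<in> borel_measurable (borel \<Otimes>\<^sub>M borel)"
      unfolding indicator_def by (simp add: measurable_If)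
    show "(\<lambda>(z, \<tau>). ?l \<tau>
        * ?g \<tau> z) \<in> borel_measurable (lborel \<Otimes>\<^sub>M lborel)"
      unfolding split_beta by measurable
  qed
  also have "\<dots> = (\<integral>\<^sup>+ z. F z \<partial>lborel)"
  proof (rule nn_integral_cong_AE, use AEnz in eventually_elim)
    fix z :: 'a assume z: "z \<noteq> 0"
    have "(\<integral>\<^sup>+ \<tau>. ?l \<tau>
        * ?g \<tau> z \<partial>lborel)
        = (\<integral>\<^sup>+ \<tau>. (ennreal (norm z ^ ?n) * F z) * (ennreal (?n * inverse (\<tau> ^ (?n + 1))) * indicator {norm z..} \<tau>) \<partial>lborel)"
    proof (rule nn_integral_cong_AE, use AE_lborel_singleton[of "norm z"] in eventually_elim)
      fix \<tau> :: real assume "\<tau> \<noteq> norm z"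
      moreover have "\<tau> > 0" if "\<tau> > norm z" using that norm_ge_zero[of z] by linarith
      ultimately show "?l \<tau>
        * ?g \<tau> z = (ennreal (norm z ^ ?n) * F z) * (ennreal (?n * inverse (\<tau> ^ (?n + 1))) * indicator {norm z..} \<tau>)"
        by (auto simp: indicator_def mult_ac)
    qed
    also have "\<dots> = (ennreal (norm z ^ ?n) * F z) * ennreal (inverse (norm z ^ ?n))"
      using z by (subst nn_integral_cmult, measurable, subst nn_integral_radial_tail) simp_all
    also have "\<dots> = F z"
      using z by (simp add: mult_ac ennreal_mult[symmetric] mult.assoc[symmetric])
    finally show "(\<integral>\<^sup>+ \<tau>. ?l \<tau>
        * ?g \<tau> z \<partial>lborel) = F z" .
  qed
  finally show ?thesis by (simp add: B_def)
qed

section \<open>The chord length between two random directions\<close>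

lemma AE_direction_law_norm: "AE s in (direction_law :: 'a::euclidean_space measure). norm s = 1"
proof -
  have "AE x in lborel. x \<noteq> (0::'a)" by (rule AE_lborel_singleton)
  hence "AE x in uniform_measure lborel (ball (0::'a) 1). x \<noteq> 0"
    by (intro AE_uniform_measureI) auto
  hence "AE x in uniform_measure lborel (ball (0::'a) 1). norm (sgn x) = 1"
    by eventually_elim (simp add: norm_sgn)
  thus ?thesis
    unfolding direction_law_def by (subst AE_distr_iff) simp_all
qed

text \<open>The chord between two unit vectors at angle \<open>\<theta>\<close> has squared length \<open>4 * (sin (\<theta> / 2))\<^sup>2\<close>, hence the factor \<open>4\<close>.\<close>

definition chord_cdf :: "'a::euclidean_space itself \<Rightarrow> real \<Rightarrow> real" where
  "chord_cdf _ k = measure (direction_law \<Otimes>\<^sub>M direction_law) {p :: 'a \<times> 'a. (dist (fst p) (snd p))\<^sup>2 \<le> 4 * k}"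

text \<open>The same probability for two independent points of the unit ball, where nonempty open sets are known to have
positive measure.\<close>

lemma chord_cdf_ball:
  defines "P \<equiv> uniform_measure lborel (ball (0::'a::euclidean_space) 1)"
  shows "chord_cdf TYPE('a) k = measure (P \<Otimes>\<^sub>M P) {p. (dist (sgn (fst p)) (sgn (snd p)))\<^sup>2 \<le> 4 * k}"
proof -
  interpret P: prob_space P
    unfolding P_def by (rule prob_space_uniform_measure) (use emeasure_unit_ball[where 'a='a] in auto)
  interpret D: prob_space "direction_law :: 'a measure" by (rule prob_space_direction_law)
  have [measurable_cong]: "sets P = sets borel" by (simp add: P_def)
  have sp: "space (P \<Otimes>\<^sub>M P) = UNIV" by (simp add: P_def space_pair_measure)
  have dl: "direction_law = distr P borel sgn" by (simp add: P_def direction_law_def)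
  have [measurable]: "(\<lambda>(x, y). (sgn x, sgn y :: 'a)) \<in> P \<Otimes>\<^sub>M P \<rightarrow>\<^sub>M borel \<Otimes>\<^sub>M borel"
    by measurable
  have eq: "direction_law \<Otimes>\<^sub>M direction_law = distr (P \<Otimes>\<^sub>M P) (borel \<Otimes>\<^sub>M borel) (\<lambda>(x, y). (sgn x, sgn y :: 'a))"
    unfolding dl
    by (rule pair_measure_distr) (auto simp: dl[symmetric] D.sigma_finite_measure_axioms, measurable)
  have "{p :: 'a \<times> 'a. (dist (fst p) (snd p))\<^sup>2 \<le> 4 * k} \<in> sets (borel \<Otimes>\<^sub>M borel)"
  proof -
    have "{p \<in> space (borel \<Otimes>\<^sub>M borel). (dist (fst p) (snd p :: 'a))\<^sup>2 \<le> 4 * k} \<in> sets (borel \<Otimes>\<^sub>M borel)"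
      by measurable
    thus ?thesis by (simp add: space_pair_measure)
  qed
  thus ?thesis
    unfolding chord_cdf_def eq by (subst measure_distr) (auto simp: sp split_beta' vimage_def)
qed

lemma prob_space_uniform_ball:
  "prob_space (uniform_measure lborel (ball (0::'a::euclidean_space) 1))"
  by (rule prob_space_uniform_measure) (use emeasure_unit_ball[where 'a='a] in auto)

lemma link_law_chord_cdf: "link_law (chord_cdf TYPE('a::euclidean_space))"
proof -
  define P where "P = uniform_measure lborel (ball (0::'a) 1)"
  interpret P: prob_space P unfolding P_def by (rule prob_space_uniform_ball)
  interpret PP: prob_space "P \<Otimes>\<^sub>M P" by (rule prob_space_pair) unfold_locales
  have [measurable_cong]: "sets P = sets borel" by (simp add: P_def)
  have sp: "space (P \<Otimes>\<^sub>M P) = UNIV" by (simp add: P_def space_pair_measure)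
  define A where "A k = {p :: 'a \<times> 'a. (dist (sgn (fst p)) (sgn (snd p)))\<^sup>2 \<le> 4 * k}" for k
  have A: "A k \<in> sets (P \<Otimes>\<^sub>M P)" for k
  proof -
    have "{p \<in> space (P \<Otimes>\<^sub>M P). (dist (sgn (fst p)) (sgn (snd p) :: 'a))\<^sup>2 \<le> 4 * k} \<in> sets (P \<Otimes>\<^sub>M P)"
      by measurable
    thus ?thesis by (simp add: sp A_def)
  qed
  have c: "chord_cdf TYPE('a) k = measure (P \<Otimes>\<^sub>M P) (A k)" for k
    unfolding A_def P_def by (rule chord_cdf_ball)
  show ?thesis
  proof
    show "mono (chord_cdf TYPE('a))"
      by (rule monoI, unfold c, rule PP.finite_measure_mono[OF _ A]) (auto simp: A_def)
    show "0 \<le> chord_cdf TYPE('a) k" "chord_cdf TYPE('a) k \<le> 1" for k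
      unfolding c by auto
    show "chord_cdf TYPE('a) k = 1" if "1 \<le> k" for k
    proof -
      have "dist (sgn x) (sgn y) \<le> 2" for x y :: 'a
        using dist_triangle[of "sgn x" "sgn y" 0] norm_sgn[of x] norm_sgn[of y] by (auto split: if_splits)
      hence "(dist (sgn x) (sgn y))\<^sup>2 \<le> 2\<^sup>2" for x y :: 'a
        by (intro power_mono) auto
      moreover have "(2::real)\<^sup>2 \<le> 4 * k" using that by simp
      ultimately have "(dist (sgn x) (sgn y))\<^sup>2 \<le> 4 * k" for x y :: 'a
        by (rule order_trans)
      hence "A k = space (P \<Otimes>\<^sub>M P)"
        unfolding A_def sp by blast
      thus ?thesis unfolding c by (simp add: PP.prob_space)
    qed
  qed
qed

text \<open>In dimension at least \<open>2\<close> there are unit vectors at every angle. Around a pair whose chord has squared length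
\<open>2 * (k + l)\<close>, strictly between \<open>4 * k\<close> and \<open>4 * l\<close>, a whole product of open sets has chords in that range.\<close>

lemma chord_cdf_strict_mono:
  assumes dim: "2 \<le> DIM('a::euclidean_space)" and kl: "0 \<le> k" "k < l" "l \<le> 1"
  shows "chord_cdf TYPE('a) k < chord_cdf TYPE('a) l"
proof -
  define P where "P = uniform_measure lborel (ball (0::'a) 1)"
  interpret P: prob_space P unfolding P_def by (rule prob_space_uniform_ball)
  interpret PP: prob_space "P \<Otimes>\<^sub>M P" by (rule prob_space_pair) unfold_locales
  have setsP [measurable_cong]: "sets P = sets borel" by (simp add: P_def)
  have sp: "space (P \<Otimes>\<^sub>M P) = UNIV" by (simp add: P_def space_pair_measure)
  define \<phi> where "\<phi> p = (dist (sgn (fst p)) (sgn (snd p) :: 'a))\<^sup>2" for p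
  have meas: "{p. \<phi> p \<le> t} \<in> sets (P \<Otimes>\<^sub>M P)" for t
  proof -
    have "{p \<in> space (P \<Otimes>\<^sub>M P). \<phi> p \<le> t} \<in> sets (P \<Otimes>\<^sub>M P)" unfolding \<phi>_def by measurable
    thus ?thesis by (simp add: sp)
  qed
  (* The cosine of the angle for which the squared chord 2 - 2 * c is 2 * (k + l). *)
  define c where "c = 1 - (k + l)"
  have c: "-1 < c" "c < 1" using kl by (auto simp: c_def)
  obtain e :: 'a where e: "norm e = 1" using vector_choose_size[of 1] by auto
  obtain f' :: 'a where f': "f' \<noteq> 0" "orthogonal e f'"
    using orthogonal_to_vector_exists[OF dim, of e] by auto
  define f where "f = sgn f'"
  have f: "norm f = 1" "e \<bullet> f = 0"
    using f' by (auto simp: f_def norm_sgn sgn_div_norm orthogonal_def)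
  define g where "g = c *\<^sub>R e + sqrt (1 - c\<^sup>2) *\<^sub>R f"
  have c2: "0 \<le> 1 - c\<^sup>2" using c by (simp add: abs_square_le_1 abs_le_iff)
  have g: "norm g = 1" "e \<bullet> g = c"
    using e f c2 by (auto simp: g_def norm_eq_sqrt_inner inner_add_left inner_add_right inner_commute[of f e]
        power2_eq_square[symmetric])
  have "0 \<le> 2 * k + 2 * l" using kl by simp
  hence "(dist e g)\<^sup>2 = 2 * (k + l)"
    using e g by (simp add: dist_norm power2_norm_eq_inner inner_diff_left inner_diff_right inner_commute[of g e]
        norm_eq_sqrt_inner c_def)
  moreover have "sgn (e /\<^sub>R 2) = e" "sgn (g /\<^sub>R 2) = g"
    using e g by (auto simp: sgn_div_norm)
  ultimately have p0: "\<phi> (e /\<^sub>R 2, g /\<^sub>R 2) = 2 * (k + l)" by (simp add: \<phi>_def)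
  define N where "N = (UNIV - {0::'a}) \<times> (UNIV - {0::'a})"
  define N_ball where "N_ball = (\<phi> -` {4 * k<..<4 * l} \<inter> N) \<inter> ball 0 1 \<times> ball 0 1"
  have "open N" unfolding N_def by (intro open_Times open_delete open_UNIV)
  have "continuous_on N \<phi>"
    unfolding \<phi>_def sgn_div_norm N_def by (intro continuous_intros) auto
  hence "open N_ball"
    unfolding N_ball_def using \<open>open N\<close>
    by (intro open_Int open_Times open_ball continuous_on_open_vimage[THEN iffD1, rule_format]) auto
  moreover have "(e /\<^sub>R 2, g /\<^sub>R 2) \<in> N_ball"
    unfolding N_ball_def N_def using p0 e g kl by auto
  ultimately obtain A B where AB: "open A" "open B" "(e /\<^sub>R 2, g /\<^sub>R 2) \<in> A \<times> B" "A \<times> B \<subseteq> N_ball"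
    by (rule open_prod_elim)
  have pos: "0 < emeasure P C" if "open C" "C \<noteq> {}" "C \<subseteq> ball 0 1" for C
  proof -
    have "emeasure lborel C \<noteq> 0"
      using open_not_negligible[OF that(1,2)] that(1) by (auto simp: negligible_iff_emeasure0)
    moreover have "ball 0 1 \<inter> C = C" using that(3) by auto
    ultimately show ?thesis
      using that(1) emeasure_unit_ball[where 'a='a] unfolding P_def
      by (simp add: ennreal_zero_less_divide less_top zero_less_iff_neq_zero)
  qed
  have ABsets: "A \<in> sets P" "B \<in> sets P" using AB by (auto simp: setsP)
  have "A \<subseteq> ball 0 1" "B \<subseteq> ball 0 1" using AB(3,4) by (auto simp: N_ball_def)
  hence "0 < emeasure P A * emeasure P B"
    using pos[of A] pos[of B] AB by (auto simp: ennreal_zero_less_mult_iff)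
  hence "0 < emeasure (P \<Otimes>\<^sub>M P) (A \<times> B)"
    using ABsets by (simp add: P.emeasure_pair_measure_Times)
  hence "0 < measure (P \<Otimes>\<^sub>M P) (A \<times> B)"
    by (simp add: PP.emeasure_eq_measure)
  moreover have "measure (P \<Otimes>\<^sub>M P) {p. \<phi> p \<le> 4 * k} + measure (P \<Otimes>\<^sub>M P) (A \<times> B)
      = measure (P \<Otimes>\<^sub>M P) ({p. \<phi> p \<le> 4 * k} \<union> A \<times> B)"
    using AB(4) meas ABsets by (intro PP.finite_measure_Union[symmetric]) (auto simp: N_ball_def)
  moreover have "\<dots> \<le> measure (P \<Otimes>\<^sub>M P) {p. \<phi> p \<le> 4 * l}"
    using AB(4) kl by (intro PP.finite_measure_mono meas) (auto simp: N_ball_def)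
  ultimately show ?thesis
    unfolding chord_cdf_ball P_def[symmetric] \<phi>_def by simp
qed

section \<open>Reduction to a radial double integral\<close>

lemma nn_integral_unif01:
  assumes [measurable]: "f \<in> borel_measurable borel"
  shows "(\<integral>\<^sup>+ u. f u \<partial>unif01) = (\<integral>\<^sup>+ u. f u * indicator {0..1} u \<partial>lborel)"
proof -
  have "(\<integral>\<^sup>+ u. f u \<partial>unif01) = (\<integral>\<^sup>+ u. f u * indicator {0<..<1} u \<partial>lborel)"
    unfolding unif01_def by (subst nn_integral_restrict_space) simp_all
  also have "\<dots> = (\<integral>\<^sup>+ u. f u * indicator {0..1} u \<partial>lborel)"
    by (rule nn_integral_cong_AE, use AE_lborel_singleton[of 0] AE_lborel_singleton[of 1] in eventually_elim)
       (auto simp: indicator_def)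
  finally show ?thesis .
qed

text \<open>The integral of \<open>F\<close> over a ball in coordinates \<open>(u, \<sigma>)\<close>, up to a constant: \<open>R u\<close> is the Euclidean norm of a point with
normalised radius \<open>u\<close>, and \<open>s u\<close> is proportional to the length of a circle of normalised radius \<open>u\<close>.\<close>

definition polar_integral :: "(real \<Rightarrow> real) \<Rightarrow> (real \<Rightarrow> real) \<Rightarrow> ('a::euclidean_space \<Rightarrow> ennreal) \<Rightarrow> ennreal" where
  "polar_integral R s F = (\<integral>\<^sup>+ u. ennreal (s u ^ (DIM('a) - 1)) *
     (\<integral>\<^sup>+ \<sigma>. F (R u *\<^sub>R \<sigma>) \<partial>direction_law) \<partial>unif01)"

lemma borel_measurable_sphere_average [measurable]:
  fixes F :: "'a::euclidean_space \<Rightarrow> ennreal"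
  assumes [measurable]: "F \<in> borel_measurable borel"
  shows "(\<lambda>r. \<integral>\<^sup>+ s. F (r *\<^sub>R s) \<partial>direction_law) \<in> borel_measurable borel"
proof -
  interpret D: prob_space "direction_law :: 'a measure" by (rule prob_space_direction_law)
  show ?thesis by (rule D.borel_measurable_nn_integral) measurable
qed

text \<open>Polar coordinates followed by the substitution \<open>r = R u\<close>. The hypothesis \<open>weight\<close> says that the density \<open>w\<close>, the
Jacobian of polar coordinates and the derivative of \<open>R\<close> combine to a multiple of \<open>s u ^ (n - 1)\<close>.\<close>

lemma nn_integral_radial_density:
  fixes F :: "'a::euclidean_space \<Rightarrow> ennreal" and w R R' s :: "real \<Rightarrow> real"
  assumes [measurable]: "F \<in> borel_measurable borel" "w \<in> borel_measurable borel" "s \<in> borel_measurable borel"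
    and R0: "R 0 = 0" and C: "0 \<le> C"
    and der: "\<And>u. u \<in> {0..1} \<Longrightarrow> (R has_real_derivative R' u) (at u)"
    and contR': "continuous_on {0..1} R'" and posR': "\<And>u. u \<in> {0..1} \<Longrightarrow> 0 \<le> R' u"
    and weight: "\<And>u. u \<in> {0..1} \<Longrightarrow> DIM('a) * R u ^ (DIM('a) - 1) * w (R u) * R' u = C * s u ^ (DIM('a) - 1)"
    and nonneg: "\<And>u. u \<in> {0..1} \<Longrightarrow> 0 \<le> s u" "\<And>r. r \<in> {0..R 1} \<Longrightarrow> 0 \<le> w r"
    and [measurable]: "R \<in> borel_measurable borel"
  shows "(\<integral>\<^sup>+ x. ennreal (w (norm x)) * indicator (cball 0 (R 1)) x * F x \<partial>lborel)
    = emeasure lborel (ball (0::'a) 1) * ennreal C * polar_integral R s F"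
proof -
  let ?n = "DIM('a)"
  define \<Phi> where "\<Phi> r = (\<integral>\<^sup>+ \<sigma>. F (r *\<^sub>R \<sigma>) \<partial>direction_law)" for r
  have [measurable]: "\<Phi> \<in> borel_measurable borel" unfolding \<Phi>_def by measurable
  have [measurable]: "cball (0::'a) r \<in> sets borel" for r by simp
  have mono: "R u \<le> R v" if "0 \<le> u" "u \<le> v" "v \<le> 1" for u v
    using that der posR' by (intro DERIV_nonneg_imp_nondecreasing[OF that(2)]) (meson atLeastAtMost_iff order_trans)
  have Rrange: "0 \<le> R u" "R u \<le> R 1" if "u \<in> {0..1}" for u
    using mono[of 0 u] mono[of u 1] that R0 by auto
  have "(\<integral>\<^sup>+ x. ennreal (w (norm x)) * indicator (cball 0 (R 1)) x * F x \<partial>lborel)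
    = emeasure lborel (ball (0::'a) 1) * (\<integral>\<^sup>+ r. ennreal (?n * r ^ (?n - 1)) * indicator {0<..} r
        * (\<integral>\<^sup>+ \<sigma>. ennreal (w (norm (r *\<^sub>R \<sigma>))) * indicator (cball 0 (R 1)) (r *\<^sub>R \<sigma>) * F (r *\<^sub>R \<sigma>) \<partial>direction_law) \<partial>lborel)"
    by (rule nn_integral_polar) measurable
  also have "(\<integral>\<^sup>+ r. ennreal (?n * r ^ (?n - 1)) * indicator {0<..} r
        * (\<integral>\<^sup>+ \<sigma>. ennreal (w (norm (r *\<^sub>R \<sigma>))) * indicator (cball 0 (R 1)) (r *\<^sub>R \<sigma>) * F (r *\<^sub>R \<sigma>) \<partial>direction_law) \<partial>lborel)
     = (\<integral>\<^sup>+ r. (ennreal (?n * r ^ (?n - 1) * w r) * \<Phi> r) * indicator {R 0..R 1} r \<partial>lborel)"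
  proof (rule nn_integral_cong_AE, use AE_lborel_singleton[of 0] in eventually_elim)
    fix r :: real assume "r \<noteq> 0"
    show "ennreal (?n * r ^ (?n - 1)) * indicator {0<..} r
        * (\<integral>\<^sup>+ \<sigma>. ennreal (w (norm (r *\<^sub>R \<sigma>))) * indicator (cball 0 (R 1)) (r *\<^sub>R \<sigma>) * F (r *\<^sub>R \<sigma>) \<partial>direction_law)
        = (ennreal (?n * r ^ (?n - 1) * w r) * \<Phi> r) * indicator {R 0..R 1} r"
    proof (cases "0 < r")
      case True
      have "(\<integral>\<^sup>+ \<sigma>. ennreal (w (norm (r *\<^sub>R \<sigma>))) * indicator (cball 0 (R 1)) (r *\<^sub>R \<sigma>) * F (r *\<^sub>R \<sigma>) \<partial>(direction_law :: 'a measure))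
          = (\<integral>\<^sup>+ \<sigma>. (ennreal (w r) * indicator {..R 1} r) * F (r *\<^sub>R \<sigma>) \<partial>direction_law)"
        by (rule nn_integral_cong_AE, use AE_direction_law_norm in eventually_elim)
           (use True in \<open>auto simp: indicator_def\<close>)
      also have "\<dots> = ennreal (w r) * indicator {..R 1} r * \<Phi> r"
        unfolding \<Phi>_def by (rule nn_integral_cmult) measurable
      finally show ?thesis
        using True R0 nonneg(2)[of r] by (auto simp: indicator_def ennreal_mult mult_ac)
    qed (use \<open>r \<noteq> 0\<close> R0 in auto)
  qed
  also have "\<dots> = (\<integral>\<^sup>+ u. (ennreal (?n * R u ^ (?n - 1) * w (R u)) * \<Phi> (R u)) * ennreal (R' u) * indicator {0..1} u \<partial>lborel)"
    by (rule nn_integral_substitution_aux) (use der contR' posR' in auto)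
  also have "\<dots> = (\<integral>\<^sup>+ u. ennreal C * (ennreal (s u ^ (?n - 1)) * \<Phi> (R u) * indicator {0..1} u) \<partial>lborel)"
  proof (rule nn_integral_cong)
    fix u :: real
    show "(ennreal (?n * R u ^ (?n - 1) * w (R u)) * \<Phi> (R u)) * ennreal (R' u) * indicator {0..1} u
      = ennreal C * (ennreal (s u ^ (?n - 1)) * \<Phi> (R u) * indicator {0..1} u)"
    proof (cases "u \<in> {0..1}")
      case True
      have "ennreal (?n * R u ^ (?n - 1) * w (R u)) * ennreal (R' u) = ennreal (C * s u ^ (?n - 1))"
        unfolding weight[OF True, symmetric]
        using True Rrange[OF True] nonneg(2)[of "R u"] posR'[OF True] by (subst ennreal_mult) auto
      also have "\<dots> = ennreal C * ennreal (s u ^ (?n - 1))"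
        using C nonneg(1)[OF True] by (intro ennreal_mult) auto
      finally have e: "ennreal (?n * R u ^ (?n - 1) * w (R u)) * ennreal (R' u) = ennreal C * ennreal (s u ^ (?n - 1))" .
      have "(ennreal (?n * R u ^ (?n - 1) * w (R u)) * \<Phi> (R u)) * ennreal (R' u)
          = (ennreal (?n * R u ^ (?n - 1) * w (R u)) * ennreal (R' u)) * \<Phi> (R u)"
        by (simp only: mult_ac)
      thus ?thesis unfolding e using True by (simp only: indicator_simps mult_1_right mult.assoc)
    qed simp
  qed
  also have "\<dots> = ennreal C * (\<integral>\<^sup>+ u. ennreal (s u ^ (?n - 1)) * \<Phi> (R u) * indicator {0..1} u \<partial>lborel)"
    by (rule nn_integral_cmult) measurable
  also have "(\<integral>\<^sup>+ u. ennreal (s u ^ (?n - 1)) * \<Phi> (R u) * indicator {0..1} u \<partial>lborel)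
     = (\<integral>\<^sup>+ u. ennreal (s u ^ (?n - 1)) * \<Phi> (R u) \<partial>unif01)"
    by (rule nn_integral_unif01[symmetric]) measurable
  finally show ?thesis by (simp add: \<Phi>_def polar_integral_def mult.assoc)
qed

text \<open>Direction and normalised radius of a point with law \<open>P\<close> are independent, the direction is uniform and the
radius has density proportional to \<open>s u ^ (d - 1)\<close>. This is stated with an unspecified constant, which is determined
by total mass \<open>1\<close>.\<close>

definition radial_law :: "'a::euclidean_space measure \<Rightarrow> (real \<Rightarrow> real) \<Rightarrow> (real \<Rightarrow> real) \<Rightarrow> bool" where
  "radial_law P R s \<longleftrightarrow> prob_space P \<and> (\<lambda>x. x) \<in> P \<rightarrow>\<^sub>M borel \<and>
     (\<exists>K. \<forall>F\<in>borel_measurable borel. (\<integral>\<^sup>+ x. F x \<partial>P) = K * polar_integral R s F)"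

text \<open>Integrate in the order \<open>u\<close>, \<open>v\<close>, \<open>\<sigma>\<close>, \<open>\<tau>\<close>. By hypothesis \<open>Q\<close> the two inner integrals give the distribution function of
the chord length. The remaining work is measurability and the passage from nonnegative to real-valued integrals.\<close>

theorem measure_pair_radial_law:
  fixes P :: "'a::euclidean_space measure"
  assumes P: "radial_law P R s" and s: "sine_like s" and [measurable]: "R \<in> borel_measurable borel"
    and Q: "\<And>u v \<sigma> \<tau>. u \<in> {0<..<1} \<Longrightarrow> v \<in> {0<..<1} \<Longrightarrow> norm \<sigma> = 1 \<Longrightarrow> norm \<tau> = 1 \<Longrightarrow>
          Q (R u *\<^sub>R \<sigma>) (R v *\<^sub>R \<tau>) \<longleftrightarrow> (dist \<sigma> \<tau>)\<^sup>2 \<le> 4 * sine_ratio s u v"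
    and Qm [measurable]: "Measurable.pred (borel \<Otimes>\<^sub>M borel) (\<lambda>p. Q (fst p) (snd p))"
  shows "measure (P \<Otimes>\<^sub>M P) {p \<in> space (P \<Otimes>\<^sub>M P). Q (fst p) (snd p)}
       = cluster_integral (DIM('a) - 1) (chord_cdf TYPE('a)) s"
proof -
  let ?m = "DIM('a) - 1"
  interpret U: prob_space unif01 by (rule prob_space_unif01)
  interpret D: prob_space "direction_law :: 'a measure" by (rule prob_space_direction_law)
  interpret DD: pair_prob_space "direction_law :: 'a measure" "direction_law :: 'a measure" by unfold_locales
  interpret DU: pair_sigma_finite "direction_law :: 'a measure" unif01 by unfold_locales
  interpret P: prob_space P using P by (simp add: radial_law_def)
  interpret L: link_law "chord_cdf TYPE('a)" by (rule link_law_chord_cdf)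
  obtain K where K: "\<And>F. F \<in> borel_measurable borel \<Longrightarrow> (\<integral>\<^sup>+ x. F x \<partial>P) =
        K * (\<integral>\<^sup>+ u. ennreal (s u ^ ?m) * (\<integral>\<^sup>+ \<sigma>. F (R u *\<^sub>R \<sigma>) \<partial>direction_law) \<partial>unif01)"
    using P unfolding radial_law_def polar_integral_def by blast
  have [measurable]: "s \<in> borel_measurable borel" by (rule sine_like_measurable[OF s])
  have Pm: "(\<lambda>x. x) \<in> P \<rightarrow>\<^sub>M borel" using P by (simp add: radial_law_def)
  have idU: "(\<lambda>x. x) \<in> unif01 \<rightarrow>\<^sub>M borel" by (rule measurable_unif01) simp
  define q where "q x y = (indicator {p. Q (fst p) (snd p)} (x, y) :: ennreal)" for x y
  let ?U = "unif01" and ?w = "\<lambda>u. ennreal (s u ^ ?m)"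
  let ?H = "\<lambda>x v. \<integral>\<^sup>+ \<tau>. q x (R v *\<^sub>R \<tau>) \<partial>direction_law"
  have qm [measurable]: "(\<lambda>(x, y). q x y) \<in> borel_measurable (borel \<Otimes>\<^sub>M borel)"
    unfolding q_def indicator_def split_beta' by simp
  have PPm: "(\<lambda>p. (fst p, snd p)) \<in> P \<Otimes>\<^sub>M P \<rightarrow>\<^sub>M borel \<Otimes>\<^sub>M borel"
    by (intro measurable_Pair measurable_compose[OF measurable_fst Pm] measurable_compose[OF measurable_snd Pm])
  note bnd = sine_like_power(1,2)[OF s, where m = ?m] and intS = sine_like_power(3)[OF s, of ?m]
  define I where "I = (\<integral>u. s u ^ ?m \<partial>?U)"
  have Ipos: "0 < I" unfolding I_def by (rule sine_like_power(4)[OF s])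
  (* Taking F = 1 determines the constant. *)
  have KI: "K * ennreal I = 1"
  proof -
    have "1 = (\<integral>\<^sup>+ x. 1 \<partial>P)" by (simp add: P.emeasure_space_1)
    also have "\<dots> = K * (\<integral>\<^sup>+ u. ?w u \<partial>?U)"
      by (subst K) (simp_all add: D.emeasure_space_1[simplified])
    also have "(\<integral>\<^sup>+ u. ?w u \<partial>?U) = ennreal I"
      unfolding I_def by (rule sine_like_power(5)[OF s])
    finally show ?thesis by simp
  qed
  define G where "G u v = chord_cdf TYPE('a) (sine_ratio s u v)" for u v
  have Gm [measurable]: "(\<lambda>(u, v). G u v) \<in> borel_measurable (borel \<Otimes>\<^sub>M borel)"
    unfolding G_def sine_ratio_def by measurable
  have G01: "0 \<le> G u v" "G u v \<le> 1" for u v by (auto simp: G_def L.nonneg L.le_1)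
  define V where "V u \<sigma> = (\<integral>\<^sup>+ v. ?w v * ?H (R u *\<^sub>R \<sigma>) v \<partial>?U)" for u \<sigma>
  (* V u \<sigma> is the integral over the second point; exchanging v with \<sigma> leaves the chord probability inside. *)
  have V: "(\<integral>\<^sup>+ \<sigma>. V u \<sigma> \<partial>direction_law) = (\<integral>\<^sup>+ v. ?w v * ennreal (G u v) \<partial>?U)"
    if u: "u \<in> {0<..<1}" for u
  proof -
    have m1: "(\<lambda>p. \<integral>\<^sup>+ \<tau>. q (R u *\<^sub>R fst p) (R (snd p) *\<^sub>R \<tau>) \<partial>direction_law) \<in> borel_measurable (borel \<Otimes>\<^sub>M borel)"
      by (rule D.borel_measurable_nn_integral) measurable
    have m2: "(\<lambda>p. (fst p, snd p)) \<in> direction_law \<Otimes>\<^sub>M ?U \<rightarrow>\<^sub>M borel \<Otimes>\<^sub>M borel"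
      by (intro measurable_Pair measurable_compose[OF measurable_snd idU]) measurable
    have "(\<integral>\<^sup>+ \<sigma>. V u \<sigma> \<partial>direction_law)
       = (\<integral>\<^sup>+ v. \<integral>\<^sup>+ \<sigma>. ?w v * ?H (R u *\<^sub>R \<sigma>) v \<partial>direction_law \<partial>?U)"
      unfolding V_def
      by (rule DU.Fubini'[symmetric])
         (use measurable_compose[OF m2, OF borel_measurable_times_ennreal[OF _ m1], of "\<lambda>p. ennreal (s (snd p) ^ ?m)"] in \<open>simp add: split_beta'\<close>)
    also have "\<dots> = (\<integral>\<^sup>+ v. ?w v * ennreal (G u v) \<partial>?U)"
    proof (rule nn_integral_cong)
      fix v assume "v \<in> space ?U"
      hence v: "v \<in> {0<..<1}" by simp
      let ?A = "{p :: 'a \<times> 'a. (dist (fst p) (snd p))\<^sup>2 \<le> 4 * sine_ratio s u v}"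
      have A: "?A \<in> sets (direction_law \<Otimes>\<^sub>M direction_law)"
      proof -
        have "{p \<in> space (borel \<Otimes>\<^sub>M borel). (dist (fst p) (snd p :: 'a))\<^sup>2 \<le> 4 * sine_ratio s u v} \<in> sets (borel \<Otimes>\<^sub>M borel)"
          by measurable
        thus ?thesis by (simp add: space_pair_measure cong: sets_pair_measure_cong)
      qed
      have "(\<integral>\<^sup>+ \<sigma>. ?w v * ?H (R u *\<^sub>R \<sigma>) v \<partial>direction_law)
        = ?w v * (\<integral>\<^sup>+ \<sigma>. ?H (R u *\<^sub>R \<sigma>) v \<partial>direction_law)"
        by (rule nn_integral_cmult, rule D.borel_measurable_nn_integral) measurable
      also have "(\<integral>\<^sup>+ \<sigma>. ?H (R u *\<^sub>R \<sigma>) v \<partial>direction_law)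
        = (\<integral>\<^sup>+ \<sigma>. (\<integral>\<^sup>+ \<tau>. indicator ?A (\<sigma>, \<tau>) \<partial>direction_law) \<partial>direction_law)"
      proof (rule nn_integral_cong_AE, use AE_direction_law_norm in eventually_elim)
        fix \<sigma> :: 'a assume \<sigma>: "norm \<sigma> = 1"
        show "?H (R u *\<^sub>R \<sigma>) v = (\<integral>\<^sup>+ \<tau>. indicator ?A (\<sigma>, \<tau>) \<partial>direction_law)"
          by (rule nn_integral_cong_AE, use AE_direction_law_norm in eventually_elim)
             (simp add: q_def indicator_def Q[OF u v \<sigma>])
      qed
      also have "\<dots> = emeasure (direction_law \<Otimes>\<^sub>M direction_law) ?A"
        using A by (rule D.emeasure_pair_measure[symmetric])
      also have "\<dots> = ennreal (G u v)"
        by (simp add: G_def chord_cdf_def DD.P.emeasure_eq_measure)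
      finally show "(\<integral>\<^sup>+ \<sigma>. ?w v * ?H (R u *\<^sub>R \<sigma>) v \<partial>direction_law)
         = ?w v * ennreal (G u v)" .
    qed
    finally show ?thesis .
  qed
  have intG: "integrable ?U (\<lambda>v. s v ^ ?m * G u v)" for u
  proof (rule bounded_integrable[of _ "s 1 ^ ?m"])
    show "(\<lambda>v. s v ^ ?m * G u v) \<in> borel_measurable ?U"
      by (rule measurable_unif01) measurable
    fix x :: real assume "0 < x" "x < 1"
    thus "\<bar>s x ^ ?m * G u x\<bar> \<le> s 1 ^ ?m"
      using bnd[of x] G01[of u x] mult_mono[of "s x ^ ?m" "s 1 ^ ?m" "G u x" 1] by (simp add: abs_mult)
  qed
  have G_nonneg: "AE v in ?U. 0 \<le> s v ^ ?m * G u v" for u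
    by (rule AE_I2, rule mult_nonneg_nonneg, use bnd(1) in \<open>simp add: less_imp_le\<close>, rule G01)
  define J where "J u = (\<integral>v. s u ^ ?m * (s v ^ ?m * G u v) \<partial>?U)" for u
  have Jm: "J \<in> borel_measurable ?U"
    unfolding J_def[abs_def]
    by (rule measurable_unif01, rule borel_measurable_integral_unif01) measurable
  have J: "0 \<le> J u" "J u \<le> s 1 ^ ?m * I" if u: "0 < u" "u < 1" for u
  proof -
    have eq: "J u = s u ^ ?m * (\<integral>v. s v ^ ?m * G u v \<partial>?U)" by (simp add: J_def)
    have "(\<integral>v. s v ^ ?m * G u v \<partial>?U) \<le> I"
      unfolding I_def using bnd G01
      by (intro integral_mono intG intS mult_left_le) (auto simp: less_imp_le)
    moreover have "0 \<le> (\<integral>v. s v ^ ?m * G u v \<partial>?U)"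
      by (rule integral_nonneg_AE[OF G_nonneg])
    ultimately show "0 \<le> J u" "J u \<le> s 1 ^ ?m * I"
      unfolding eq using bnd[OF u] Ipos by (auto intro!: mult_mono mult_nonneg_nonneg)
  qed
  have inner: "(\<integral>\<^sup>+ y. q x y \<partial>P) = K * (\<integral>\<^sup>+ v. ?w v * ?H x v \<partial>?U)" for x
    by (rule K) measurable
  have m3: "(\<lambda>x. \<integral>\<^sup>+ y. q x y \<partial>P) \<in> borel_measurable borel"
  proof (rule P.borel_measurable_nn_integral)
    have "(\<lambda>p. (fst p, snd p)) \<in> borel \<Otimes>\<^sub>M P \<rightarrow>\<^sub>M borel \<Otimes>\<^sub>M borel"
      by (intro measurable_Pair measurable_fst measurable_compose[OF measurable_snd Pm])
    from measurable_compose[OF this qm]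
    show "(\<lambda>(x, y). q x y) \<in> borel_measurable (borel \<Otimes>\<^sub>M P)" by (simp add: split_beta')
  qed
  let ?S = "{p \<in> space (P \<Otimes>\<^sub>M P). Q (fst p) (snd p)}"
  have S: "?S \<in> sets (P \<Otimes>\<^sub>M P)"
    using measurable_compose[OF PPm Qm] by (simp add: pred_def)
  have "emeasure (P \<Otimes>\<^sub>M P) ?S = (\<integral>\<^sup>+ x. \<integral>\<^sup>+ y. indicator ?S (x, y) \<partial>P \<partial>P)"
    using S by (rule P.emeasure_pair_measure)
  also have "\<dots> = (\<integral>\<^sup>+ x. \<integral>\<^sup>+ y. q x y \<partial>P \<partial>P)"
    by (intro nn_integral_cong) (auto simp: q_def indicator_def space_pair_measure)
  also have "\<dots> = K * (\<integral>\<^sup>+ u. ?w u * (\<integral>\<^sup>+ \<sigma>. (\<integral>\<^sup>+ y. q (R u *\<^sub>R \<sigma>) y \<partial>P) \<partial>direction_law) \<partial>?U)"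
    by (rule K[OF m3])
  also have "\<dots> = K * (\<integral>\<^sup>+ u. ?w u * (\<integral>\<^sup>+ \<sigma>. K * V u \<sigma> \<partial>direction_law) \<partial>?U)"
    unfolding inner V_def ..
  also have "\<dots> = K * (\<integral>\<^sup>+ u. K * ennreal (\<integral>v. s u ^ ?m * (s v ^ ?m * G u v) \<partial>?U) \<partial>?U)"
  proof (intro arg_cong[where f="\<lambda>x. K * x"] nn_integral_cong)
    fix u assume "u \<in> space ?U"
    hence u: "u \<in> {0<..<1}" by simp
    have "(\<integral>\<^sup>+ \<sigma>. K * V u \<sigma> \<partial>direction_law) = K * (\<integral>\<^sup>+ \<sigma>. V u \<sigma> \<partial>direction_law)"
    proof (rule nn_integral_cmult)
      have "(\<lambda>x. \<integral>\<^sup>+ v. ?w v * ?H x v \<partial>?U) \<in> borel_measurable borel"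
      proof (rule U.borel_measurable_nn_integral)
        have m2: "(\<lambda>p. (fst p, snd p)) \<in> borel \<Otimes>\<^sub>M ?U \<rightarrow>\<^sub>M borel \<Otimes>\<^sub>M borel"
          by (intro measurable_Pair measurable_fst measurable_compose[OF measurable_snd idU])
        have "(\<lambda>p. \<integral>\<^sup>+ \<tau>. q (fst p) (R (snd p) *\<^sub>R \<tau>) \<partial>direction_law) \<in> borel_measurable (borel \<Otimes>\<^sub>M borel)"
          by (rule D.borel_measurable_nn_integral) measurable
        from measurable_compose[OF m2, OF borel_measurable_times_ennreal[OF _ this], of "\<lambda>p. ennreal (s (snd p) ^ ?m)"]
        show "(\<lambda>(x, v). ?w v * ?H x v) \<in> borel_measurable (borel \<Otimes>\<^sub>M ?U)"
          by (simp add: split_beta')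
      qed
      thus "V u \<in> borel_measurable direction_law" unfolding V_def by measurable
    qed
    also have "(\<integral>\<^sup>+ \<sigma>. V u \<sigma> \<partial>direction_law) = (\<integral>\<^sup>+ v. ennreal (s v ^ ?m * G u v) \<partial>?U)"
      unfolding V[OF u] using bnd G01 by (intro nn_integral_cong) (simp add: ennreal_mult less_imp_le)
    also have "\<dots> = ennreal (\<integral>v. s v ^ ?m * G u v \<partial>?U)"
      by (rule nn_integral_eq_integral[OF intG G_nonneg])
    finally have e: "(\<integral>\<^sup>+ \<sigma>. K * V u \<sigma> \<partial>direction_law) = K * ennreal (\<integral>v. s v ^ ?m * G u v \<partial>?U)" .
    have "ennreal (\<integral>v. s u ^ ?m * (s v ^ ?m * G u v) \<partial>?U)
        = ?w u * ennreal (\<integral>v. s v ^ ?m * G u v \<partial>?U)"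
      using bnd(1)[of u] u by (simp add: ennreal_mult' less_imp_le)
    thus "?w u * (\<integral>\<^sup>+ \<sigma>. K * V u \<sigma> \<partial>direction_law)
       = K * ennreal (\<integral>v. s u ^ ?m * (s v ^ ?m * G u v) \<partial>?U)"
      unfolding e by (simp only: mult.left_commute)
  qed
  also have "\<dots> = K * (K * (\<integral>\<^sup>+ u. ennreal (J u) \<partial>?U))"
    unfolding J_def[symmetric]
    by (intro arg_cong[where f="\<lambda>x. K * x"] nn_integral_cmult measurable_compose[OF Jm measurable_ennreal])
  also have "(\<integral>\<^sup>+ u. ennreal (J u) \<partial>?U) = ennreal (\<integral>u. J u \<partial>?U)"
  proof (rule nn_integral_eq_integral)
    show "integrable ?U J"
      by (rule bounded_integrable[OF Jm, of "s 1 ^ ?m * I"]) (use J in \<open>simp add: abs_le_iff\<close>)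
    show "AE u in ?U. 0 \<le> J u"
      by (rule AE_I2) (use J in simp)
  qed
  finally have "emeasure (P \<Otimes>\<^sub>M P) ?S = K * (K * ennreal (\<integral>u. J u \<partial>?U))" .
  also have "K = ennreal (1 / I)"
  proof -
    have "K = (K * ennreal I) * ennreal (1 / I)"
      using Ipos by (simp add: mult.assoc ennreal_mult[symmetric])
    thus ?thesis by (simp add: KI)
  qed
  also have "ennreal (1 / I) * (ennreal (1 / I) * ennreal (\<integral>u. J u \<partial>?U))
     = ennreal ((\<integral>u. J u \<partial>?U) / I\<^sup>2)"
    using Ipos by (simp add: ennreal_mult'[symmetric] power2_eq_square)
  finally have "measure (P \<Otimes>\<^sub>M P) ?S = (\<integral>u. J u \<partial>?U) / I\<^sup>2"
    using J by (intro measure_eq_emeasure_eq_ennreal divide_nonneg_nonneg integral_nonneg_AE AE_I2) auto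
  thus ?thesis
    by (simp add: J_def I_def G_def cluster_integral_def)
qed

section \<open>The distance in the ball model\<close>

text \<open>The hyperbolic cosine of the distance in the ball model of curvature \<open>-1\<close>.\<close>

definition cosh_dist :: "'a::real_inner \<Rightarrow> 'a \<Rightarrow> real" where
  "cosh_dist x y = 1 + 2 * (norm (x - y))\<^sup>2 / ((1 - (norm x)\<^sup>2) * (1 - (norm y)\<^sup>2))"

lemma one_minus_norm_sq_pos: "norm (x::'a::real_normed_vector) < 1 \<Longrightarrow> 0 < 1 - (norm x)\<^sup>2"
  by (simp add: abs_square_less_1)

lemma cosh_dist_ge_1: "norm x < 1 \<Longrightarrow> norm y < 1 \<Longrightarrow> 1 \<le> cosh_dist x y"
  unfolding cosh_dist_def
  using one_minus_norm_sq_pos[of x] one_minus_norm_sq_pos[of y] by simp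

abbreviation "hyp_speed \<equiv> riemannian_speed (hyperbolic_metric 1)"

abbreviation "hyp_length \<equiv> riemannian_length (hyperbolic_metric 1)"

lemma riemannian_speed_hyperbolic:
  fixes \<gamma> :: "real \<Rightarrow> real^'n"
  assumes "norm (\<gamma> s) < 1"
  shows "hyp_speed \<gamma> s
       = 2 / (1 - (norm (\<gamma> s))\<^sup>2) * norm (vector_derivative \<gamma> (at s))"
proof -
  have "4 / (1 * (1 - (norm (\<gamma> s))\<^sup>2)\<^sup>2) * (vector_derivative \<gamma> (at s) \<bullet> vector_derivative \<gamma> (at s))
     = (2 / (1 - (norm (\<gamma> s))\<^sup>2) * norm (vector_derivative \<gamma> (at s)))\<^sup>2"
    by (simp add: power_mult_distrib power_divide power2_norm_eq_inner)
  thus ?thesis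
    unfolding riemannian_speed_def hyperbolic_metric_def
    using one_minus_norm_sq_pos[OF assms] by simp
qed

text \<open>The derivative of the distance \<open>\<rho>\<close> from \<open>x\<close> in direction \<open>w\<close> is at most the hyperbolic length of \<open>w\<close>. Here \<open>D\<close> is the
derivative of \<open>cosh \<rho>\<close>, so the bound carries the factor \<open>sinh \<rho>\<close>, in the form \<open>(cosh \<rho>)\<^sup>2 - 1\<close>. Up to a scalar,
the gradient is the vector \<open>p\<close> below, whose squared norm turns out to be exactly the required multiple of
\<open>(cosh \<rho>)\<^sup>2 - 1\<close>; the inequality is Cauchy-Schwarz.\<close>

lemma cosh_dist_gradient_bound:
  fixes x z w :: "'a::real_inner"
  assumes "norm x < 1" "norm z < 1"
  defines "m \<equiv> 1 - z \<bullet> z" and "q \<equiv> (z - x) \<bullet> (z - x)" and "c \<equiv> 2 / (1 - x \<bullet> x)"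
  defines "D \<equiv> c * (2 * ((z - x) \<bullet> w) * m + q * (2 * (z \<bullet> w))) / m\<^sup>2"
  shows "D\<^sup>2 \<le> ((cosh_dist x z)\<^sup>2 - 1) * (2 / m * norm w)\<^sup>2"
proof -
  have m: "0 < m" and x: "0 < 1 - x \<bullet> x"
    using assms(1,2) one_minus_norm_sq_pos by (auto simp: m_def power2_norm_eq_inner[symmetric])
  define p where "p = m *\<^sub>R (z - x) + q *\<^sub>R z"
  have D: "D = (2 * c / m\<^sup>2) * (p \<bullet> w)"
  proof -
    have "p \<bullet> w = m * ((z - x) \<bullet> w) + q * (z \<bullet> w)"
      by (simp add: p_def inner_add_left)
    hence "c * (2 * ((z - x) \<bullet> w) * m + q * (2 * (z \<bullet> w))) = 2 * c * (p \<bullet> w)"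
      by algebra
    thus ?thesis by (simp add: D_def)
  qed
  have pp: "p \<bullet> p = q * (q + m * (1 - x \<bullet> x))"
    unfolding p_def m_def q_def
    by (simp add: inner_add_left inner_add_right inner_diff_left inner_diff_right inner_commute[of x z])
       algebra
  have E: "cosh_dist x z = 1 + c * q / m"
    by (simp add: cosh_dist_def c_def q_def m_def power2_norm_eq_inner norm_minus_commute[of x z])
  have cx: "c * (1 - x \<bullet> x) = 2" 
    unfolding c_def by (rule iffD1[OF nonzero_eq_divide_eq]) (use x in auto)
  have E2: "(cosh_dist x z)\<^sup>2 - 1 = c\<^sup>2 / m\<^sup>2 * (q * (q + m * (1 - x \<bullet> x)))"
  proof -
    have "(cosh_dist x z)\<^sup>2 - 1 = c * q * (c * q + 2 * m) / m\<^sup>2"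
      using m unfolding E by (simp add: field_simps power2_eq_square)
    also have "\<dots> = c * q * (c * q + c * (1 - x \<bullet> x) * m) / m\<^sup>2" by (simp only: cx)
    also have "\<dots> = c\<^sup>2 / m\<^sup>2 * (q * (q + m * (1 - x \<bullet> x)))"
    proof -
      have "c * q * (c * q + c * (1 - x \<bullet> x) * m) = c\<^sup>2 * (q * (q + m * (1 - x \<bullet> x)))" by algebra
      thus ?thesis by simp
    qed
    finally show ?thesis .
  qed
  have "D\<^sup>2 = (2 * c / m\<^sup>2)\<^sup>2 * (p \<bullet> w)\<^sup>2" by (simp add: D power_mult_distrib power_divide)
  also have "\<dots> \<le> (2 * c / m\<^sup>2)\<^sup>2 * ((p \<bullet> p) * (w \<bullet> w))"
    by (intro mult_left_mono Cauchy_Schwarz_ineq) simp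
  also have "\<dots> = ((cosh_dist x z)\<^sup>2 - 1) * (2 / m * norm w)\<^sup>2"
    unfolding E2 pp power_mult_distrib power2_norm_eq_inner
    using m by (simp add: power_divide power_mult_distrib field_simps)
  finally show ?thesis .
qed

lemma has_real_derivative_inner_self:
  fixes f :: "real \<Rightarrow> 'a::real_inner"
  assumes "(f has_vector_derivative f') (at t)"
  shows "((\<lambda>t. f t \<bullet> f t) has_real_derivative 2 * (f t \<bullet> f')) (at t)"
  using has_derivative_inner[OF assms[unfolded has_vector_derivative_def] assms[unfolded has_vector_derivative_def]]
  unfolding has_field_derivative_def
  by (rule has_derivative_eq_rhs) (auto simp: inner_commute algebra_simps)

text \<open>Integrate the gradient bound along the path. Since \<open>arcosh\<close> is not differentiable at \<open>1\<close>, where the path starts and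
to which it may return, the distance is replaced by \<open>arcosh (E t + \<epsilon>)\<close>, and \<open>\<epsilon>\<close> tends to \<open>0\<close> at the end.\<close>

lemma arcosh_cosh_dist_le_length:
  fixes \<gamma> :: "real \<Rightarrow> real^'n"
  assumes vp: "valid_path \<gamma>" and img: "path_image \<gamma> \<subseteq> ball 0 1"
    and int: "hyp_speed \<gamma> integrable_on {0..1}"
  shows "arcosh (cosh_dist (pathstart \<gamma>) (pathfinish \<gamma>)) \<le> hyp_length \<gamma>"
proof -
  define L where "L = hyp_length \<gamma>"
  define v where "v = hyp_speed \<gamma>"
  define x where "x = \<gamma> 0"
  define E where "E t = cosh_dist x (\<gamma> t)" for t
  have norm1: "norm (\<gamma> t) < 1" if "t \<in> {0..1}" for t
    using img that by (auto simp: path_image_def subset_iff)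
  have x1: "norm x < 1" unfolding x_def by (rule norm1) simp
  have E1: "1 \<le> E t" if "t \<in> {0..1}" for t
    unfolding E_def using x1 norm1[OF that] by (rule cosh_dist_ge_1)
  obtain S where S: "finite S" "\<gamma> C1_differentiable_on {0..1} - S" and cont: "continuous_on {0..1} \<gamma>"
    using vp by (auto simp: valid_path_def piecewise_C1_differentiable_on_def)
  have contE: "continuous_on {0..1} E"
    unfolding E_def cosh_dist_def
    using one_minus_norm_sq_pos[OF x1] one_minus_norm_sq_pos[OF norm1]
    by (intro continuous_intros cont) (auto simp: less_le)
  define K where "K = 2 / (1 - x \<bullet> x)"
  define D where "D t = K * (2 * ((\<gamma> t - x) \<bullet> vector_derivative \<gamma> (at t)) * (1 - \<gamma> t \<bullet> \<gamma> t)
        + ((\<gamma> t - x) \<bullet> (\<gamma> t - x)) * (2 * (\<gamma> t \<bullet> vector_derivative \<gamma> (at t)))) / (1 - \<gamma> t \<bullet> \<gamma> t)\<^sup>2" for t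
  have derE: "(E has_real_derivative D t) (at t)" if t: "t \<in> {0..1} - S" for t
  proof -
    have d: "(\<gamma> has_vector_derivative vector_derivative \<gamma> (at t)) (at t)"
      using S(2) t by (auto simp: C1_differentiable_on_eq vector_derivative_works)
    have d': "((\<lambda>t. \<gamma> t - x) has_vector_derivative vector_derivative \<gamma> (at t)) (at t)"
      using d by (auto intro!: derivative_eq_intros)
    have m: "0 < 1 - \<gamma> t \<bullet> \<gamma> t"
      using one_minus_norm_sq_pos[OF norm1[of t]] t by (simp add: power2_norm_eq_inner)
    have "((\<lambda>t. 1 + K * (((\<gamma> t - x) \<bullet> (\<gamma> t - x)) / (1 - \<gamma> t \<bullet> \<gamma> t))) has_real_derivative D t) (at t)"
      using m by (auto intro!: derivative_eq_intros has_real_derivative_inner_self[OF d] has_real_derivative_inner_self[OF d']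
        simp: D_def power2_eq_square) algebra
    moreover have "E = (\<lambda>t. 1 + K * (((\<gamma> t - x) \<bullet> (\<gamma> t - x)) / (1 - \<gamma> t \<bullet> \<gamma> t)))"
      by (rule ext) (simp add: E_def K_def cosh_dist_def power2_norm_eq_inner norm_minus_commute[of x])
    ultimately show ?thesis by simp
  qed
  have bound: "arcosh (E 1 + \<epsilon>) - arcosh (1 + \<epsilon>) \<le> L" if e: "\<epsilon> > 0" for \<epsilon>
  proof -
    define \<Phi> where "\<Phi> t = arcosh (E t + \<epsilon>)" for t
    (* A finite set does not affect the integral, and the value v t there makes the comparison hold everywhere. *)
    define \<phi> where "\<phi> t = (if t \<in> S then v t else D t / sqrt ((E t + \<epsilon>)\<^sup>2 - 1))" for t
    have "(\<phi> has_integral \<Phi> 1 - \<Phi> 0) {0..1}"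
    proof (rule fundamental_theorem_of_calculus_interior_strong[OF S(1)])
      show "continuous_on {0..1} \<Phi>"
        unfolding \<Phi>_def using E1 e by (intro continuous_intros contE) force
      fix t :: real assume t: "t \<in> {0<..<1} - S"
      hence "E t + \<epsilon> > 1" using E1[of t] e by auto
      moreover have "((\<lambda>t. E t + \<epsilon>) has_real_derivative D t) (at t)"
        using derE[of t] t by (auto intro!: derivative_eq_intros)
      ultimately have "(\<Phi> has_real_derivative 1 / sqrt ((E t + \<epsilon>)\<^sup>2 - 1) * D t) (at t)"
        unfolding \<Phi>_def by (intro DERIV_chain2[OF arcosh_real_has_field_derivative])
      thus "(\<Phi> has_vector_derivative \<phi> t) (at t)"
        using t by (simp add: \<phi>_def has_real_derivative_iff_has_vector_derivative)
    qed simp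
    moreover have "(v has_integral L) {0..1}"
      using int by (simp add: v_def L_def riemannian_length_def has_integral_integral)
    moreover have "\<phi> t \<le> v t" if t: "t \<in> {0..1}" for t
    proof (cases "t \<in> S")
      case False
      have v: "v t = 2 / (1 - \<gamma> t \<bullet> \<gamma> t) * norm (vector_derivative \<gamma> (at t))"
        unfolding v_def using riemannian_speed_hyperbolic[of \<gamma> t] norm1[OF t] by (simp add: power2_norm_eq_inner)
      have m: "0 < 1 - \<gamma> t \<bullet> \<gamma> t"
        using one_minus_norm_sq_pos[OF norm1[of t]] t by (simp add: power2_norm_eq_inner)
      have v0: "0 \<le> v t" using m by (simp add: v)
      have "(D t)\<^sup>2 \<le> ((E t)\<^sup>2 - 1) * (v t)\<^sup>2"
        unfolding D_def K_def E_def v by (rule cosh_dist_gradient_bound[OF x1 norm1[OF t]])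
      also have "\<dots> \<le> ((E t + \<epsilon>)\<^sup>2 - 1) * (v t)\<^sup>2"
        using E1[OF t] e by (intro mult_right_mono diff_right_mono power_mono) auto
      finally have le: "(D t)\<^sup>2 \<le> ((E t + \<epsilon>)\<^sup>2 - 1) * (v t)\<^sup>2" .
      have pos: "0 < (E t + \<epsilon>)\<^sup>2 - 1"
        using E1[OF t] e one_less_power[of "E t + \<epsilon>" 2] by simp
      define \<sigma> where "\<sigma> = sqrt ((E t + \<epsilon>)\<^sup>2 - 1)"
      have \<sigma>: "0 < \<sigma>" "\<sigma>\<^sup>2 = (E t + \<epsilon>)\<^sup>2 - 1" using pos by (simp_all add: \<sigma>_def)
      from le have "(D t)\<^sup>2 \<le> (\<sigma> * v t)\<^sup>2" unfolding \<sigma>(2)[symmetric] power_mult_distrib .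
      hence "D t \<le> \<sigma> * v t"
        by (rule power2_le_imp_le) (use v0 \<sigma>(1) in simp)
      thus ?thesis using False \<sigma>(1) by (simp add: \<phi>_def \<sigma>_def[symmetric] divide_le_eq mult.commute)
    qed (simp add: \<phi>_def)
    ultimately have "\<Phi> 1 - \<Phi> 0 \<le> L" by (rule has_integral_le)
    moreover have "E 0 = 1" by (simp add: E_def x_def cosh_dist_def)
    ultimately show ?thesis by (simp add: \<Phi>_def)
  qed
  have "((\<lambda>\<epsilon>. arcosh (E 1 + \<epsilon>) - arcosh (1 + \<epsilon>)) \<longlongrightarrow> arcosh (E 1 + 0) - arcosh (1 + 0)) (at_right 0)"
    using E1[of 1]
    by (intro tendsto_diff tendsto_arcosh_strong tendsto_intros) (auto simp: eventually_at_right_less intro: eventually_mono[OF eventually_at_right_less[of 0]])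
  moreover have "\<forall>\<^sub>F \<epsilon> in at_right 0. arcosh (E 1 + \<epsilon>) - arcosh (1 + \<epsilon>) \<le> L"
    using bound by (intro eventually_mono[OF eventually_at_right_less[of 0]]) auto
  ultimately have "arcosh (E 1 + 0) - arcosh (1 + 0) \<le> L"
    by (intro tendsto_upperbound) auto
  thus ?thesis by (simp add: E_def x_def L_def pathstart_def pathfinish_def)
qed

lemma sinh_interpolation:
  fixes a b :: real
  shows "(sinh a)\<^sup>2 + (sinh b)\<^sup>2 + 2 * sinh a * sinh b * cosh (a + b) = (sinh (a + b))\<^sup>2"
    and "2 * cosh a * cosh b * cosh (a + b) - (cosh a)\<^sup>2 - (cosh b)\<^sup>2 = (sinh (a + b))\<^sup>2"
proof -
  have *: "(sinh a)\<^sup>2 = (cosh a)\<^sup>2 - 1" "(sinh b)\<^sup>2 = (cosh b)\<^sup>2 - 1" by (simp_all add: sinh_square_eq)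
  show "(sinh a)\<^sup>2 + (sinh b)\<^sup>2 + 2 * sinh a * sinh b * cosh (a + b) = (sinh (a + b))\<^sup>2"
    "2 * cosh a * cosh b * cosh (a + b) - (cosh a)\<^sup>2 - (cosh b)\<^sup>2 = (sinh (a + b))\<^sup>2"
    unfolding sinh_add cosh_add using * by algebra+
qed

text \<open>The ball model is the image of the hyperboloid \<open>t\<^sup>2 - v \<bullet> v = 1\<close>, \<open>t > 0\<close>, under the stereographic projection
\<open>(t, v) \<mapsto> v / (1 + t)\<close>. This lemma computes the conformal factor at the image, and the next lemma shows that the
projection is conformal.\<close>

lemma ball_of_hyperboloid:
  fixes v :: "'a::real_inner"
  assumes "t > 0" "v \<bullet> v = t\<^sup>2 - 1"
  shows "norm (v /\<^sub>R (1 + t)) < 1" "1 - (norm (v /\<^sub>R (1 + t)))\<^sup>2 = 2 / (1 + t)"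
proof -
  have "(norm (v /\<^sub>R (1 + t)))\<^sup>2 = (t\<^sup>2 - 1) / (1 + t)\<^sup>2"
    using assms by (simp add: power_mult_distrib power_divide power2_norm_eq_inner field_simps)
  also have "\<dots> = (t - 1) / (t + 1)"
    using assms(1) by (simp add: divide_simps power2_eq_square) (simp add: algebra_simps)
  finally have *: "(norm (v /\<^sub>R (1 + t)))\<^sup>2 = (t - 1) / (t + 1)" .
  show "1 - (norm (v /\<^sub>R (1 + t)))\<^sup>2 = 2 / (1 + t)"
    unfolding * using assms(1) by (simp add: field_simps)
  have "(norm (v /\<^sub>R (1 + t)))\<^sup>2 < 1\<^sup>2"
    unfolding * using assms(1) by (simp add: field_simps)
  thus "norm (v /\<^sub>R (1 + t)) < 1" by (rule power2_less_imp_less) simp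
qed

lemma norm_hyperboloid_velocity:
  fixes v v' :: "'a::real_inner"
  assumes "t > 0" "v \<bullet> v = t\<^sup>2 - 1" "v \<bullet> v' = t * t'" "v' \<bullet> v' - t'\<^sup>2 = r\<^sup>2" "r \<ge> 0"
  shows "norm (v' /\<^sub>R (1 + t) - (t' / (1 + t)\<^sup>2) *\<^sub>R v) = r / (1 + t)"
proof -
  have t: "1 + t \<noteq> 0" using assms(1) by simp
  have "v' /\<^sub>R (1 + t) - (t' / (1 + t)\<^sup>2) *\<^sub>R v = (1 / (1 + t)\<^sup>2) *\<^sub>R ((1 + t) *\<^sub>R v' - t' *\<^sub>R v)"
    using t by (simp add: scaleR_diff_right power2_eq_square divide_simps)
  hence "(norm (v' /\<^sub>R (1 + t) - (t' / (1 + t)\<^sup>2) *\<^sub>R v))\<^sup>2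
      = (1 / (1 + t)\<^sup>2)\<^sup>2 * (((1 + t) *\<^sub>R v' - t' *\<^sub>R v) \<bullet> ((1 + t) *\<^sub>R v' - t' *\<^sub>R v))"
    by (simp add: power_divide power2_norm_eq_inner)
  also have "((1 + t) *\<^sub>R v' - t' *\<^sub>R v) \<bullet> ((1 + t) *\<^sub>R v' - t' *\<^sub>R v)
      = (1 + t)\<^sup>2 * (v' \<bullet> v') - 2 * (1 + t) * t' * (v \<bullet> v') + t'\<^sup>2 * (v \<bullet> v)"
    by (simp add: inner_diff_left inner_diff_right inner_commute[of v' v] power2_eq_square algebra_simps)
  also have "\<dots> = (1 + t)\<^sup>2 * r\<^sup>2"
    using assms(2-4) by algebra
  also have "(1 / (1 + t)\<^sup>2)\<^sup>2 * ((1 + t)\<^sup>2 * r\<^sup>2) = (r / (1 + t))\<^sup>2"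
    using t by (simp add: power2_eq_square divide_simps)
  finally show ?thesis
    using assms(1,5) by (subst (asm) power2_eq_iff_nonneg) auto
qed

text \<open>The geodesic of the hyperboloid from \<open>(X0, X)\<close> to \<open>(Y0, Y)\<close> is their combination with coefficients
\<open>A s = sinh ((1 - s) * r) / sinh r\<close> and \<open>B s = sinh (s * r) / sinh r\<close>; it stays on the hyperboloid and has constant
speed \<open>r\<close> because of the identities \<open>sinh_interpolation\<close>. Its stereographic projection is the path.\<close>

lemma exists_geodesic:
  fixes x y :: "real^'n"
  assumes x: "norm x < 1" and y: "norm y < 1" and "x \<noteq> y"
  defines "r \<equiv> arcosh (cosh_dist x y)"
  obtains \<gamma> where "valid_path \<gamma>" "path_image \<gamma> \<subseteq> ball 0 1" "pathstart \<gamma> = x" "pathfinish \<gamma> = y"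
    "\<And>s. s \<in> {0..1} \<Longrightarrow> hyp_speed \<gamma> s = r"
proof -
  have x1: "0 < 1 - x \<bullet> x" and y1: "0 < 1 - y \<bullet> y"
    using one_minus_norm_sq_pos[OF x] one_minus_norm_sq_pos[OF y] by (auto simp: power2_norm_eq_inner)
  have "cosh_dist x y > 1"
    using \<open>x \<noteq> y\<close> x1 y1 by (simp add: cosh_dist_def power2_norm_eq_inner)
  hence r: "r > 0" and cr: "cosh r = cosh_dist x y" by (auto simp: r_def)
  define X0 Y0 where "X0 = (1 + x \<bullet> x) / (1 - x \<bullet> x)" and "Y0 = (1 + y \<bullet> y) / (1 - y \<bullet> y)"
  define X Y where "X = (2 / (1 - x \<bullet> x)) *\<^sub>R x" and "Y = (2 / (1 - y \<bullet> y)) *\<^sub>R y"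
  have X: "X \<bullet> X = X0\<^sup>2 - 1" "Y \<bullet> Y = Y0\<^sup>2 - 1"
    unfolding X_def Y_def X0_def Y0_def using x1 y1
    by (simp_all add: divide_simps power2_eq_square) (simp_all add: algebra_simps)
  have XY: "X \<bullet> Y = X0 * Y0 - cosh r"
    unfolding X_def Y_def X0_def Y0_def cr cosh_dist_def power2_norm_eq_inner using x1 y1
    by (simp add: divide_simps inner_diff_left inner_diff_right inner_commute[of y x]) (simp add: algebra_simps)
  have X0: "X0 > 0" "Y0 > 0" using x1 y1 by (auto simp: X0_def Y0_def intro!: divide_pos_pos add_pos_nonneg)
  define A B A' B' where "A s = sinh ((1 - s) * r) / sinh r" and "B s = sinh (s * r) / sinh r"
    and "A' s = - r * cosh ((1 - s) * r) / sinh r" and "B' s = r * cosh (s * r) / sinh r" for s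
  define t t' where "t s = A s * X0 + B s * Y0" and "t' s = A' s * X0 + B' s * Y0" for s
  define v v' where "v s = A s *\<^sub>R X + B s *\<^sub>R Y" and "v' s = A' s *\<^sub>R X + B' s *\<^sub>R Y" for s
  have sr: "sinh r > 0" using r by simp
  (* Lorentz norms of the curve and of its velocity, and their Lorentz product. *)
  have AB: "(A s)\<^sup>2 + (B s)\<^sup>2 + 2 * A s * B s * cosh r = 1"
       "(A' s)\<^sup>2 + (B' s)\<^sup>2 + 2 * A' s * B' s * cosh r = - r\<^sup>2"
       "A s * A' s + B s * B' s + (A s * B' s + A' s * B s) * cosh r = 0" for s
  proof -
    have eq: "(1 - s) * r + s * r = r" by (simp add: algebra_simps)
    note * = sinh_interpolation[of "(1 - s) * r" "s * r", unfolded eq]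
    show "(A s)\<^sup>2 + (B s)\<^sup>2 + 2 * A s * B s * cosh r = 1"
    proof -
      have "(A s)\<^sup>2 + (B s)\<^sup>2 + 2 * A s * B s * cosh r = ((sinh ((1 - s) * r))\<^sup>2 + (sinh (s * r))\<^sup>2
            + 2 * sinh ((1 - s) * r) * sinh (s * r) * cosh r) / (sinh r)\<^sup>2"
        by (simp add: A_def B_def power_divide add_divide_distrib power2_eq_square)
      thus ?thesis unfolding *(1) using sr by simp
    qed
    have "(A' s)\<^sup>2 + (B' s)\<^sup>2 + 2 * A' s * B' s * cosh r =
      - r\<^sup>2 / (sinh r)\<^sup>2 * (2 * cosh ((1 - s) * r) * cosh (s * r) * cosh r - (cosh ((1 - s) * r))\<^sup>2 - (cosh (s * r))\<^sup>2)"
      unfolding A'_def B'_def using sr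
      by (simp add: power_divide power_mult_distrib) (simp add: power2_eq_square divide_simps, simp add: algebra_simps)
    also have "\<dots> = - r\<^sup>2" unfolding *(2) using sr by simp
    finally show "(A' s)\<^sup>2 + (B' s)\<^sup>2 + 2 * A' s * B' s * cosh r = - r\<^sup>2" .
    define a b where "a = (1 - s) * r" and "b = s * r"
    have "r = a + b" by (simp add: a_def b_def algebra_simps)
    have "- sinh a * cosh a + sinh b * cosh b + (sinh a * cosh b - cosh a * sinh b) * cosh r = 0"
      unfolding \<open>r = a + b\<close> cosh_add using cosh_square_eq[of a] cosh_square_eq[of b] by algebra
    note zero = this
    show "A s * A' s + B s * B' s + (A s * B' s + A' s * B s) * cosh r = 0"
    proof -
      have "A s * A' s + B s * B' s + (A s * B' s + A' s * B s) * cosh r = r / (sinh r)\<^sup>2 *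
         (- sinh a * cosh a + sinh b * cosh b + (sinh a * cosh b - cosh a * sinh b) * cosh r)"
        unfolding A_def B_def A'_def B'_def a_def[symmetric] b_def[symmetric] power2_eq_square
        using sr by (simp add: divide_simps) algebra
      thus ?thesis unfolding zero by simp
    qed
  qed
  have vv: "v s \<bullet> v s = (t s)\<^sup>2 - 1" "v s \<bullet> v' s = t s * t' s" "v' s \<bullet> v' s - (t' s)\<^sup>2 = r\<^sup>2" for s
    unfolding v_def t_def v'_def t'_def inner_add_left inner_add_right inner_scaleR_left inner_scaleR_right
      inner_commute[of Y X] X XY
    using AB[of s] by algebra+
  have tpos: "t s > 0" if s: "s \<in> {0..1}" for s
  proof -
    have "A s > 0 \<or> B s > 0" "A s \<ge> 0" "B s \<ge> 0"
      unfolding A_def B_def using s sr r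
      by (cases "s = 0"; simp add: zero_less_divide_iff zero_less_mult_iff)+
    thus ?thesis unfolding t_def using X0 by (auto intro: add_pos_nonneg add_nonneg_pos)
  qed
  define \<gamma> where "\<gamma> s = v s /\<^sub>R (1 + t s)" for s
  define \<gamma>' where "\<gamma>' s = v' s /\<^sub>R (1 + t s) - (t' s / (1 + t s)\<^sup>2) *\<^sub>R v s" for s
  have derAB: "(A has_real_derivative A' s) (at s)" "(B has_real_derivative B' s) (at s)" for s
  proof -
    have "((\<lambda>s. sinh ((1 - s) * r) / sinh r) has_real_derivative - r * cosh ((1 - s) * r) / sinh r) (at s)"
      "((\<lambda>s. sinh (s * r) / sinh r) has_real_derivative r * cosh (s * r) / sinh r) (at s)"
      using sr by (auto intro!: derivative_eq_intros)
    moreover have "A = (\<lambda>s. sinh ((1 - s) * r) / sinh r)" "B = (\<lambda>s. sinh (s * r) / sinh r)"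
      by (rule ext, simp add: A_def B_def)+
    ultimately show "(A has_real_derivative A' s) (at s)" "(B has_real_derivative B' s) (at s)"
      by (simp_all add: A'_def B'_def)
  qed
  have der: "(\<gamma> has_vector_derivative \<gamma>' s) (at s)" if s: "s \<in> {0..1}" for s
  proof -
    have dt: "(t has_real_derivative t' s) (at s)"
      unfolding t_def[abs_def] t'_def by (intro DERIV_add DERIV_cmult_right derAB)
    have dv: "(v has_vector_derivative v' s) (at s)"
      unfolding v_def[abs_def] v'_def
      using has_vector_derivative_add[OF has_vector_derivative_scaleR[OF derAB(1) has_vector_derivative_const]
          has_vector_derivative_scaleR[OF derAB(2) has_vector_derivative_const]] by simp
    have di: "((\<lambda>s. inverse (1 + t s)) has_real_derivative - (t' s / (1 + t s)\<^sup>2)) (at s)"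
      using tpos[OF s] by (auto intro!: derivative_eq_intros dt simp: power2_eq_square field_simps)
    show ?thesis
      unfolding \<gamma>_def[abs_def] \<gamma>'_def
      using has_vector_derivative_scaleR[OF di dv] by simp
  qed
  have "continuous_on {0..1} \<gamma>'"
  proof -
    have c: "continuous_on {0..1} A" "continuous_on {0..1} B" "continuous_on {0..1} A'" "continuous_on {0..1} B'"
      unfolding A_def[abs_def] B_def[abs_def] A'_def[abs_def] B'_def[abs_def]
      using sr by (auto intro!: continuous_intros)
    have ct: "continuous_on {0..1} t" "continuous_on {0..1} t'" "continuous_on {0..1} v" "continuous_on {0..1} v'"
      unfolding t_def[abs_def] t'_def[abs_def] v_def[abs_def] v'_def[abs_def]
      by (intro continuous_intros c)+
    have "1 + t s \<noteq> 0" "(1 + t s)\<^sup>2 \<noteq> 0" if "s \<in> {0..1}" for s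
      using tpos[OF that] by auto
    thus ?thesis
      unfolding \<gamma>'_def[abs_def] by (intro continuous_intros ct) blast+
  qed
  with der have "\<gamma> C1_differentiable_on {0..1}"
    unfolding C1_differentiable_on_def by blast
  hence vp: "valid_path \<gamma>"
    unfolding valid_path_def by (rule C1_differentiable_imp_piecewise)
  have n1: "norm (\<gamma> s) < 1" "1 - (norm (\<gamma> s))\<^sup>2 = 2 / (1 + t s)" if s: "s \<in> {0..1}" for s
    unfolding \<gamma>_def using ball_of_hyperboloid[OF tpos[OF s] vv(1)] by auto
  have speed: "hyp_speed \<gamma> s = r" if s: "s \<in> {0..1}" for s
  proof -
    have "vector_derivative \<gamma> (at s) = \<gamma>' s" using der[OF s] by (rule vector_derivative_at)
    moreover have "norm (\<gamma>' s) = r / (1 + t s)"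
      unfolding \<gamma>'_def using r by (intro norm_hyperboloid_velocity[OF tpos[OF s] vv]) auto
    ultimately show ?thesis
      using riemannian_speed_hyperbolic[of \<gamma> s] n1[OF s] tpos[OF s] by simp
  qed
  have chart: "((2 / (1 - z \<bullet> z)) *\<^sub>R z) /\<^sub>R (1 + (1 + z \<bullet> z) / (1 - z \<bullet> z)) = z"
    if "0 < 1 - z \<bullet> z" for z :: "real^'n"
  proof -
    have eq: "1 + (1 + z \<bullet> z) / (1 - z \<bullet> z) = 2 / (1 - z \<bullet> z)"
      using that by (simp add: field_simps)
    define d where "d = 2 / (1 - z \<bullet> z)"
    have "d \<noteq> 0" using that by (simp add: d_def)
    thus ?thesis unfolding eq d_def[symmetric] by simp
  qed
  have img: "path_image \<gamma> \<subseteq> ball 0 1"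
    using n1(1) by (auto simp: path_image_def)
  have "\<gamma> 0 = x"
    using sr chart[OF x1] by (simp add: \<gamma>_def v_def t_def A_def B_def X_def X0_def)
  moreover have "\<gamma> 1 = y"
    using sr chart[OF y1] by (simp add: \<gamma>_def v_def t_def A_def B_def Y_def Y0_def)
  ultimately show ?thesis
    using that[OF vp img _ _ speed] by (simp add: pathstart_def pathfinish_def)
qed

theorem hyperbolic_dist_eq_arcosh:
  fixes x y :: "real^'n"
  assumes x: "norm x < 1" and y: "norm y < 1"
  shows "hyperbolic_dist 1 x y = arcosh (cosh_dist x y)"
  unfolding hyperbolic_dist_def riemannian_dist_def
proof (rule cInf_eq_minimum)
  let ?L = "{hyp_length \<gamma> |\<gamma>. valid_path \<gamma> \<and> path_image \<gamma> \<subseteq> ball 0 1 \<and>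
      pathstart \<gamma> = x \<and> pathfinish \<gamma> = y \<and> hyp_speed \<gamma> integrable_on {0..1}}"
  show "arcosh (cosh_dist x y) \<in> ?L"
  proof (cases "x = y")
    case True
    define \<gamma> where "\<gamma> = (\<lambda>_::real. x)"
    have "hyp_speed \<gamma> s = 0" for s
      using riemannian_speed_hyperbolic[of \<gamma> s] x by (simp add: \<gamma>_def)
    hence "hyp_speed \<gamma> = (\<lambda>_. 0)" by auto
    moreover have "cosh_dist x y = 1" by (simp add: cosh_dist_def True)
    moreover have "valid_path \<gamma>"
      unfolding valid_path_def \<gamma>_def by (intro C1_differentiable_imp_piecewise) simp
    moreover have "path_image \<gamma> \<subseteq> ball 0 1" "pathstart \<gamma> = x" "pathfinish \<gamma> = y"
      using x True by (auto simp: \<gamma>_def pathstart_def pathfinish_def path_image_def)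
    ultimately have "arcosh (cosh_dist x y) = hyp_length \<gamma> \<and> valid_path \<gamma> \<and>
      path_image \<gamma> \<subseteq> ball 0 1 \<and> pathstart \<gamma> = x \<and> pathfinish \<gamma> = y \<and>
      hyp_speed \<gamma> integrable_on {0..1}"
      by (simp add: riemannian_length_def integrable_0)
    thus ?thesis by blast
  next
    case False
    obtain \<gamma> where g: "valid_path \<gamma>" "path_image \<gamma> \<subseteq> ball 0 1" "pathstart \<gamma> = x" "pathfinish \<gamma> = y"
      "\<And>s. s \<in> {0..1} \<Longrightarrow> hyp_speed \<gamma> s = arcosh (cosh_dist x y)"
      using exists_geodesic[OF x y False] by blast
    have "(hyp_speed \<gamma> has_integral arcosh (cosh_dist x y)) {0..1}"
      using has_integral_const_real[of "arcosh (cosh_dist x y)" 0 1] g(5)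
      by (subst has_integral_cong[of _ _ "\<lambda>_. arcosh (cosh_dist x y)"]) auto
    hence "hyp_length \<gamma> = arcosh (cosh_dist x y)"
      "hyp_speed \<gamma> integrable_on {0..1}"
      by (auto simp: riemannian_length_def integral_unique)
    with g(1-4) show ?thesis by (metis (mono_tags, lifting) mem_Collect_eq)
  qed
  fix l assume "l \<in> ?L"
  then show "arcosh (cosh_dist x y) \<le> l"
    using arcosh_cosh_dist_le_length by blast
qed

section \<open>The two clustering tendencies as radial double integrals\<close>

text \<open>Dividing by \<open>\<alpha>\<close> cancels from the cluster integral, but lets the Euclidean case \<open>s u = u\<close> appear as the limit at \<open>0\<close>.\<close>

definition hyp_sine :: "real \<Rightarrow> real \<Rightarrow> real" where
  "hyp_sine \<alpha> x = sinh (\<alpha> * x) / \<alpha>"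

lemma sinh_mult_sinh: "2 * (sinh a * sinh b) = cosh (a + b) - cosh (a - b :: real)"
  by (simp add: cosh_add cosh_diff)

lemma sinh_superadditive:
  fixes a b :: real
  assumes "0 \<le> a" "0 \<le> b"
  shows "sinh a + sinh b \<le> sinh (a + b)"
  unfolding sinh_add
  using assms cosh_real_ge_1[of a] cosh_real_ge_1[of b]
    mult_left_mono[of 1 "cosh b" "sinh a"] mult_right_mono[of 1 "cosh a" "sinh b"]
  by auto

lemma sine_ratio_hyp_sine:
  assumes "\<alpha> \<noteq> 0"
  shows "sine_ratio (hyp_sine \<alpha>) u v
       = (cosh \<alpha> - cosh (\<alpha> * u - \<alpha> * v)) / (2 * (sinh (\<alpha> * u) * sinh (\<alpha> * v)))"
proof -
  have "sine_ratio (hyp_sine \<alpha>) u v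
     = sinh (\<alpha> * ((1 + u - v) / 2)) * sinh (\<alpha> * ((1 + v - u) / 2)) / (sinh (\<alpha> * u) * sinh (\<alpha> * v))"
    using assms by (simp add: sine_ratio_def hyp_sine_def)
  also have "\<dots> = 2 * (sinh (\<alpha> * ((1 + u - v) / 2)) * sinh (\<alpha> * ((1 + v - u) / 2))) / (2 * (sinh (\<alpha> * u) * sinh (\<alpha> * v)))"
    by simp
  also have "2 * (sinh (\<alpha> * ((1 + u - v) / 2)) * sinh (\<alpha> * ((1 + v - u) / 2))) = cosh \<alpha> - cosh (\<alpha> * u - \<alpha> * v)"
  proof -
    have "\<alpha> * ((1 + u - v) / 2) + \<alpha> * ((1 + v - u) / 2) = \<alpha>"
      "\<alpha> * ((1 + u - v) / 2) - \<alpha> * ((1 + v - u) / 2) = \<alpha> * u - \<alpha> * v"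
      by (simp_all add: field_simps)
    thus ?thesis unfolding sinh_mult_sinh by simp
  qed
  finally show ?thesis .
qed

text \<open>With \<open>a = \<alpha> * u\<close> and \<open>b = \<alpha> * v\<close> the ratio is \<open>(cosh \<alpha> - cosh (a - b)) / (2 * sinh a * sinh b)\<close>. That it decreases from
\<open>a\<close> to \<open>a'\<close> amounts to \<open>cosh b * sinh (a' - a) \<le> cosh \<alpha> * (sinh a' - sinh a)\<close>, which holds by superadditivity of
\<open>sinh\<close> and because the side \<open>\<alpha>\<close> is the longest one.\<close>

lemma sine_like_hyp_sine:
  assumes \<alpha>: "0 < \<alpha>"
  shows "sine_like (hyp_sine \<alpha>)"
  unfolding sine_like_def
proof (intro conjI ballI monotone_onI)
  show "hyp_sine \<alpha> \<in> borel_measurable borel"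
    unfolding hyp_sine_def[abs_def] sinh_def by measurable
  show "0 < hyp_sine \<alpha> x" if "x \<in> {0<..1}" for x using that \<alpha> by (simp add: hyp_sine_def)
  show "hyp_sine \<alpha> x < hyp_sine \<alpha> y" if "x < y" for x y
    using that \<alpha> by (simp add: hyp_sine_def divide_strict_right_mono)
  fix v u u' :: real assume v: "v \<in> {0<..<1}" and u: "u \<in> {0<..<1}" and u': "u' \<in> {0<..<1}" and le: "u \<le> u'"
  define a a' b where "a = \<alpha> * u" and "a' = \<alpha> * u'" and "b = \<alpha> * v"
  have ab: "0 < a" "a \<le> a'" "0 < b" "b \<le> \<alpha>"
    using \<alpha> u v le by (auto simp: a_def a'_def b_def)
  have "cosh b * sinh (a' - a) \<le> cosh \<alpha> * (sinh a' - sinh a)"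
    using ab \<alpha> sinh_superadditive[of "a' - a" a] by (intro mult_mono) (auto simp: cosh_real_nonneg_le_iff)
  hence "(cosh \<alpha> - cosh a' * cosh b) * sinh a \<le> (cosh \<alpha> - cosh a * cosh b) * sinh a'"
    by (simp add: sinh_diff algebra_simps)
  hence "(cosh \<alpha> - cosh (a' - b)) * sinh a \<le> (cosh \<alpha> - cosh (a - b)) * sinh a'"
    by (simp add: cosh_diff algebra_simps)
  hence "(cosh \<alpha> - cosh (a' - b)) / sinh a' \<le> (cosh \<alpha> - cosh (a - b)) / sinh a"
    using ab by (simp add: divide_simps mult.commute)
  hence "(cosh \<alpha> - cosh (a' - b)) / sinh a' / (2 * sinh b) \<le> (cosh \<alpha> - cosh (a - b)) / sinh a / (2 * sinh b)"
    using ab by (intro divide_right_mono) auto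
  thus "sine_ratio (hyp_sine \<alpha>) u' v \<le> sine_ratio (hyp_sine \<alpha>) u v"
    using \<alpha> by (simp add: sine_ratio_hyp_sine a_def a'_def b_def mult_ac)
qed

lemma sine_ratio_ident: "sine_ratio (\<lambda>x. x) u v = (1 - (u - v)\<^sup>2) / (4 * (u * v))"
  unfolding sine_ratio_def by (simp add: power2_eq_square field_simps)

lemma sine_like_ident: "sine_like (\<lambda>x. x)"
  unfolding sine_like_def
proof (intro conjI ballI monotone_onI)
  fix v u u' :: real assume v: "v \<in> {0<..<1}" and u: "u \<in> {0<..<1}" and u': "u' \<in> {0<..<1}" and le: "u \<le> u'"
  have "v\<^sup>2 \<le> 1" using v by (simp add: abs_square_le_1)
  moreover have "0 \<le> u * u'" using u u' by simp
  ultimately have "0 \<le> (u' - u) * (1 + u * u' - v\<^sup>2)"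
    using le by (intro mult_nonneg_nonneg) auto
  hence "(1 - (u' - v)\<^sup>2) * u \<le> (1 - (u - v)\<^sup>2) * u'"
    by (simp add: power2_eq_square algebra_simps)
  hence "(1 - (u' - v)\<^sup>2) / u' \<le> (1 - (u - v)\<^sup>2) / u"
    using u u' by (simp add: divide_simps mult.commute)
  hence "(1 - (u' - v)\<^sup>2) / u' / (4 * v) \<le> (1 - (u - v)\<^sup>2) / u / (4 * v)"
    using v by (intro divide_right_mono) auto
  thus "sine_ratio (\<lambda>x. x) u' v \<le> sine_ratio (\<lambda>x. x) u v"
    by (simp add: sine_ratio_ident mult_ac)
qed auto

text \<open>The numerator \<open>N\<close> of the derivative of \<open>sinh (\<beta> * z) / sinh (\<alpha> * z)\<close> vanishes at \<open>0\<close> and has a positive derivative.\<close>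

lemma sinh_ratio_increasing:
  fixes \<alpha> \<beta> x y :: real
  assumes "0 < \<alpha>" "\<alpha> < \<beta>" "0 < x" "x < y"
  shows "sinh (\<beta> * x) * sinh (\<alpha> * y) < sinh (\<alpha> * x) * sinh (\<beta> * y)"
proof -
  define N where "N x = \<beta> * cosh (\<beta> * x) * sinh (\<alpha> * x) - \<alpha> * sinh (\<beta> * x) * cosh (\<alpha> * x)" for x
  have dN: "(N has_real_derivative (\<beta>\<^sup>2 - \<alpha>\<^sup>2) * (sinh (\<beta> * x) * sinh (\<alpha> * x))) (at x)" for x
    unfolding N_def[abs_def] by (auto intro!: derivative_eq_intros simp: power2_eq_square algebra_simps)
  have sq: "0 < \<beta>\<^sup>2 - \<alpha>\<^sup>2" using assms by (simp add: power_strict_mono)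
  have Npos: "0 < N x" if "0 < x" for x
  proof -
    have "N 0 < N x"
    proof (rule DERIV_pos_imp_increasing_open[OF that])
      fix z :: real assume "0 < z" "z < x"
      hence "0 < (\<beta>\<^sup>2 - \<alpha>\<^sup>2) * (sinh (\<beta> * z) * sinh (\<alpha> * z))"
        using sq assms by (intro mult_pos_pos) auto
      thus "\<exists>y. (N has_real_derivative y) (at z) \<and> 0 < y"
        using dN[of z] by blast
    qed (rule DERIV_continuous_on, rule has_field_derivative_at_within, rule dN)
    thus ?thesis by (simp add: N_def)
  qed
  have "sinh (\<beta> * x) / sinh (\<alpha> * x) < sinh (\<beta> * y) / sinh (\<alpha> * y)"
  proof (rule DERIV_pos_imp_increasing[OF assms(4)])
    fix z assume z: "x \<le> z" "z \<le> y"
    hence "0 < z" using assms by simp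
    hence sz: "sinh (\<alpha> * z) > 0" using assms by simp
    have "((\<lambda>z. sinh (\<beta> * z) / sinh (\<alpha> * z)) has_real_derivative N z / (sinh (\<alpha> * z))\<^sup>2) (at z)"
      using sz by (auto intro!: derivative_eq_intros simp: N_def power2_eq_square algebra_simps)
    thus "\<exists>D. ((\<lambda>z. sinh (\<beta> * z) / sinh (\<alpha> * z)) has_real_derivative D) (at z) \<and> 0 < D"
      using divide_pos_pos[OF Npos[OF \<open>0 < z\<close>] zero_less_power[OF sz]] by blast
  qed
  thus ?thesis using assms by (simp add: divide_simps mult.commute)
qed

lemma sinh_over_ident_increasing:
  fixes \<beta> x y :: real
  assumes "0 < \<beta>" "0 < x" "x < y"
  shows "sinh (\<beta> * x) * y < x * sinh (\<beta> * y)"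
proof -
  define N where "N x = \<beta> * cosh (\<beta> * x) * x - sinh (\<beta> * x)" for x
  have dN: "(N has_real_derivative \<beta>\<^sup>2 * (sinh (\<beta> * x) * x)) (at x)" for x
    unfolding N_def[abs_def] by (auto intro!: derivative_eq_intros simp: power2_eq_square algebra_simps)
  have Npos: "0 < N x" if "0 < x" for x
  proof -
    have "N 0 < N x"
    proof (rule DERIV_pos_imp_increasing_open[OF that])
      fix z :: real assume "0 < z" "z < x"
      hence "0 < \<beta>\<^sup>2 * (sinh (\<beta> * z) * z)"
        using assms by (intro mult_pos_pos) auto
      thus "\<exists>y. (N has_real_derivative y) (at z) \<and> 0 < y"
        using dN[of z] by blast
    qed (rule DERIV_continuous_on, rule has_field_derivative_at_within, rule dN)
    thus ?thesis by (simp add: N_def)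
  qed
  have "sinh (\<beta> * x) / x < sinh (\<beta> * y) / y"
  proof (rule DERIV_pos_imp_increasing[OF assms(3)])
    fix z assume z: "x \<le> z" "z \<le> y"
    hence z0: "0 < z" using assms by simp
    have "((\<lambda>z. sinh (\<beta> * z) / z) has_real_derivative N z / z\<^sup>2) (at z)"
      using z0 by (auto intro!: derivative_eq_intros simp: N_def power2_eq_square algebra_simps)
    thus "\<exists>D. ((\<lambda>z. sinh (\<beta> * z) / z) has_real_derivative D) (at z) \<and> 0 < D"
      using Npos[OF z0] z0 by (intro exI conjI) (assumption, simp)
  qed
  thus ?thesis using assms by (simp add: divide_simps mult.commute)
qed

text \<open>Conditioning on a ball only changes the constant, once the ball is known to have positive finite measure; its measure
is the polar integral of \<open>1\<close>.\<close>

lemma radial_law_uniform_measure: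
  fixes \<mu> :: "'a::euclidean_space measure"
  assumes s: "sine_like s" and c: "c \<noteq> 0" "c \<noteq> top" and B: "B \<in> sets \<mu>" and id: "(\<lambda>x. x) \<in> \<mu> \<rightarrow>\<^sub>M borel"
    and int: "\<And>F. F \<in> borel_measurable borel \<Longrightarrow>
      (\<integral>\<^sup>+ x. F x * indicator B x \<partial>\<mu>) = c * polar_integral R s F"
  shows "radial_law (uniform_measure \<mu> B) R s"
proof -
  let ?m = "DIM('a) - 1"
  interpret D: prob_space "direction_law :: 'a measure" by (rule prob_space_direction_law)
  define I where "I = (\<integral>u. s u ^ ?m \<partial>unif01)"
  have Ipos: "0 < I" unfolding I_def by (rule sine_like_power(4)[OF s])
  have "emeasure \<mu> B = (\<integral>\<^sup>+ x. 1 * indicator B x \<partial>\<mu>)" using B by simp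
  also have "\<dots> = c * (\<integral>\<^sup>+ u. ennreal (s u ^ ?m) \<partial>unif01)"
    by (subst int) (simp_all add: polar_integral_def D.emeasure_space_1[simplified])
  also have "(\<integral>\<^sup>+ u. ennreal (s u ^ ?m) \<partial>unif01) = ennreal I"
    unfolding I_def by (rule sine_like_power(5)[OF s])
  finally have e: "emeasure \<mu> B = c * ennreal I" .
  have e0: "emeasure \<mu> B \<noteq> 0" "emeasure \<mu> B \<noteq> \<infinity>"
    using c Ipos by (auto simp: e ennreal_mult_eq_top_iff)
  show ?thesis
    unfolding radial_law_def
  proof (intro conjI exI ballI)
    show "prob_space (uniform_measure \<mu> B)"
      using e0 by (intro prob_space_uniform_measure)
    show "(\<lambda>x. x) \<in> uniform_measure \<mu> B \<rightarrow>\<^sub>M borel" using id by simp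
    fix F :: "'a \<Rightarrow> ennreal" assume F: "F \<in> borel_measurable borel"
    hence "F \<in> borel_measurable \<mu>" using measurable_compose[OF id F] by simp
    hence "(\<integral>\<^sup>+ x. F x \<partial>uniform_measure \<mu> B) = (\<integral>\<^sup>+ x. F x * indicator B x \<partial>\<mu>) / emeasure \<mu> B"
      using B by (rule nn_integral_uniform_measure)
    also have "\<dots> = c / emeasure \<mu> B * polar_integral R s F"
      unfolding int[OF F] by (simp add: ennreal_divide_times ennreal_times_divide)
    finally show "(\<integral>\<^sup>+ x. F x \<partial>uniform_measure \<mu> B) = c / emeasure \<mu> B * polar_integral R s F" .
  qed
qed

lemma norm_diff_polar_sq:
  fixes \<sigma> \<tau> :: "'a::real_inner"
  assumes "norm \<sigma> = 1" "norm \<tau> = 1"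
  shows "(norm (a *\<^sub>R \<sigma> - b *\<^sub>R \<tau>))\<^sup>2 = (a - b)\<^sup>2 + a * b * (dist \<sigma> \<tau>)\<^sup>2"
  using assms unfolding norm_eq_1 dist_norm power2_norm_eq_inner
  by (simp add: inner_diff_left inner_diff_right inner_commute[of \<tau> \<sigma>] power2_eq_square algebra_simps)

theorem euclidean_p_eq_cluster_integral:
  "euclidean_p TYPE('n::finite) = cluster_integral (CARD('n) - 1) (chord_cdf TYPE(real^'n)) (\<lambda>x. x)"
proof -
  define P where "P = uniform_measure lborel {x \<in> space lborel. dist (0::real^'n) x \<le> 1}"
  have set: "{x \<in> space lborel. dist (0::real^'n) x \<le> 1} = cball 0 1" by (auto simp: dist_commute)
  have "radial_law P (\<lambda>u. u) (\<lambda>x. x)"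
    unfolding P_def set
  proof (rule radial_law_uniform_measure)
    show "emeasure lborel (ball (0::real^'n) 1) * ennreal (real CARD('n)) \<noteq> 0"
      "emeasure lborel (ball (0::real^'n) 1) * ennreal (real CARD('n)) \<noteq> top"
      using emeasure_unit_ball[where 'a="real^'n"] by (auto simp: ennreal_mult_eq_top_iff)
    fix F :: "real^'n \<Rightarrow> ennreal" assume F: "F \<in> borel_measurable borel"
    have "(\<integral>\<^sup>+ x. ennreal 1 * indicator (cball 0 1) x * F x \<partial>lborel)
      = emeasure lborel (ball (0::real^'n) 1) * ennreal (real CARD('n)) * polar_integral (\<lambda>u. u) (\<lambda>u. u) F"
      by (rule nn_integral_radial_density[OF F, of "\<lambda>_. 1" "\<lambda>x. x" "\<lambda>u. u" _ "\<lambda>_. 1"])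
         (auto intro!: derivative_eq_intros)
    thus "(\<integral>\<^sup>+ x. F x * indicator (cball 0 1) x \<partial>lborel)
      = emeasure lborel (ball (0::real^'n) 1) * ennreal (real CARD('n)) * polar_integral (\<lambda>u. u) (\<lambda>u. u) F"
      by (simp add: mult.commute)
  qed (auto simp: sine_like_ident)
  hence "measure (P \<Otimes>\<^sub>M P) {p \<in> space (P \<Otimes>\<^sub>M P). dist (fst p) (snd p) \<le> 1}
       = cluster_integral (DIM(real^'n) - 1) (chord_cdf TYPE(real^'n)) (\<lambda>x. x)"
  proof (rule measure_pair_radial_law[OF _ sine_like_ident])
    fix u v :: real and \<sigma> \<tau> :: "real^'n"
    assume uv: "u \<in> {0<..<1}" "v \<in> {0<..<1}" and n: "norm \<sigma> = 1" "norm \<tau> = 1"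
    have "dist (u *\<^sub>R \<sigma>) (v *\<^sub>R \<tau>) \<le> 1 \<longleftrightarrow> (norm (u *\<^sub>R \<sigma> - v *\<^sub>R \<tau>))\<^sup>2 \<le> 1"
      by (simp add: dist_norm abs_square_le_1)
    also have "\<dots> \<longleftrightarrow> u * v * (dist \<sigma> \<tau>)\<^sup>2 \<le> 1 - (u - v)\<^sup>2"
      unfolding norm_diff_polar_sq[OF n] by linarith
    also have "\<dots> \<longleftrightarrow> (dist \<sigma> \<tau>)\<^sup>2 \<le> 4 * sine_ratio (\<lambda>x. x) u v"
    proof -
      have "4 * sine_ratio (\<lambda>x. x) u v = (1 - (u - v)\<^sup>2) / (u * v)"
        unfolding sine_ratio_ident times_divide_eq_right by (rule mult_divide_mult_cancel_left) simp
      thus ?thesis using uv by (simp add: pos_le_divide_eq mult.commute)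
    qed
    finally show "dist (u *\<^sub>R \<sigma>) (v *\<^sub>R \<tau>) \<le> 1 \<longleftrightarrow> (dist \<sigma> \<tau>)\<^sup>2 \<le> 4 * sine_ratio (\<lambda>x. x) u v" .
  qed measurable
  thus ?thesis
    unfolding euclidean_p_def clustering_tendency_def Let_def P_def by simp
qed

lemma hyperbolic_volume_density:
  fixes x :: "real^'n"
  assumes "norm x < 1"
  shows "sqrt (det (\<chi> i j. hyperbolic_metric 1 x (axis i 1) (axis j 1))) = (2 / (1 - (norm x)\<^sup>2)) ^ CARD('n)"
proof -
  define a where "a = 2 / (1 - (norm x)\<^sup>2)"
  have a: "0 < a" using one_minus_norm_sq_pos[OF assms] by (simp add: a_def)
  have m: "hyperbolic_metric 1 x (axis i 1) (axis j 1) = (if i = j then a\<^sup>2 else 0)" for i j :: 'n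
    by (simp add: hyperbolic_metric_def inner_axis_axis a_def power_divide)
  have "det (\<chi> i j. hyperbolic_metric 1 x (axis i 1) (axis j 1)) = (\<Prod>i\<in>(UNIV :: 'n set). a\<^sup>2)"
    by (subst det_diagonal) (simp_all add: m)
  also have "\<dots> = (a ^ CARD('n))\<^sup>2" by (simp add: power_mult[symmetric] mult.commute)
  finally show ?thesis using a by (simp add: a_def)
qed

text \<open>A point at hyperbolic distance \<open>a\<close> from the origin has Euclidean norm \<open>tanh (a / 2)\<close> in the ball model.\<close>

lemma tanh_half_identities:
  fixes x :: real
  shows "1 - (tanh (x / 2))\<^sup>2 = 1 / (cosh (x / 2))\<^sup>2" and "2 * sinh (x / 2) * cosh (x / 2) = sinh x"
    "2 * (sinh (x / 2))\<^sup>2 = cosh x - 1"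
proof -
  have "(cosh (x / 2))\<^sup>2 \<noteq> 0" by simp
  thus "1 - (tanh (x / 2))\<^sup>2 = 1 / (cosh (x / 2))\<^sup>2"
    using cosh_square_eq[of "x / 2"] by (simp add: tanh_def power_divide field_simps)
  show "2 * sinh (x / 2) * cosh (x / 2) = sinh x"
    using sinh_double[of "x / 2"] by simp
  show "2 * (sinh (x / 2))\<^sup>2 = cosh x - 1"
    using cosh_double[of "x / 2"] cosh_square_eq[of "x / 2"] by simp
qed

text \<open>The hyperbolic law of cosines, with \<open>1 - cos \<theta>\<close> written as half the squared chord.\<close>

lemma cosh_dist_polar:
  fixes \<sigma> \<tau> :: "'a::real_inner"
  assumes n: "norm \<sigma> = 1" "norm \<tau> = 1"
  shows "cosh_dist (tanh (a / 2) *\<^sub>R \<sigma>) (tanh (b / 2) *\<^sub>R \<tau>) = cosh (a - b) + sinh a * sinh b * (dist \<sigma> \<tau>)\<^sup>2 / 2"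
proof -
  let ?A = "cosh (a / 2)" and ?B = "cosh (b / 2)" and ?x = "sinh (a / 2)" and ?y = "sinh (b / 2)"
  have nz: "?A \<noteq> 0" "?B \<noteq> 0" by simp_all
  have "cosh_dist (tanh (a / 2) *\<^sub>R \<sigma>) (tanh (b / 2) *\<^sub>R \<tau>)
      = 1 + 2 * ((tanh (a / 2) - tanh (b / 2))\<^sup>2 + tanh (a / 2) * tanh (b / 2) * (dist \<sigma> \<tau>)\<^sup>2) * (?A\<^sup>2 * ?B\<^sup>2)"
    unfolding cosh_dist_def norm_diff_polar_sq[OF n] using n
    by (simp add: tanh_half_identities(1))
  also have "\<dots> = 1 + 2 * (?x * ?B - ?A * ?y)\<^sup>2 + 2 * (?x * ?A) * (?y * ?B) * (dist \<sigma> \<tau>)\<^sup>2"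
    using nz by (simp add: tanh_def field_simps power2_eq_square)
  also have "?x * ?B - ?A * ?y = sinh ((a - b) / 2)"
    by (simp add: sinh_diff diff_divide_distrib)
  also have "1 + 2 * (sinh ((a - b) / 2))\<^sup>2 = cosh (a - b)"
    by (simp add: tanh_half_identities(3))
  also have "2 * (?x * ?A) * (?y * ?B) * (dist \<sigma> \<tau>)\<^sup>2 = sinh a * sinh b * (dist \<sigma> \<tau>)\<^sup>2 / 2"
    unfolding tanh_half_identities(2)[of a, symmetric] tanh_half_identities(2)[of b, symmetric] by simp
  finally show ?thesis .
qed

lemma hyperbolic_dist_le_iff:
  fixes x y :: "real^'n"
  assumes "norm x < 1" "norm y < 1" "0 \<le> \<alpha>"
  shows "hyperbolic_dist 1 x y \<le> \<alpha> \<longleftrightarrow> cosh_dist x y \<le> cosh \<alpha>"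
proof -
  have ge: "1 \<le> cosh_dist x y" by (rule cosh_dist_ge_1[OF assms(1,2)])
  have "hyperbolic_dist 1 x y \<le> \<alpha> \<longleftrightarrow> cosh (arcosh (cosh_dist x y)) \<le> cosh \<alpha>"
    unfolding hyperbolic_dist_eq_arcosh[OF assms(1,2)]
    using ge assms(3) by (subst cosh_real_nonneg_le_iff) auto
  thus ?thesis using ge by simp
qed

lemma hyperbolic_ball_eq_cball:
  assumes "0 < \<alpha>"
  shows "{x \<in> ball (0::real^'n) 1. hyperbolic_dist 1 0 x \<le> \<alpha>} = cball 0 (tanh (\<alpha> / 2))"
proof -
  have "norm x < 1 \<and> hyperbolic_dist 1 0 x \<le> \<alpha> \<longleftrightarrow> norm x \<le> tanh (\<alpha> / 2)" for x :: "real^'n"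
  proof (cases "norm x < 1")
    case True
    have x: "0 < 1 - (norm x)\<^sup>2" by (rule one_minus_norm_sq_pos[OF True])
    let ?t = "(tanh (\<alpha> / 2))\<^sup>2"
    have t: "0 < 1 - ?t" by (simp add: tanh_half_identities(1))
    have c: "cosh \<alpha> = 1 + 2 * ?t / (1 - ?t)"
      using tanh_half_identities(3)[of \<alpha>] unfolding tanh_half_identities(1) by (simp add: tanh_def power_divide)
    have "hyperbolic_dist 1 0 x \<le> \<alpha> \<longleftrightarrow> cosh_dist 0 x \<le> cosh \<alpha>"
      using assms True by (intro hyperbolic_dist_le_iff) auto
    also have "\<dots> \<longleftrightarrow> (norm x)\<^sup>2 / (1 - (norm x)\<^sup>2) \<le> ?t / (1 - ?t)"
      unfolding c by (simp add: cosh_dist_def flip: times_divide_eq_right)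
    also have "\<dots> \<longleftrightarrow> (norm x)\<^sup>2 * (1 - ?t) \<le> ?t * (1 - (norm x)\<^sup>2)"
      using x t by (simp add: divide_simps mult.commute)
    also have "\<dots> \<longleftrightarrow> (norm x)\<^sup>2 \<le> ?t" by (simp add: algebra_simps)
    also have "\<dots> \<longleftrightarrow> norm x \<le> tanh (\<alpha> / 2)"
      using assms by (simp add: power_mono_iff)
    finally show ?thesis using True by simp
  next
    case False
    thus ?thesis using tanh_real_lt_1[of "\<alpha> / 2"] by linarith
  qed
  thus ?thesis by (simp add: set_eq_iff)
qed

text \<open>With \<open>r = tanh (\<alpha> * u / 2)\<close> one has \<open>2 * r / (1 - r\<^sup>2) = sinh (\<alpha> * u)\<close> and
\<open>dr / du = \<alpha> / 2 * (1 - r\<^sup>2)\<close>, so the volume density \<open>(2 / (1 - r\<^sup>2)) ^ d\<close> times \<open>r ^ (d - 1) * dr / du\<close>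
equals \<open>\<alpha> * sinh (\<alpha> * u) ^ (d - 1)\<close>.\<close>

theorem hyperbolic_p_eq_cluster_integral:
  assumes \<alpha>: "0 < \<alpha>"
  shows "hyperbolic_p TYPE('n::finite) \<alpha> = cluster_integral (CARD('n) - 1) (chord_cdf TYPE(real^'n)) (hyp_sine \<alpha>)"
proof -
  define \<mu> where "\<mu> = (hyperbolic_volume 1 :: (real^'n) measure)"
  define R where "R u = tanh (\<alpha> * u / 2)" for u
  define w where "w r = (2 / (1 - r\<^sup>2)) ^ CARD('n)" for r :: real
  define B where "B = {x \<in> space \<mu>. hyperbolic_dist 1 0 x \<le> \<alpha>}"
  define P where "P = uniform_measure \<mu> B"
  let ?d = "\<lambda>x :: real^'n. sqrt (det (\<chi> i j. hyperbolic_metric 1 x (axis i 1) (axis j 1)))"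
  have \<mu>: "\<mu> = density (restrict_space lborel (ball 0 1)) (\<lambda>x. ennreal (?d x))"
    by (simp add: \<mu>_def hyperbolic_volume_def riemannian_volume_def)
  have space_\<mu>: "space \<mu> = ball 0 1" by (simp add: \<mu> space_restrict_space)
  have sets_\<mu>: "sets \<mu> = sets (restrict_space lborel (ball (0::real^'n) 1))" by (simp add: \<mu>)
  have B: "B = cball 0 (R 1)"
    unfolding B_def space_\<mu> hyperbolic_ball_eq_cball[OF \<alpha>] R_def by simp
  have R1: "R 1 < 1" by (simp add: R_def tanh_real_lt_1)
  have B_ball: "B \<subseteq> ball 0 1" unfolding B using R1 by auto
  have Bsets: "B \<in> sets \<mu>"
    unfolding sets_\<mu> using B_ball by (subst sets_restrict_space_iff) (auto simp: B)
  have id: "(\<lambda>x. x) \<in> \<mu> \<rightarrow>\<^sub>M borel"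
    unfolding \<mu> by (simp add: measurable_restrict_space1)
  have wm [measurable]: "w \<in> borel_measurable borel" unfolding w_def by measurable
  have radial: "radial_law P R (hyp_sine \<alpha>)"
    unfolding P_def
  proof (rule radial_law_uniform_measure[OF sine_like_hyp_sine[OF \<alpha>] _ _ Bsets id])
    let ?C = "real CARD('n) * \<alpha> ^ CARD('n)"
    show "emeasure lborel (ball (0::real^'n) 1) * ennreal ?C \<noteq> 0"
      "emeasure lborel (ball (0::real^'n) 1) * ennreal ?C \<noteq> top"
      using emeasure_unit_ball[where 'a="real^'n"] \<alpha> by (auto simp: ennreal_mult_eq_top_iff)
    fix F :: "real^'n \<Rightarrow> ennreal" assume F [measurable]: "F \<in> borel_measurable borel"
    have Bb: "B \<in> sets borel" by (simp add: B)
    have dm: "(\<lambda>x :: real^'n. ennreal (?d x))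
         \<in> borel_measurable (restrict_space lborel (ball 0 1))"
    proof -
      have "(\<lambda>x :: real^'n. ennreal (w (norm x))) \<in> borel_measurable (restrict_space lborel (ball 0 1))"
        by (intro measurable_restrict_space1) measurable
      thus ?thesis
        by (rule measurable_cong[THEN iffD1, rotated])
           (auto simp: space_restrict_space hyperbolic_volume_density w_def)
    qed
    have fm: "(\<lambda>x. F x * indicator B x) \<in> borel_measurable (restrict_space lborel (ball 0 1))"
      using Bb by (intro measurable_restrict_space1) simp
    have "(\<integral>\<^sup>+ x. F x * indicator B x \<partial>\<mu>) = (\<integral>\<^sup>+ x. ennreal (?d x)
        * (F x * indicator B x) \<partial>restrict_space lborel (ball 0 1))"
      unfolding \<mu> by (rule nn_integral_density[OF dm fm])
    also have "\<dots> = (\<integral>\<^sup>+ x. ennreal (w (norm x)) * (F x * indicator B x) \<partial>restrict_space lborel (ball 0 1))"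
      by (rule nn_integral_cong) (simp add: space_restrict_space hyperbolic_volume_density w_def)
    also have "\<dots> = (\<integral>\<^sup>+ x. ennreal (w (norm x)) * (F x * indicator B x) * indicator (ball 0 1) x \<partial>lborel)"
      by (rule nn_integral_restrict_space) simp
    also have "\<dots> = (\<integral>\<^sup>+ x. ennreal (w (norm x)) * indicator (cball 0 (R 1)) x * F x \<partial>lborel)"
      by (rule nn_integral_cong) (use B_ball in \<open>auto simp: B indicator_def\<close>)
    also have "\<dots> = emeasure lborel (ball (0::real^'n) 1) * ennreal ?C * polar_integral R (hyp_sine \<alpha>) F"
    proof (rule nn_integral_radial_density[OF F wm, where R' = "\<lambda>u. \<alpha> / 2 * (1 - (R u)\<^sup>2)"])
      show "hyp_sine \<alpha> \<in> borel_measurable borel" by (rule sine_like_measurable[OF sine_like_hyp_sine[OF \<alpha>]])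
      show der: "(R has_real_derivative \<alpha> / 2 * (1 - (R u)\<^sup>2)) (at u)" for u
        unfolding R_def[abs_def] by (auto intro!: derivative_eq_intros)
      have contR: "continuous_on A R" for A
        by (rule DERIV_continuous_on, rule has_field_derivative_at_within, rule der)
      show "continuous_on {0..1} (\<lambda>u. \<alpha> / 2 * (1 - (R u)\<^sup>2))"
        by (intro continuous_intros contR)
      show "R \<in> borel_measurable borel" by (rule borel_measurable_continuous_onI[OF contR])
      have sq: "0 < 1 - (R u)\<^sup>2" for u unfolding R_def by (simp add: tanh_half_identities(1))
      show "0 \<le> \<alpha> / 2 * (1 - (R u)\<^sup>2)" for u using \<alpha> sq[of u] by (intro mult_nonneg_nonneg) auto
      show "0 \<le> hyp_sine \<alpha> u" if "u \<in> {0..1}" for u using that \<alpha> by (simp add: hyp_sine_def)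
      show "0 \<le> w r" if "r \<in> {0..R 1}" for r
      proof -
        have "r\<^sup>2 < 1" using that R1 by (auto simp: abs_square_less_1)
        thus ?thesis by (simp add: w_def)
      qed
      fix u :: real
      let ?c = "cosh (\<alpha> * u / 2)" and ?s = "sinh (\<alpha> * u / 2)"
      have c0: "?c \<noteq> 0" by simp
      have "R u ^ (CARD('n) - 1) * w (R u) * (\<alpha> / 2 * (1 - (R u)\<^sup>2))
         = (R u * (2 / (1 - (R u)\<^sup>2))) ^ (CARD('n) - 1) * \<alpha>"
      proof -
        have "w (R u) = (2 / (1 - (R u)\<^sup>2)) ^ (CARD('n) - 1) * (2 / (1 - (R u)\<^sup>2))"
          unfolding w_def by (simp only: power_minus_mult zero_less_card_finite)
        moreover have "(2 / (1 - (R u)\<^sup>2)) * (\<alpha> / 2 * (1 - (R u)\<^sup>2)) = \<alpha>" using sq[of u] by simp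
        ultimately show ?thesis by (simp only: power_mult_distrib mult.assoc)
      qed
      also have "R u * (2 / (1 - (R u)\<^sup>2)) = \<alpha> * hyp_sine \<alpha> u"
      proof -
        have "R u * (2 / (1 - (R u)\<^sup>2)) = 2 * ?s * ?c"
          unfolding R_def tanh_half_identities(1) using c0 by (simp add: tanh_def power2_eq_square)
        thus ?thesis using \<alpha> by (simp add: hyp_sine_def tanh_half_identities(2))
      qed
      also have "(\<alpha> * hyp_sine \<alpha> u) ^ (CARD('n) - 1) * \<alpha> = \<alpha> ^ CARD('n) * hyp_sine \<alpha> u ^ (CARD('n) - 1)"
      proof -
        have "\<alpha> ^ CARD('n) = \<alpha> ^ (CARD('n) - 1) * \<alpha>"
          by (simp only: power_minus_mult zero_less_card_finite)
        thus ?thesis by (simp only: power_mult_distrib mult_ac)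
      qed
      finally show "real DIM(real^'n) * R u ^ (DIM(real^'n) - 1) * w (R u) * (\<alpha> / 2 * (1 - (R u)\<^sup>2))
         = ?C * hyp_sine \<alpha> u ^ (DIM(real^'n) - 1)" by (simp add: mult.assoc)
    qed (use \<alpha> in \<open>auto simp: R_def\<close>)
    finally show "(\<integral>\<^sup>+ x. F x * indicator B x \<partial>\<mu>) = emeasure lborel (ball (0::real^'n) 1) * ennreal ?C * polar_integral R (hyp_sine \<alpha>) F" .
  qed
  have "measure (P \<Otimes>\<^sub>M P) {p \<in> space (P \<Otimes>\<^sub>M P). cosh_dist (fst p) (snd p) \<le> cosh \<alpha>}
       = cluster_integral (DIM(real^'n) - 1) (chord_cdf TYPE(real^'n)) (hyp_sine \<alpha>)"
  proof (rule measure_pair_radial_law[OF radial sine_like_hyp_sine[OF \<alpha>]])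
    show "Measurable.pred (borel \<Otimes>\<^sub>M borel) (\<lambda>p. cosh_dist (fst p :: real^'n) (snd p) \<le> cosh \<alpha>)"
      unfolding cosh_dist_def by measurable
    show "R \<in> borel_measurable borel" unfolding R_def[abs_def] tanh_def sinh_def cosh_def by measurable
    fix u v :: real and \<sigma> \<tau> :: "real^'n"
    assume uv: "u \<in> {0<..<1}" "v \<in> {0<..<1}" and n: "norm \<sigma> = 1" "norm \<tau> = 1"
    have ss: "0 < sinh (\<alpha> * u) * sinh (\<alpha> * v)" using uv \<alpha> by simp
    define S where "S = sinh (\<alpha> * u) * sinh (\<alpha> * v)"
    define X where "X = cosh \<alpha> - cosh (\<alpha> * u - \<alpha> * v)"
    have "4 * sine_ratio (hyp_sine \<alpha>) u v = (2 * (2 * X)) / (2 * S)"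
      using \<alpha> by (simp add: sine_ratio_hyp_sine X_def S_def)
    hence r: "4 * sine_ratio (hyp_sine \<alpha>) u v = (2 * X) / S"
      by (simp only: mult_divide_mult_cancel_left[of 2] zero_neq_numeral[symmetric] not_False_eq_True)
    have "cosh_dist (R u *\<^sub>R \<sigma>) (R v *\<^sub>R \<tau>) \<le> cosh \<alpha> \<longleftrightarrow> S * (dist \<sigma> \<tau>)\<^sup>2 \<le> 2 * X"
    proof -
      have "x + z / 2 \<le> c \<longleftrightarrow> z \<le> 2 * (c - x)" for x z c :: real
        by (auto simp: field_simps)
      thus ?thesis
        unfolding R_def cosh_dist_polar[OF n] S_def[symmetric] X_def .
    qed
    also have "\<dots> \<longleftrightarrow> (dist \<sigma> \<tau>)\<^sup>2 \<le> 4 * sine_ratio (hyp_sine \<alpha>) u v"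
      unfolding r using ss by (simp only: S_def[symmetric] pos_le_divide_eq mult.commute)
    finally show "cosh_dist (R u *\<^sub>R \<sigma>) (R v *\<^sub>R \<tau>) \<le> cosh \<alpha> \<longleftrightarrow> (dist \<sigma> \<tau>)\<^sup>2 \<le> 4 * sine_ratio (hyp_sine \<alpha>) u v" .
  qed
  also have "{p \<in> space (P \<Otimes>\<^sub>M P). cosh_dist (fst p) (snd p) \<le> cosh \<alpha>}
     = {p \<in> space (P \<Otimes>\<^sub>M P). hyperbolic_dist 1 (fst p) (snd p) \<le> \<alpha>}"
    using \<alpha> by (auto simp: P_def space_pair_measure space_\<mu> hyperbolic_dist_le_iff)
  finally show ?thesis
    unfolding hyperbolic_p_def clustering_tendency_def Let_def \<mu>_def[symmetric] B_def[symmetric] P_def[symmetric] by simp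
qed

section \<open>Chords of the circle\<close>

text \<open>Identifies the plane with pairs of reals, so that areas can be computed by iterated integrals.\<close>

lemma lborel_real2:
  "distr (lborel \<Otimes>\<^sub>M lborel) borel (\<lambda>(x, y). x *\<^sub>R axis 1 1 + y *\<^sub>R axis 2 1 :: real^2) = lborel"
proof (rule lborel_eqI[symmetric])
  let ?f = "\<lambda>(x, y). x *\<^sub>R axis 1 1 + y *\<^sub>R axis 2 1 :: real^2"
  have [measurable]: "?f \<in> borel_measurable (lborel \<Otimes>\<^sub>M lborel)"
    unfolding split_beta' by measurable
  fix l u :: "real^2" assume le: "\<And>b. b \<in> Basis \<Longrightarrow> l \<bullet> b \<le> u \<bullet> b"
  have le': "l $ i \<le> u $ i" for i
    using le[of "axis i 1"] by (simp add: inner_axis)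
  have B: "(Basis :: (real^2) set) = {axis 1 1, axis 2 1}"
    by (auto simp: Basis_vec_def UNIV_2)
  have ne: "axis 1 1 \<noteq> (axis 2 1 :: real^2)"
    by (simp add: axis_eq_axis)
  have "?f -` box l u = {l $ 1<..<u $ 1} \<times> {l $ 2<..<u $ 2}"
    by (auto simp: mem_box_cart forall_2 axis_def)
  hence "emeasure (distr (lborel \<Otimes>\<^sub>M lborel) borel ?f) (box l u)
      = emeasure (lborel \<Otimes>\<^sub>M lborel) ({l $ 1<..<u $ 1} \<times> {l $ 2<..<u $ 2})"
    by (subst emeasure_distr) (auto simp: space_pair_measure)
  also have "\<dots> = ennreal ((u $ 1 - l $ 1) * (u $ 2 - l $ 2))"
    using le' by (simp add: lborel.emeasure_pair_measure_Times ennreal_mult)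
  also have "(u $ 1 - l $ 1) * (u $ 2 - l $ 2) = (\<Prod>b\<in>Basis. (u - l) \<bullet> b)"
    using ne by (simp add: B inner_axis)
  finally show "emeasure (distr (lborel \<Otimes>\<^sub>M lborel) borel ?f) (box l u) = (\<Prod>b\<in>Basis. (u - l) \<bullet> b)" .
qed simp

lemma nn_integral_real2:
  fixes F :: "real^2 \<Rightarrow> ennreal"
  assumes [measurable]: "F \<in> borel_measurable borel"
  shows "(\<integral>\<^sup>+ z. F z \<partial>lborel) = (\<integral>\<^sup>+ y. \<integral>\<^sup>+ x. F (x *\<^sub>R axis 1 1 + y *\<^sub>R axis 2 1) \<partial>lborel \<partial>lborel)"
proof -
  have [measurable]: "(\<lambda>(x, y). x *\<^sub>R axis 1 1 + y *\<^sub>R axis 2 1 :: real^2) \<in> borel_measurable (lborel \<Otimes>\<^sub>M lborel)"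
    unfolding split_beta' by measurable
  have "(\<integral>\<^sup>+ z. F z \<partial>lborel) = (\<integral>\<^sup>+ p. F (case p of (x, y) \<Rightarrow> x *\<^sub>R axis 1 1 + y *\<^sub>R axis 2 1) \<partial>(lborel \<Otimes>\<^sub>M lborel))"
    by (subst lborel_real2[symmetric], subst nn_integral_distr) simp_all
  also have "\<dots> = (\<integral>\<^sup>+ x. \<integral>\<^sup>+ y. F (x *\<^sub>R axis 1 1 + y *\<^sub>R axis 2 1) \<partial>lborel \<partial>lborel)"
    by (subst lborel.nn_integral_fst[symmetric]) simp_all
  also have "\<dots> = (\<integral>\<^sup>+ y. \<integral>\<^sup>+ x. F (x *\<^sub>R axis 1 1 + y *\<^sub>R axis 2 1) \<partial>lborel \<partial>lborel)"
    by (rule lborel_pair.Fubini') measurable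
  finally show ?thesis .
qed

lemma nn_integral_even:
  fixes h :: "real \<Rightarrow> ennreal"
  assumes [measurable]: "h \<in> borel_measurable borel" and even: "\<And>y. h (- y) = h y"
  shows "(\<integral>\<^sup>+ y. h y \<partial>lborel) = 2 * (\<integral>\<^sup>+ y. h y * indicator {0<..} y \<partial>lborel)"
proof -
  have "(\<integral>\<^sup>+ y. h y \<partial>lborel) = (\<integral>\<^sup>+ y. h y * indicator {0<..} y + h y * indicator {..<0} y \<partial>lborel)"
    by (rule nn_integral_cong_AE, use AE_lborel_singleton[of 0] in eventually_elim) (auto simp: indicator_def)
  also have "\<dots> = (\<integral>\<^sup>+ y. h y * indicator {0<..} y \<partial>lborel) + (\<integral>\<^sup>+ y. h y * indicator {..<0} y \<partial>lborel)"
    by (rule nn_integral_add) simp_all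
  also have "(\<integral>\<^sup>+ y. h y * indicator {..<0} y \<partial>lborel) = (\<integral>\<^sup>+ y. h (- y) * indicator {..<0} (- y) \<partial>lborel)"
    by (subst nn_integral_real_affine[where c="-1" and t=0]) simp_all
  also have "\<dots> = (\<integral>\<^sup>+ y. h y * indicator {0<..} y \<partial>lborel)"
    by (rule nn_integral_cong) (simp add: even indicator_def)
  finally show ?thesis by (simp add: mult_2)
qed

text \<open>The direction of slope parameter \<open>\<tau>\<close> has first coordinate \<open>sin (arctan \<tau>)\<close>, which is increasing in \<open>\<tau>\<close>.\<close>

lemma slope_iff:
  fixes c \<tau> :: real
  assumes "-1 < c" "c < 1"
  shows "c * sqrt (1 + \<tau>\<^sup>2) \<le> \<tau> \<longleftrightarrow> c / sqrt (1 - c\<^sup>2) \<le> \<tau>"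
proof -
  have pos: "0 < sqrt (1 + \<tau>\<^sup>2)" by (simp add: add_pos_nonneg)
  have "c * sqrt (1 + \<tau>\<^sup>2) \<le> \<tau> \<longleftrightarrow> c \<le> sin (arctan \<tau>)"
    using pos by (simp add: sin_arctan pos_le_divide_eq)
  also have "\<dots> \<longleftrightarrow> sin (arcsin c) \<le> sin (arctan \<tau>)" using assms by simp
  also have "\<dots> \<longleftrightarrow> arcsin c \<le> arctan \<tau>"
    using arcsin_bounded[of c] arctan_bounded[of \<tau>] assms
    by (intro sin_mono_le_eq) auto
  also have "arcsin c = arctan (c / sqrt (1 - c\<^sup>2))"
    using assms by (intro arcsin_arctan)
  finally show ?thesis by (simp add: arctan_le_iff)
qed

text \<open>By symmetry consider the upper half only, and substitute \<open>x = y * \<tau>\<close> in the inner integral. The sector becomes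
\<open>\<tau> \<ge> T\<close>, the disc becomes \<open>y < 1 / sqrt (1 + \<tau>\<^sup>2)\<close>, and what is left is the integral of \<open>1 / (2 * (1 + \<tau>\<^sup>2))\<close>. This
treats acute and obtuse sectors alike.\<close>

lemma emeasure_sector:
  assumes c: "-1 < c" "c < 1"
  shows "emeasure lborel {z :: real^2. norm z < 1 \<and> c * norm z \<le> z $ 1} = ennreal (arccos c)"
proof -
  define T where "T = c / sqrt (1 - c\<^sup>2)"
  define Q where "Q x y \<longleftrightarrow> x\<^sup>2 + y\<^sup>2 < 1 \<and> c * sqrt (x\<^sup>2 + y\<^sup>2) \<le> x" for x y :: real
  define h where "h y = (\<integral>\<^sup>+ x. indicator {x. Q x y} x \<partial>lborel)" for y
  have nrm: "norm (x *\<^sub>R axis 1 1 + y *\<^sub>R axis 2 1 :: real^2) = sqrt (x\<^sup>2 + y\<^sup>2)" for x y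
    by (simp add: norm_vec_def L2_set_def sum_2 axis_def)
  have [measurable]: "Measurable.pred (borel \<Otimes>\<^sub>M borel) (\<lambda>p. Q (fst p) (snd p))"
    unfolding Q_def by measurable
  have [measurable]: "Measurable.pred borel (\<lambda>x. Q x y)" for y
    unfolding Q_def by measurable
  have Qmeas [measurable]: "(\<lambda>p. indicator {x. Q x (fst p)} (snd p) :: ennreal) \<in> borel_measurable (borel \<Otimes>\<^sub>M borel)"
    unfolding indicator_def Q_def mem_Collect_eq by measurable
  have [measurable]: "h \<in> borel_measurable borel"
    unfolding h_def by (rule lborel.borel_measurable_nn_integral) (use Qmeas in \<open>simp add: split_beta'\<close>)
  have sec: "{z :: real^2. norm z < 1 \<and> c * norm z \<le> z $ 1} \<in> sets borel"
  proof -
    have "{z \<in> space borel. norm z < 1 \<and> c * norm z \<le> (z :: real^2) $ 1} \<in> sets borel" by measurable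
    thus ?thesis by simp
  qed
  have "emeasure lborel {z :: real^2. norm z < 1 \<and> c * norm z \<le> z $ 1}
      = (\<integral>\<^sup>+ z. indicator {z :: real^2. norm z < 1 \<and> c * norm z \<le> z $ 1} z \<partial>lborel)"
    using sec by simp
  also have "\<dots> = (\<integral>\<^sup>+ y. h y \<partial>lborel)"
  proof -
    have "(axis 2 1 :: real^2) $ 1 = 0" by (simp add: axis_def)
    hence "indicator {z :: real^2. norm z < 1 \<and> c * norm z \<le> z $ 1} (x *\<^sub>R axis 1 1 + y *\<^sub>R axis 2 1)
        = (indicator {x. Q x y} x :: ennreal)" for x y
      by (simp add: indicator_def nrm Q_def)
    thus ?thesis
      unfolding h_def by (subst nn_integral_real2) (use sec in simp_all)
  qed
  also have "\<dots> = 2 * (\<integral>\<^sup>+ y. h y * indicator {0<..} y \<partial>lborel)"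
    by (rule nn_integral_even) (auto simp: h_def Q_def)
  also have "(\<integral>\<^sup>+ y. h y * indicator {0<..} y \<partial>lborel)
     = (\<integral>\<^sup>+ y. \<integral>\<^sup>+ \<tau>. ennreal y * indicator {0<..} y * indicator {y. y < 1 / sqrt (1 + \<tau>\<^sup>2)} y * indicator {T..} \<tau> \<partial>lborel \<partial>lborel)"
  proof (rule nn_integral_cong)
    fix y :: real
    show "h y * indicator {0<..} y = (\<integral>\<^sup>+ \<tau>. ennreal y * indicator {0<..} y * indicator {y. y < 1 / sqrt (1 + \<tau>\<^sup>2)} y * indicator {T..} \<tau> \<partial>lborel)"
    proof (cases "0 < y")
      case y: True
      have Q: "Q (y * \<tau>) y \<longleftrightarrow> y < 1 / sqrt (1 + \<tau>\<^sup>2) \<and> T \<le> \<tau>" for \<tau>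
      proof -
        have pos: "0 < sqrt (1 + \<tau>\<^sup>2)" by (simp add: add_pos_nonneg)
        have eq: "(y * \<tau>)\<^sup>2 + y\<^sup>2 = y\<^sup>2 * (1 + \<tau>\<^sup>2)" by (simp add: power_mult_distrib algebra_simps)
        have s: "sqrt ((y * \<tau>)\<^sup>2 + y\<^sup>2) = y * sqrt (1 + \<tau>\<^sup>2)"
          unfolding eq real_sqrt_mult using y by simp
        have "(y * \<tau>)\<^sup>2 + y\<^sup>2 < 1 \<longleftrightarrow> sqrt ((y * \<tau>)\<^sup>2 + y\<^sup>2) < 1" by simp
        also have "\<dots> \<longleftrightarrow> y < 1 / sqrt (1 + \<tau>\<^sup>2)" unfolding s using pos by (simp add: pos_less_divide_eq)
        finally have a: "(y * \<tau>)\<^sup>2 + y\<^sup>2 < 1 \<longleftrightarrow> y < 1 / sqrt (1 + \<tau>\<^sup>2)" .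
        have "c * sqrt ((y * \<tau>)\<^sup>2 + y\<^sup>2) \<le> y * \<tau> \<longleftrightarrow> y * (c * sqrt (1 + \<tau>\<^sup>2)) \<le> y * \<tau>"
          unfolding s by (simp only: mult_ac)
        also have "\<dots> \<longleftrightarrow> T \<le> \<tau>" using y slope_iff[OF c, of \<tau>] by (simp add: T_def)
        finally show ?thesis unfolding Q_def a by simp
      qed
      have "h y = ennreal y * (\<integral>\<^sup>+ \<tau>. indicator {x. Q x y} (y * \<tau>) \<partial>lborel)"
        unfolding h_def using y by (subst nn_integral_real_affine[where c=y and t=0]) (simp_all, measurable)
      also have "\<dots> = (\<integral>\<^sup>+ \<tau>. ennreal y * indicator {0<..} y * indicator {y. y < 1 / sqrt (1 + \<tau>\<^sup>2)} y * indicator {T..} \<tau> \<partial>lborel)"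
        using y by (subst nn_integral_cmult[symmetric]) (auto intro!: nn_integral_cong simp: indicator_def Q)
      finally show ?thesis using y by simp
    qed simp
  qed
  also have "\<dots> = (\<integral>\<^sup>+ \<tau>. \<integral>\<^sup>+ y. ennreal y * indicator {0<..} y * indicator {y. y < 1 / sqrt (1 + \<tau>\<^sup>2)} y * indicator {T..} \<tau> \<partial>lborel \<partial>lborel)"
    by (rule lborel_pair.Fubini') (simp add: indicator_def split_beta')
  also have "\<dots> = (\<integral>\<^sup>+ \<tau>. ennreal (1 / (2 * (1 + \<tau>\<^sup>2))) * indicator {T..} \<tau> \<partial>lborel)"
  proof (rule nn_integral_cong)
    fix \<tau> :: real
    define b where "b = 1 / sqrt (1 + \<tau>\<^sup>2)"
    have b: "b > 0" by (simp add: b_def add_pos_nonneg)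
    have "(\<integral>\<^sup>+ y. ennreal y * indicator {0<..} y * indicator {y. y < b} y * indicator {T..} \<tau> \<partial>lborel)
        = (\<integral>\<^sup>+ y. (ennreal y * indicator {0..b} y) * indicator {T..} \<tau> \<partial>lborel)"
      by (rule nn_integral_cong_AE, use AE_lborel_singleton[of 0] AE_lborel_singleton[of b] in eventually_elim)
         (auto simp: indicator_def)
    also have "\<dots> = (\<integral>\<^sup>+ y. ennreal y * indicator {0..b} y \<partial>lborel) * indicator {T..} \<tau>"
      by (rule nn_integral_multc) simp
    also have "(\<integral>\<^sup>+ y. ennreal y * indicator {0..b} y \<partial>lborel) = ennreal (b\<^sup>2 / 2 - 0\<^sup>2 / 2)"
      using b by (intro nn_integral_FTC_Icc) (auto intro!: derivative_eq_intros)
    also have "b\<^sup>2 / 2 - 0\<^sup>2 / 2 = 1 / (2 * (1 + \<tau>\<^sup>2))"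
      by (simp add: b_def power_divide)
    finally show "(\<integral>\<^sup>+ y. ennreal y * indicator {0<..} y * indicator {y. y < 1 / sqrt (1 + \<tau>\<^sup>2)} y * indicator {T..} \<tau> \<partial>lborel)
       = ennreal (1 / (2 * (1 + \<tau>\<^sup>2))) * indicator {T..} \<tau>" by (simp add: b_def)
  qed
  also have "\<dots> = ennreal (pi / 2 / 2 - arctan T / 2)"
  proof (rule nn_integral_FTC_atLeast)
    show "((\<lambda>x. arctan x / 2) has_real_derivative 1 / (2 * (1 + x\<^sup>2))) (at x)" for x :: real
    proof -
      have "inverse (1 + x\<^sup>2) / 2 = 1 / (2 * (1 + x\<^sup>2))" by (simp only: inverse_eq_divide divide_divide_eq_left mult.commute)
      thus ?thesis using DERIV_cdivide[OF DERIV_arctan, of 2 x] by (simp only:)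
    qed
    show "((\<lambda>x. arctan x / 2) \<longlongrightarrow> pi / 2 / 2) at_top"
      by (intro tendsto_intros tendsto_arctan_at_top) simp
  qed auto
  also have "2 * \<dots> = ennreal (pi / 2 - arctan T)"
    using arctan_ubound[of T] by (simp add: ennreal_mult[symmetric] flip: ennreal_numeral)
  also have "pi / 2 - arctan T = arccos c"
    using arccos_arctan[of c] c by (simp add: T_def)
  finally show ?thesis .
qed

text \<open>An orthogonal map takes the axis of the sector to the first coordinate axis and preserves area.\<close>

lemma measure_direction_law_cap:
  fixes a :: "real^2"
  assumes a: "norm a = 1" and c: "-1 < c" "c < 1"
  shows "measure direction_law {s. c \<le> a \<bullet> s} = arccos c / pi"
proof -
  interpret D: prob_space "direction_law :: (real^2) measure" by (rule prob_space_direction_law)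
  define S where "S a = {z :: real^2. norm z < 1 \<and> c * norm z \<le> a \<bullet> z}" for a
  have S: "S a \<in> sets borel" for a
  proof -
    have "{z \<in> space borel. norm z < 1 \<and> c * norm z \<le> a \<bullet> z} \<in> sets borel" by measurable
    thus ?thesis by (simp add: S_def)
  qed
  have Slm: "S a \<in> lmeasurable" for a
    using S[of a] by (intro bounded_set_imp_lmeasurable bounded_subset[OF bounded_ball[of 0 1]]) (auto simp: S_def)
  obtain f :: "real^2 \<Rightarrow> real^2" where f: "orthogonal_transformation f" "f (axis 1 1) = a"
    using orthogonal_transformation_exists_1[OF norm_axis_1 a] by blast
  have "S a = f ` S (axis 1 1)"
  proof -
    have "f x \<in> S a" if "x \<in> S (axis 1 1)" for x
      using that f(1) unfolding S_def f(2)[symmetric]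
      by (simp add: orthogonal_transformation_norm orthogonal_transformation_def)
    moreover have "z \<in> f ` S (axis 1 1)" if z: "z \<in> S a" for z
    proof -
      obtain x where x: "z = f x" using orthogonal_transformation_surj[OF f(1)] by (metis surj_def)
      have "x \<in> S (axis 1 1)"
        using z f(1) unfolding x S_def f(2)[symmetric]
        by (simp add: orthogonal_transformation_norm orthogonal_transformation_def)
      thus ?thesis using x by blast
    qed
    ultimately show ?thesis by blast
  qed
  hence "measure lebesgue (S a) = measure lebesgue (S (axis 1 1))"
    using measure_orthogonal_image[OF f(1) Slm] by simp
  hence "measure lborel (S a) = measure lborel (S (axis 1 1))"
    using S by simp
  also have "S (axis 1 1) = {z. norm z < 1 \<and> c * norm z \<le> z $ 1}"
    by (simp add: S_def inner_axis')
  also have "measure lborel \<dots> = arccos c"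
    using emeasure_sector[OF c] arccos_lbound[of c] c by (simp add: measure_def)
  finally have mS: "measure lborel (S a) = arccos c" .
  have "emeasure lborel (S a) = ennreal (arccos c)"
  proof -
    have "bounded (S a)"
      by (rule bounded_subset[OF bounded_ball[of 0 1]]) (auto simp: S_def)
    hence "emeasure lborel (S a) \<noteq> top"
      using emeasure_bounded_finite by fastforce
    thus ?thesis using mS by (simp add: emeasure_eq_ennreal_measure)
  qed
  moreover have "ennreal pi * emeasure direction_law {s. c \<le> a \<bullet> s} = emeasure lborel (S a)"
  proof -
    have set: "{s :: real^2. c \<le> a \<bullet> s} \<in> sets borel"
    proof -
      have "{z \<in> space borel. c \<le> a \<bullet> z} \<in> sets borel" by measurable
      thus ?thesis by simp
    qed
    have "ennreal pi * emeasure direction_law {s. c \<le> a \<bullet> s}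
      = emeasure lborel (ball (0::real^2) 1) * (\<integral>\<^sup>+ s. indicator {s. c \<le> a \<bullet> s} s \<partial>direction_law)"
      using set by (simp add: emeasure_ball unit_ball_vol_2)
    also have "\<dots> = (\<integral>\<^sup>+ y. indicator {s. c \<le> a \<bullet> s} (sgn y) * indicator (ball 0 1) y \<partial>lborel)"
      using set by (intro nn_integral_direction_law) simp
    also have "\<dots> = (\<integral>\<^sup>+ y. indicator (S a) y \<partial>lborel)"
    proof (rule nn_integral_cong_AE, use AE_lborel_singleton[of 0] in eventually_elim)
      fix y :: "real^2" assume "y \<noteq> 0"
      hence "c \<le> a \<bullet> sgn y \<longleftrightarrow> c * norm y \<le> a \<bullet> y"
        by (simp add: sgn_div_norm pos_le_divide_eq divide_inverse_commute[symmetric])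
      thus "indicator {s. c \<le> a \<bullet> s} (sgn y) * indicator (ball 0 1) y = (indicator (S a) y :: ennreal)"
        by (auto simp: S_def indicator_def)
    qed
    also have "\<dots> = emeasure lborel (S a)" using S by simp
    finally show ?thesis .
  qed
  ultimately have "ennreal (pi * measure direction_law {s. c \<le> a \<bullet> s}) = ennreal (arccos c)"
    by (simp add: D.emeasure_eq_measure ennreal_mult)
  hence "pi * measure direction_law {s. c \<le> a \<bullet> s} = arccos c"
    using arccos_lbound[of c] c by (subst (asm) ennreal_inj) auto
  thus ?thesis by (simp add: field_simps)
qed

text \<open>Unit vectors satisfy \<open>(dist s x)\<^sup>2 \<le> 4 * k\<close> iff \<open>s \<bullet> x \<ge> 1 - 2 * k\<close>, an arc of half-angle \<open>arccos (1 - 2 * k)\<close> around \<open>s\<close>.\<close>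

lemma chord_cdf_plane:
  assumes k: "0 < k"
  shows "chord_cdf TYPE(real^2) k = arccos (1 - 2 * min k 1) / pi"
proof (cases "k < 1")
  case False
  interpret L: link_law "chord_cdf TYPE(real^2)" by (rule link_law_chord_cdf)
  show ?thesis using False L.eq_1[of k] by simp
next
  case True
  interpret D: prob_space "direction_law :: (real^2) measure" by (rule prob_space_direction_law)
  interpret DD: pair_prob_space "direction_law :: (real^2) measure" "direction_law :: (real^2) measure"
    by unfold_locales
  let ?A = "{p :: (real^2) \<times> (real^2). (dist (fst p) (snd p))\<^sup>2 \<le> 4 * k}"
  have A: "?A \<in> sets (direction_law \<Otimes>\<^sub>M direction_law)"
  proof -
    have "{p \<in> space (borel \<Otimes>\<^sub>M borel). (dist (fst p) (snd p :: real^2))\<^sup>2 \<le> 4 * k} \<in> sets (borel \<Otimes>\<^sub>M borel)"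
      by measurable
    thus ?thesis by (simp add: space_pair_measure cong: sets_pair_measure_cong)
  qed
  have "emeasure (direction_law \<Otimes>\<^sub>M direction_law) ?A
     = (\<integral>\<^sup>+ s. emeasure direction_law (Pair s -` ?A) \<partial>direction_law)"
    using A by (rule D.emeasure_pair_measure_alt)
  also have "\<dots> = (\<integral>\<^sup>+ s. ennreal (arccos (1 - 2 * k) / pi) \<partial>(direction_law :: (real^2) measure))"
  proof (rule nn_integral_cong_AE, use AE_direction_law_norm in eventually_elim)
    fix s :: "real^2" assume s: "norm s = 1"
    have "emeasure direction_law (Pair s -` ?A) = emeasure direction_law {s'. 1 - 2 * k \<le> s \<bullet> s'}"
    proof (rule emeasure_eq_AE)
      show "AE x in direction_law. x \<in> Pair s -` ?A \<longleftrightarrow> x \<in> {s'. 1 - 2 * k \<le> s \<bullet> s'}"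
        using AE_direction_law_norm
      proof eventually_elim
        fix x :: "real^2" assume x: "norm x = 1"
        have "(dist s x)\<^sup>2 = 2 - 2 * (s \<bullet> x)"
          using s x unfolding norm_eq_1 by (simp add: dist_norm power2_norm_eq_inner inner_diff_left inner_diff_right inner_commute[of x s])
        thus "x \<in> Pair s -` ?A \<longleftrightarrow> x \<in> {s'. 1 - 2 * k \<le> s \<bullet> s'}" by auto
      qed
      show "Pair s -` ?A \<in> sets direction_law"
        using A by (rule sets_Pair1)
      have "{z \<in> space borel. 1 - 2 * k \<le> s \<bullet> z} \<in> sets borel" by measurable
      thus "{s'. 1 - 2 * k \<le> s \<bullet> s'} \<in> sets direction_law" by simp
    qed
    also have "\<dots> = ennreal (arccos (1 - 2 * k) / pi)"
      using measure_direction_law_cap[OF s, of "1 - 2 * k"] k True by (simp add: D.emeasure_eq_measure)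
    finally show "emeasure direction_law (Pair s -` ?A) = ennreal (arccos (1 - 2 * k) / pi)" .
  qed
  also have "\<dots> = ennreal (arccos (1 - 2 * k) / pi)"
    by (simp add: D.emeasure_space_1[simplified])
  finally have "measure (direction_law \<Otimes>\<^sub>M direction_law) ?A = arccos (1 - 2 * k) / pi"
    using arccos_lbound[of "1 - 2 * k"] k True by (simp add: measure_def)
  thus ?thesis using True by (simp add: chord_cdf_def min_def)
qed

section \<open>Areas of lenses in the hyperbolic plane\<close>

lemma integral_unif01_eq:
  fixes f :: "real \<Rightarrow> real"
  assumes "f \<in> borel_measurable borel" "\<And>x. 0 < x \<Longrightarrow> x < 1 \<Longrightarrow> \<bar>f x\<bar> \<le> B" "(f has_integral I) {0..1}"
  shows "(\<integral>x. f x \<partial>unif01) = I"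
proof -
  have int: "integrable unif01 f"
    by (rule bounded_integrable[of _ B]) (use assms in \<open>auto intro: measurable_unif01\<close>)
  hence "integrable lborel (\<lambda>x. indicator {0<..<1} x *\<^sub>R f x)"
    unfolding unif01_def by (subst (asm) integrable_restrict_space) auto
  from has_integral_integral_lborel[OF this]
  have "((\<lambda>x. indicator {0<..<1} x *\<^sub>R f x) has_integral (\<integral>x. f x \<partial>unif01)) UNIV"
    unfolding unif01_def by (subst integral_restrict_space) auto
  moreover have "(\<lambda>x. indicator {0<..<1} x *\<^sub>R f x) = (\<lambda>x. if x \<in> {0<..<1} then f x else 0)"
    by (auto simp: indicator_def)
  ultimately have "(f has_integral (\<integral>x. f x \<partial>unif01)) {0<..<1}"
    by (simp only: has_integral_restrict_UNIV)
  hence "(f has_integral (\<integral>x. f x \<partial>unif01)) {0..1}"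
    using has_integral_open_interval[of f _ "0::real" 1] by (simp add: box_real cbox_interval)
  thus ?thesis using assms(3) by (rule has_integral_unique)
qed

lemma has_integral_rescale:
  fixes f :: "real \<Rightarrow> real"
  assumes "(f has_integral I) {0..\<alpha>}" "0 < \<alpha>"
  shows "((\<lambda>u. f (\<alpha> * u)) has_integral I / \<alpha>) {0..1}"
proof -
  have "(\<lambda>x. x / \<alpha>) ` {0..\<alpha>} = {0..1}"
    using assms(2) by (auto simp: image_iff divide_simps intro!: bexI[of _ "\<alpha> * x" for x])
  thus ?thesis
    using has_integral_stretch_real[OF assms(1), of \<alpha>] assms(2) by simp
qed

text \<open>In the applications \<open>W\<close> is the same for all angles of a triangle, so that their derivatives are rational in \<open>W\<close> and
the hyperbolic functions of the sides.\<close>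

lemma DERIV_arccos_quotient:
  fixes f :: "real \<Rightarrow> real"
  assumes f: "(f has_real_derivative f') (at b)" and eq: "f b = n / d" and d: "0 < d" and W: "0 < W" "d\<^sup>2 - n\<^sup>2 = W\<^sup>2"
  shows "((\<lambda>b. arccos (f b)) has_real_derivative - (f' * d / W)) (at b)"
proof -
  have "n\<^sup>2 = d\<^sup>2 - W\<^sup>2" using W(2) by simp
  hence "(f b)\<^sup>2 = 1 - (W / d)\<^sup>2"
    using d by (simp add: eq power_divide diff_divide_distrib)
  moreover have "0 < W / d" using d W by simp
  ultimately have sq: "sqrt (1 - (f b)\<^sup>2) = W / d" and "(f b)\<^sup>2 < 1" using d W(1) by simp_all
  hence "\<bar>f b\<bar> < 1" by (simp add: abs_square_less_1)
  hence "-1 < f b" "f b < 1" by auto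
  from DERIV_chain2[OF DERIV_arccos[OF this] f]
  show ?thesis unfolding sq by (rule DERIV_cong) (simp add: field_simps)
qed

text \<open>The cosine of the angle between the sides \<open>x\<close> and \<open>y\<close>, opposite to \<open>z\<close>, in a hyperbolic triangle.\<close>

definition hyp_cos :: "real \<Rightarrow> real \<Rightarrow> real \<Rightarrow> real" where
  "hyp_cos x y z = (cosh x * cosh y - cosh z) / (sinh x * sinh y)"

lemma hyp_cos_bounds:
  assumes "0 < x" "0 < y"
  shows "\<bar>x - y\<bar> \<le> z \<Longrightarrow> hyp_cos x y z \<le> 1" "0 \<le> z \<Longrightarrow> z \<le> x + y \<Longrightarrow> -1 \<le> hyp_cos x y z"
    "x + y \<le> z \<Longrightarrow> hyp_cos x y z \<le> -1"
proof -
  have s: "0 < sinh x * sinh y" using assms by simp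
  show "hyp_cos x y z \<le> 1" if "\<bar>x - y\<bar> \<le> z"
  proof -
    have "cosh \<bar>x - y\<bar> \<le> cosh z" using that by (subst cosh_real_nonneg_le_iff) auto
    thus ?thesis using s by (simp add: hyp_cos_def pos_divide_le_eq cosh_diff)
  qed
  show "-1 \<le> hyp_cos x y z" if "0 \<le> z" "z \<le> x + y"
  proof -
    have "cosh z \<le> cosh (x + y)" using that by (subst cosh_real_nonneg_le_iff) auto
    thus ?thesis using s by (simp add: hyp_cos_def pos_le_divide_eq cosh_add)
  qed
  show "hyp_cos x y z \<le> -1" if "x + y \<le> z"
  proof -
    have "cosh (x + y) \<le> cosh z" using that assms by (subst cosh_real_nonneg_le_iff) auto
    thus ?thesis using s by (simp add: hyp_cos_def pos_divide_le_eq cosh_add)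
  qed
qed

lemma continuous_on_arccos_hyp_cos:
  assumes "continuous_on S f" "continuous_on S g" "continuous_on S h"
    and "\<And>b. b \<in> S \<Longrightarrow> 0 < f b \<and> 0 < g b \<and> \<bar>f b - g b\<bar> \<le> h b \<and> h b \<le> f b + g b"
  shows "continuous_on S (\<lambda>b. arccos (hyp_cos (f b) (g b) (h b)))"
proof (rule continuous_on_arccos)
  show "continuous_on S (\<lambda>b. hyp_cos (f b) (g b) (h b))"
    unfolding hyp_cos_def using assms by (intro continuous_intros) fastforce+
  show "\<forall>b\<in>S. -1 \<le> hyp_cos (f b) (g b) (h b) \<and> hyp_cos (f b) (g b) (h b) \<le> 1"
    using assms(4) hyp_cos_bounds(1,2) by (metis abs_ge_zero order_trans)
qed

text \<open>
The lens is the intersection of two discs of radius \<open>\<alpha>\<close> whose centres are at distance \<open>a\<close>. Consider the triangle with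
sides \<open>a\<close>, \<open>b\<close> and \<open>\<alpha>\<close>, where \<open>b\<close> varies. The primitive \<open>F b\<close> combines its three angles; up to a constant it is the
area of the part of one half of the lens that lies within distance \<open>b\<close> of the first centre or beyond the side \<open>b\<close>,
computed from two sectors and a triangle by the angle defect. The derivatives of the angles have the common denominator
\<open>sinh b * W\<close>, where \<open>W\<^sup>2\<close> is the Gram determinant, and their contributions to the derivative of \<open>F\<close> cancel.\<close>

lemma has_integral_lens_upper:
  assumes a: "0 < a" "a < \<alpha>"
  shows "((\<lambda>b. sinh b * arccos (hyp_cos a b \<alpha>)) has_integral
     (2 * cosh \<alpha> * arccos (hyp_cos a \<alpha> \<alpha>) + arccos (hyp_cos \<alpha> \<alpha> a)) - pi * cosh (\<alpha> - a)) {\<alpha> - a..\<alpha>}"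
proof -
  define F where "F b = cosh b * arccos (hyp_cos a b \<alpha>) + cosh \<alpha> * arccos (hyp_cos a \<alpha> b) + arccos (hyp_cos b \<alpha> a)" for b
  have "((\<lambda>b. sinh b * arccos (hyp_cos a b \<alpha>)) has_integral (F \<alpha> - F (\<alpha> - a))) {\<alpha> - a..\<alpha>}"
  proof (rule fundamental_theorem_of_calculus_interior)
    show "\<alpha> - a \<le> \<alpha>" using a by simp
    show "continuous_on {\<alpha> - a..\<alpha>} F"
      unfolding F_def using a
      by (intro continuous_intros continuous_on_arccos_hyp_cos) auto
    fix b assume b: "b \<in> {\<alpha> - a<..<\<alpha>}"
    define A B C where "A = cosh a" and "B = cosh b" and "C = cosh \<alpha>"
    define sa sb S where "sa = sinh a" and "sb = sinh b" and "S = sinh \<alpha>"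
    have sq: "A\<^sup>2 = sa\<^sup>2 + 1" "B\<^sup>2 = sb\<^sup>2 + 1" "C\<^sup>2 = S\<^sup>2 + 1"
      by (simp_all add: A_def B_def C_def sa_def sb_def S_def cosh_square_eq)
    have pos: "0 < sa" "0 < sb" "0 < S" using a b by (auto simp: sa_def sb_def S_def)
    have gram: "(sa * sb)\<^sup>2 - (A * B - C)\<^sup>2 = 1 + 2 * A * B * C - A\<^sup>2 - B\<^sup>2 - C\<^sup>2"
       "(sa * S)\<^sup>2 - (A * C - B)\<^sup>2 = 1 + 2 * A * B * C - A\<^sup>2 - B\<^sup>2 - C\<^sup>2"
       "(sb * S)\<^sup>2 - (B * C - A)\<^sup>2 = 1 + 2 * A * B * C - A\<^sup>2 - B\<^sup>2 - C\<^sup>2"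
      using sq by algebra+
    have "0 < 1 + 2 * A * B * C - A\<^sup>2 - B\<^sup>2 - C\<^sup>2"
    proof -
      have "cosh \<alpha> < cosh (a + b)" "cosh (a - b) < cosh \<alpha>"
        using a b cosh_real_nonneg_less_iff[of \<alpha> "a + b"] cosh_real_nonneg_less_iff[of "\<bar>a - b\<bar>" \<alpha>] by auto
      hence "0 < sa * sb + (A * B - C)" "0 < sa * sb - (A * B - C)"
        by (auto simp: cosh_add cosh_diff A_def B_def C_def sa_def sb_def)
      hence "0 < (sa * sb + (A * B - C)) * (sa * sb - (A * B - C))" by (rule mult_pos_pos)
      also have "\<dots> = (sa * sb)\<^sup>2 - (A * B - C)\<^sup>2" by algebra
      finally show ?thesis unfolding gram(1) .
    qed
    then obtain W where W: "0 < W" "1 + 2 * A * B * C - A\<^sup>2 - B\<^sup>2 - C\<^sup>2 = W\<^sup>2"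
      using real_sqrt_gt_zero real_sqrt_pow2 less_imp_le by metis
    note gram = gram[unfolded W(2)]
    have d1: "((\<lambda>b. hyp_cos a b \<alpha>) has_real_derivative (C * B - A) / (sa * sb\<^sup>2)) (at b)"
      unfolding hyp_cos_def using pos sq(2)
      by (auto intro!: derivative_eq_intros simp: A_def[symmetric] B_def[symmetric] C_def[symmetric] sa_def[symmetric] sb_def[symmetric]
          divide_simps power2_eq_square) algebra
    have d2: "((\<lambda>b. hyp_cos a \<alpha> b) has_real_derivative - sb / (sa * S)) (at b)"
      unfolding hyp_cos_def using pos
      by (auto intro!: derivative_eq_intros simp: sa_def[symmetric] sb_def[symmetric] S_def[symmetric])
    have d3: "((\<lambda>b. hyp_cos b \<alpha> a) has_real_derivative (A * B - C) / (sb\<^sup>2 * S)) (at b)"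
      unfolding hyp_cos_def using pos sq(2)
      by (auto intro!: derivative_eq_intros simp: A_def[symmetric] B_def[symmetric] C_def[symmetric] S_def[symmetric] sb_def[symmetric]
          divide_simps power2_eq_square) algebra
    have e: "hyp_cos a b \<alpha> = (A * B - C) / (sa * sb)" "hyp_cos a \<alpha> b = (A * C - B) / (sa * S)"
      "hyp_cos b \<alpha> a = (B * C - A) / (sb * S)"
      by (simp_all add: hyp_cos_def A_def B_def C_def sa_def sb_def S_def)
    have p: "0 < sa * sb" "0 < sa * S" "0 < sb * S" using pos by simp_all
    have D1: "((\<lambda>b. arccos (hyp_cos a b \<alpha>)) has_real_derivative (A - C * B) / (sb * W)) (at b)"
      by (rule DERIV_cong[OF DERIV_arccos_quotient[OF d1 e(1) p(1) W(1) gram(1)]])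
         (use pos W(1) in \<open>simp add: divide_simps power2_eq_square\<close>)
    have D2: "((\<lambda>b. arccos (hyp_cos a \<alpha> b)) has_real_derivative sb / W) (at b)"
      by (rule DERIV_cong[OF DERIV_arccos_quotient[OF d2 e(2) p(2) W(1) gram(2)]])
         (use pos W(1) in \<open>simp add: divide_simps\<close>)
    have D3: "((\<lambda>b. arccos (hyp_cos b \<alpha> a)) has_real_derivative (C - A * B) / (sb * W)) (at b)"
      by (rule DERIV_cong[OF DERIV_arccos_quotient[OF d3 e(3) p(3) W(1) gram(3)]])
         (use pos W(1) in \<open>simp add: divide_simps power2_eq_square\<close>)
    have dcosh: "(cosh has_real_derivative sinh b) (at b)" by (auto intro!: derivative_eq_intros)
    have "(F has_real_derivative sinh b * arccos (hyp_cos a b \<alpha>) + (cosh b * ((A - C * B) / (sb * W)) + cosh \<alpha> * (sb / W) + (C - A * B) / (sb * W))) (at b)"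
      unfolding F_def[abs_def]
      by (rule DERIV_cong[OF DERIV_add[OF DERIV_add[OF DERIV_mult[OF dcosh D1] DERIV_cmult[OF D2]] D3]]) simp
    moreover have "cosh b * ((A - C * B) / (sb * W)) + cosh \<alpha> * (sb / W) + (C - A * B) / (sb * W) = 0"
      unfolding B_def[symmetric] C_def[symmetric] using pos W(1) sq(2)
      by (simp add: divide_simps) algebra
    ultimately show "(F has_vector_derivative sinh b * arccos (hyp_cos a b \<alpha>)) (at b)"
      by (simp add: has_real_derivative_iff_has_vector_derivative)
  qed
  moreover have "F \<alpha> = 2 * cosh \<alpha> * arccos (hyp_cos a \<alpha> \<alpha>) + arccos (hyp_cos \<alpha> \<alpha> a)"
    by (simp add: F_def)
  moreover have "F (\<alpha> - a) = pi * cosh (\<alpha> - a)"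
  proof -
    have s: "0 < sinh a" "0 < sinh (\<alpha> - a)" "0 < sinh \<alpha>" using a by auto
    have "cosh \<alpha> = cosh a * cosh (\<alpha> - a) + sinh a * sinh (\<alpha> - a)"
      using cosh_add[of a "\<alpha> - a"] by simp
    hence "hyp_cos a (\<alpha> - a) \<alpha> = -1" using s by (simp add: hyp_cos_def)
    moreover have "cosh (\<alpha> - a) = cosh a * cosh \<alpha> - sinh a * sinh \<alpha>"
      by (simp add: cosh_diff mult.commute)
    hence "hyp_cos a \<alpha> (\<alpha> - a) = 1" using s by (simp add: hyp_cos_def)
    moreover have "cosh a = cosh (\<alpha> - a) * cosh \<alpha> - sinh (\<alpha> - a) * sinh \<alpha>"
      using cosh_diff[of "\<alpha> - a" \<alpha>] by simp
    hence "hyp_cos (\<alpha> - a) \<alpha> a = 1" using s by (simp add: hyp_cos_def)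
    ultimately show ?thesis by (simp add: F_def)
  qed
  ultimately show ?thesis by simp
qed

text \<open>For \<open>b \<le> \<alpha> - a\<close> all directions qualify, and the truncation at \<open>-1\<close> makes the angle equal to \<open>\<pi>\<close> there.\<close>

lemma has_integral_lens:
  assumes a: "0 < a" "a < \<alpha>"
  shows "((\<lambda>b. sinh b * arccos (max (-1) (hyp_cos a b \<alpha>))) has_integral
     2 * cosh \<alpha> * arccos (hyp_cos a \<alpha> \<alpha>) + arccos (hyp_cos \<alpha> \<alpha> a) - pi) {0..\<alpha>}"
proof -
  have "((\<lambda>b. sinh b * pi) has_integral cosh (\<alpha> - a) * pi - cosh 0 * pi) {0..\<alpha> - a}"
    using a by (intro fundamental_theorem_of_calculus)
      (auto intro!: derivative_eq_intros simp flip: has_real_derivative_iff_has_vector_derivative)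
  hence 1: "((\<lambda>b. sinh b * arccos (max (-1) (hyp_cos a b \<alpha>))) has_integral cosh (\<alpha> - a) * pi - cosh 0 * pi) {0..\<alpha> - a}"
  proof (rule has_integral_eq[rotated])
    fix b assume b: "b \<in> {0..\<alpha> - a}"
    show "sinh b * pi = sinh b * arccos (max (-1) (hyp_cos a b \<alpha>))"
    proof (cases "b = 0")
      case False
      hence "hyp_cos a b \<alpha> \<le> -1" using a b by (intro hyp_cos_bounds(3)) auto
      thus ?thesis by (simp add: max_absorb1)
    qed simp
  qed
  have 2: "((\<lambda>b. sinh b * arccos (max (-1) (hyp_cos a b \<alpha>))) has_integral
     (2 * cosh \<alpha> * arccos (hyp_cos a \<alpha> \<alpha>) + arccos (hyp_cos \<alpha> \<alpha> a)) - pi * cosh (\<alpha> - a)) {\<alpha> - a..\<alpha>}"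
  proof (rule has_integral_eq[OF _ has_integral_lens_upper[OF a]])
    fix b assume b: "b \<in> {\<alpha> - a..\<alpha>}"
    hence "-1 \<le> hyp_cos a b \<alpha>" using a by (intro hyp_cos_bounds(2)) auto
    thus "sinh b * arccos (hyp_cos a b \<alpha>) = sinh b * arccos (max (-1) (hyp_cos a b \<alpha>))"
      by (simp add: max_absorb2)
  qed
  show ?thesis
    using has_integral_combine[OF _ _ 1 2] a by (simp add: algebra_simps)
qed

text \<open>These forms of the base angle and of the apex angle also make sense at \<open>a = 0\<close>.\<close>

lemma hyp_cos_isosceles:
  assumes "0 < a" "0 < \<alpha>"
  shows "hyp_cos a \<alpha> \<alpha> = tanh (a / 2) * cosh \<alpha> / sinh \<alpha>" "hyp_cos \<alpha> \<alpha> a = ((cosh \<alpha>)\<^sup>2 - cosh a) / (sinh \<alpha>)\<^sup>2"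
proof -
  have "2 * (sinh (a / 2))\<^sup>2 * cosh (a / 2) = sinh (a / 2) * sinh a"
    using tanh_half_identities(2)[of a] by (simp add: power2_eq_square)
  hence "(cosh a - 1) * cosh (a / 2) = sinh (a / 2) * sinh a"
    by (simp add: tanh_half_identities(3))
  hence "(cosh a - 1) / sinh a = tanh (a / 2)"
    using assms by (simp add: tanh_def field_simps)
  moreover have "hyp_cos a \<alpha> \<alpha> = (cosh a - 1) / sinh a * (cosh \<alpha> / sinh \<alpha>)"
    by (simp add: hyp_cos_def left_diff_distrib)
  ultimately show "hyp_cos a \<alpha> \<alpha> = tanh (a / 2) * cosh \<alpha> / sinh \<alpha>" by simp
  show "hyp_cos \<alpha> \<alpha> a = ((cosh \<alpha>)\<^sup>2 - cosh a) / (sinh \<alpha>)\<^sup>2"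
    by (simp add: hyp_cos_def power2_eq_square)
qed

text \<open>The primitive \<open>H\<close> comes from integration by parts in the variable \<open>cosh a\<close>. The derivatives of both angles have the
same square root \<open>W\<close> in the denominator, which is also the last ingredient of \<open>H\<close>. At \<open>a = \<alpha>\<close> the triangle is
equilateral, and both angles are equal to \<open>\<Omega>\<close>.\<close>

lemma has_integral_lens_areas:
  assumes \<alpha>: "0 < \<alpha>"
  defines "C \<equiv> cosh \<alpha>" and "S \<equiv> sinh \<alpha>"
  defines "\<Omega> \<equiv> arccos (C / (C + 1))"
  shows "((\<lambda>a. sinh a * (2 * C * arccos (tanh (a / 2) * C / S) + arccos ((C\<^sup>2 - cosh a) / S\<^sup>2) - pi)) has_integral
     3 * C * (C + 1) * \<Omega> + (C - 1) * sqrt (2 * C + 1) - 3 * pi * C + pi) {0..\<alpha>}"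
proof -
  have C1: "1 < C" using \<alpha> cosh_real_nonneg_less_iff[of 0 \<alpha>] by (simp add: C_def)
  have S0: "0 < S" using \<alpha> by (simp add: S_def)
  have CS: "C\<^sup>2 = S\<^sup>2 + 1" by (simp add: C_def S_def cosh_square_eq)
  have half: "tanh (a / 2) * (cosh a + 1) = sinh a" for a :: real
  proof -
    have "cosh a + 1 = 2 * (cosh (a / 2))\<^sup>2"
      using tanh_half_identities(3)[of a] cosh_square_eq[of "a / 2"] by simp
    thus ?thesis using tanh_half_identities(2)[of a] by (simp add: tanh_def power2_eq_square)
  qed
  define H where "H a = 2 * C * ((cosh a + 1) * arccos (tanh (a / 2) * C / S) + C * arccos ((C\<^sup>2 - cosh a) / S\<^sup>2))
     + (cosh a - C\<^sup>2) * arccos ((C\<^sup>2 - cosh a) / S\<^sup>2) + sqrt ((cosh a - 1) * (2 * C\<^sup>2 - 1 - cosh a)) - pi * cosh a" for a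
  have top1: "tanh (\<alpha> / 2) * C / S = C / (C + 1)"
    using half[of \<alpha>] C1 S0 by (simp add: C_def[symmetric] S_def[symmetric] field_simps)
  have top2: "(C\<^sup>2 - C) / S\<^sup>2 = C / (C + 1)"
    using CS C1 S0 by (simp add: field_simps power2_eq_square)
  have "((\<lambda>a. sinh a * (2 * C * arccos (tanh (a / 2) * C / S) + arccos ((C\<^sup>2 - cosh a) / S\<^sup>2) - pi)) has_integral
     (H \<alpha> - H 0)) {0..\<alpha>}"
  proof (rule fundamental_theorem_of_calculus_interior)
    have b1: "0 \<le> tanh (a / 2) * C / S \<and> tanh (a / 2) * C / S \<le> 1" if "a \<in> {0..\<alpha>}" for a
    proof -
      have "tanh (a / 2) * C / S \<le> tanh (\<alpha> / 2) * C / S"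
        using that C1 S0 by (intro divide_right_mono mult_right_mono) auto
      also have "\<dots> \<le> 1" unfolding top1 using C1 by simp
      finally show ?thesis using that C1 S0 by simp
    qed
    have b2: "0 \<le> (C\<^sup>2 - cosh a) / S\<^sup>2 \<and> (C\<^sup>2 - cosh a) / S\<^sup>2 \<le> 1" if "a \<in> {0..\<alpha>}" for a
    proof -
      have "cosh a \<le> C" using that \<alpha> by (simp add: C_def cosh_real_nonneg_le_iff)
      moreover have "C \<le> C\<^sup>2" using C1 by (simp add: power2_eq_square)
      ultimately show ?thesis using CS S0 cosh_real_ge_1[of a] by (simp add: divide_le_eq)
    qed
    show "continuous_on {0..\<alpha>} H"
      unfolding H_def using S0 b1 b2 by (intro continuous_intros) (auto intro: order_trans[of _ 0])
    fix a assume a: "a \<in> {0<..<\<alpha>}"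
    define A sa where "A = cosh a" and "sa = sinh a"
    have A: "1 < A" "A < C" "0 < sa" "A\<^sup>2 = sa\<^sup>2 + 1"
      using a \<alpha> cosh_real_nonneg_less_iff[of 0 a] cosh_real_nonneg_less_iff[of a \<alpha>]
      by (auto simp: A_def C_def sa_def cosh_square_eq)
    have "C \<le> C\<^sup>2" using C1 by (simp add: power2_eq_square)
    hence "0 < 2 * C\<^sup>2 - 1 - A" using A C1 by linarith
    hence Q: "0 < (A - 1) * (2 * C\<^sup>2 - 1 - A)" using A by simp
    define W where "W = sqrt ((A - 1) * (2 * C\<^sup>2 - 1 - A))"
    have W: "0 < W" "W\<^sup>2 = (A - 1) * (2 * C\<^sup>2 - 1 - A)" using Q by (simp_all add: W_def)
    have hA: "tanh (a / 2) = sa / (A + 1)"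
      using half[of a] A by (simp add: A_def[symmetric] sa_def[symmetric] field_simps)
    have d1: "((\<lambda>a. tanh (a / 2) * C / S) has_real_derivative C / (S * (A + 1))) (at a)"
    proof -
      have "(1 - (tanh (a / 2))\<^sup>2) / 2 = 1 / (A + 1)"
      proof -
        have "A + 1 = 2 * (cosh (a / 2))\<^sup>2"
          using tanh_half_identities(3)[of a] cosh_square_eq[of "a / 2"] by (simp add: A_def)
        thus ?thesis by (simp add: tanh_half_identities(1))
      qed
      moreover have "((\<lambda>a. tanh (a / 2) * C / S) has_real_derivative (1 - (tanh (a / 2))\<^sup>2) / 2 * C / S) (at a)"
        using S0 by (auto intro!: derivative_eq_intros)
      ultimately have "((\<lambda>a. tanh (a / 2) * C / S) has_real_derivative 1 / (A + 1) * C / S) (at a)"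
        by (simp only:)
      thus ?thesis by (rule DERIV_cong) simp
    qed
    have d2: "((\<lambda>a. (C\<^sup>2 - cosh a) / S\<^sup>2) has_real_derivative - sa / S\<^sup>2) (at a)"
      unfolding sa_def by (rule DERIV_cdivide) (auto intro!: derivative_eq_intros)
    have e1: "tanh (a / 2) * C / S = (C * (A - 1)) / (sa * S)"
    proof -
      have "sa * sa = (A - 1) * (A + 1)" using A(4) by algebra
      hence "sa / (A + 1) = (A - 1) / sa" using A by (simp add: frac_eq_eq)
      thus ?thesis unfolding hA by simp
    qed
    have g1: "(sa * S)\<^sup>2 - (C * (A - 1))\<^sup>2 = W\<^sup>2"
      unfolding W(2) using A(4) CS by algebra
    have g2: "(S\<^sup>2)\<^sup>2 - (C\<^sup>2 - A)\<^sup>2 = W\<^sup>2"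
      unfolding W(2) using CS by algebra
    have D1: "((\<lambda>a. arccos (tanh (a / 2) * C / S)) has_real_derivative - (C * sa / ((A + 1) * W))) (at a)"
    proof (rule DERIV_cong[OF DERIV_arccos_quotient[OF d1 e1 _ W(1) g1]])
      show "0 < sa * S" using A S0 by simp
      have "C / (S * K) * (sa * S) / W = C * sa / (K * W)" for K
        using S0 by simp
      thus "- (C / (S * (A + 1)) * (sa * S) / W) = - (C * sa / ((A + 1) * W))" by (simp only:)
    qed
    have D2: "((\<lambda>a. arccos ((C\<^sup>2 - cosh a) / S\<^sup>2)) has_real_derivative sa / W) (at a)"
      by (rule DERIV_cong[OF DERIV_arccos_quotient[OF d2 _ _ W(1) g2]])
         (use S0 W(1) in \<open>simp_all add: A_def\<close>)
    have D3: "((\<lambda>a. sqrt ((cosh a - 1) * (2 * C\<^sup>2 - 1 - cosh a))) has_real_derivative sa * (C\<^sup>2 - A) / W) (at a)"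
    proof -
      have "((\<lambda>a. (cosh a - 1) * (2 * C\<^sup>2 - 1 - cosh a)) has_real_derivative sa * (2 * (C\<^sup>2 - A))) (at a)"
        unfolding sa_def A_def by (auto intro!: derivative_eq_intros simp: algebra_simps)
      from DERIV_chain2[OF DERIV_real_sqrt[OF Q[unfolded A_def]] this]
      show ?thesis by (rule DERIV_cong) (simp add: W_def A_def divide_simps)
    qed
    have dc: "(cosh has_real_derivative sa) (at a)" unfolding sa_def by (auto intro!: derivative_eq_intros)
    have "(H has_real_derivative 2 * C * (sa * arccos (tanh (a / 2) * C / S) + (A + 1) * (- (C * sa / ((A + 1) * W))) + C * (sa / W))
       + (sa * arccos ((C\<^sup>2 - cosh a) / S\<^sup>2) + (A - C\<^sup>2) * (sa / W)) + sa * (C\<^sup>2 - A) / W - pi * sa) (at a)"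
      unfolding H_def[abs_def] A_def
      by (rule derivative_eq_intros dc D1[unfolded A_def] D2 D3[unfolded A_def] refl)+ (simp add: algebra_simps)
    moreover have "2 * C * (sa * arccos (tanh (a / 2) * C / S) + (A + 1) * (- (C * sa / ((A + 1) * W))) + C * (sa / W))
       + (sa * arccos ((C\<^sup>2 - cosh a) / S\<^sup>2) + (A - C\<^sup>2) * (sa / W)) + sa * (C\<^sup>2 - A) / W - pi * sa
       = sinh a * (2 * C * arccos (tanh (a / 2) * C / S) + arccos ((C\<^sup>2 - cosh a) / S\<^sup>2) - pi)"
    proof -
      have "(A + 1) * (- (C * sa / ((A + 1) * W))) + C * (sa / W) = 0"
        using A W(1) by simp
      moreover have "(A - C\<^sup>2) * (sa / W) + sa * (C\<^sup>2 - A) / W = 0"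
        by (simp add: algebra_simps diff_divide_distrib)
      ultimately show ?thesis unfolding sa_def[symmetric] by algebra
    qed
    ultimately show "(H has_vector_derivative sinh a * (2 * C * arccos (tanh (a / 2) * C / S) + arccos ((C\<^sup>2 - cosh a) / S\<^sup>2) - pi)) (at a)"
      by (simp add: has_real_derivative_iff_has_vector_derivative)
  qed (use \<alpha> in simp)
  moreover have "H \<alpha> = 3 * C * (C + 1) * \<Omega> + (C - 1) * sqrt (2 * C + 1) - pi * C"
  proof -
    have "(C - 1) * (2 * C\<^sup>2 - 1 - C) = (C - 1)\<^sup>2 * (2 * C + 1)" by algebra
    hence "sqrt ((C - 1) * (2 * C\<^sup>2 - 1 - C)) = (C - 1) * sqrt (2 * C + 1)"
      using C1 by (simp add: real_sqrt_mult)
    thus ?thesis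
      unfolding H_def C_def[symmetric] top1 top2 \<Omega>_def[symmetric] by algebra
  qed
  moreover have "H 0 = 2 * C * pi - pi"
    using S0 CS by (simp add: H_def)
  ultimately show ?thesis by (simp add: algebra_simps)
qed

section \<open>The closed form in the hyperbolic plane\<close>

lemma abs_integral_unif01_le:
  fixes f :: "real \<Rightarrow> real"
  assumes "f \<in> borel_measurable unif01" "\<And>x. 0 < x \<Longrightarrow> x < 1 \<Longrightarrow> \<bar>f x\<bar> \<le> B"
  shows "\<bar>\<integral>x. f x \<partial>unif01\<bar> \<le> B"
proof -
  interpret U: prob_space unif01 by (rule prob_space_unif01)
  have int: "integrable unif01 f" by (rule bounded_integrable[OF assms])
  have "\<bar>\<integral>x. f x \<partial>unif01\<bar> \<le> (\<integral>x. \<bar>f x\<bar> \<partial>unif01)" by (rule integral_abs_bound)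
  also have "\<dots> \<le> (\<integral>x. B \<partial>unif01)"
    using int assms(2) by (intro integral_mono) auto
  also have "\<dots> = B" by (simp add: U.prob_space[simplified])
  finally show ?thesis .
qed

lemma sine_ratio_pos:
  assumes "sine_like s" "0 < u" "u < 1" "0 < v" "v \<le> 1"
  shows "0 < sine_ratio s u v"
  unfolding sine_ratio_def using assms sine_like_pos[OF assms(1)]
  by (intro divide_pos_pos mult_pos_pos) auto

lemma hyp_cos_eq_sine_ratio:
  assumes "\<alpha> \<noteq> 0" "u \<noteq> 0" "v \<noteq> 0"
  shows "1 - 2 * sine_ratio (hyp_sine \<alpha>) u v = hyp_cos (\<alpha> * u) (\<alpha> * v) \<alpha>"
proof -
  define S where "S = sinh (\<alpha> * u) * sinh (\<alpha> * v)"
  have S: "S \<noteq> 0" using assms by (simp add: S_def)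
  have "2 * sine_ratio (hyp_sine \<alpha>) u v = (cosh \<alpha> - cosh (\<alpha> * u - \<alpha> * v)) / S"
    unfolding sine_ratio_hyp_sine[OF assms(1)] S_def[symmetric] times_divide_eq_right
    by (rule mult_divide_mult_cancel_left) simp
  hence "1 - 2 * sine_ratio (hyp_sine \<alpha>) u v = (S - (cosh \<alpha> - cosh (\<alpha> * u - \<alpha> * v))) / S"
    using S by (simp add: diff_divide_distrib)
  thus ?thesis by (simp add: hyp_cos_def S_def cosh_diff)
qed

text \<open>As a function of \<open>C = cosh \<alpha>\<close>; \<open>arccos (C / (C + 1))\<close> is the angle of the equilateral triangle of side \<open>\<alpha>\<close>.\<close>

definition hyperbolic_plane_p :: "real \<Rightarrow> real" where
  "hyperbolic_plane_p C = (3 * C * (C + 1) * arccos (C / (C + 1)) + (C - 1) * sqrt (2 * C + 1) - 3 * pi * C + pi)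
     / (pi * (C - 1)\<^sup>2)"

text \<open>The inner integral is the one of \<open>has_integral_lens\<close> at \<open>a = \<alpha> * u\<close>, the outer one that of
\<open>has_integral_lens_areas\<close>; each rescaling of a radius and each factor of \<open>hyp_sine\<close> contributes \<open>1 / \<alpha>\<close>.\<close>

theorem hyperbolic_p_plane:
  assumes \<alpha>: "0 < \<alpha>"
  shows "hyperbolic_p TYPE(2) \<alpha> = hyperbolic_plane_p (cosh \<alpha>)"
proof -
  define s where "s = hyp_sine \<alpha>"
  have s: "sine_like s" unfolding s_def by (rule sine_like_hyp_sine[OF \<alpha>])
  have sm [measurable]: "s \<in> borel_measurable borel" by (rule sine_like_measurable[OF s])
  interpret L: link_law "chord_cdf TYPE(real^2)" by (rule link_law_chord_cdf)
  define C S where "C = cosh \<alpha>" and "S = sinh \<alpha>"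
  have C1: "1 < C" using \<alpha> cosh_real_nonneg_less_iff[of 0 \<alpha>] by (simp add: C_def)
  define f where "f u v = s u * (s v * chord_cdf TYPE(real^2) (sine_ratio s u v))" for u v
  define J where "J u = (\<integral>v. f u v \<partial>unif01)" for u
  define T where "T a = 2 * C * arccos (tanh (a / 2) * C / S) + arccos ((C\<^sup>2 - cosh a) / S\<^sup>2) - pi" for a
  have fm [measurable]: "(\<lambda>(u, v). f u v) \<in> borel_measurable (borel \<Otimes>\<^sub>M borel)"
    unfolding f_def sine_ratio_def by measurable
  have s01: "0 < s u" "s u \<le> s 1" if "0 < u" "u < 1" for u
    using sine_like_pos[OF s, of u] sine_like_less[OF s, of u 1] that by auto
  have fb: "\<bar>f u v\<bar> \<le> s 1 * (s 1 * 1)" if "0 < u" "u < 1" "0 < v" "v < 1" for u v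
    unfolding f_def abs_mult using s01[OF that(1,2)] s01[OF that(3,4)] L.nonneg L.le_1
    by (intro mult_mono) auto
  have J: "J u = s u * (T (\<alpha> * u) / (pi * \<alpha>\<^sup>2))" if u: "0 < u" "u < 1" for u
    unfolding J_def
  proof (rule integral_unif01_eq)
    show "f u \<in> borel_measurable borel" by measurable
    show "\<bar>f u v\<bar> \<le> s 1 * (s 1 * 1)" if "0 < v" "v < 1" for v
      by (rule fb[OF u that])
    have "0 < \<alpha> * u" "\<alpha> * u < \<alpha>" using u \<alpha> by auto
    from has_integral_rescale[OF has_integral_lens[OF this] \<alpha>]
    have "((\<lambda>v. sinh (\<alpha> * v) * arccos (max (- 1) (hyp_cos (\<alpha> * u) (\<alpha> * v) \<alpha>))) has_integral T (\<alpha> * u) / \<alpha>) {0..1}"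
      using hyp_cos_isosceles[OF \<open>0 < \<alpha> * u\<close> \<alpha>] by (simp add: T_def C_def S_def)
    from has_integral_mult_right[OF this, of "s u / (pi * \<alpha>)"]
    have "((\<lambda>v. s u / (pi * \<alpha>) * (sinh (\<alpha> * v) * arccos (max (- 1) (hyp_cos (\<alpha> * u) (\<alpha> * v) \<alpha>))))
        has_integral s u * (T (\<alpha> * u) / (pi * \<alpha>\<^sup>2))) {0..1}"
      by (simp add: power2_eq_square mult.assoc)
    thus "(f u has_integral s u * (T (\<alpha> * u) / (pi * \<alpha>\<^sup>2))) {0..1}"
    proof (rule has_integral_eq[rotated])
      fix v :: real assume v: "v \<in> {0..1}"
      show "s u / (pi * \<alpha>) * (sinh (\<alpha> * v) * arccos (max (- 1) (hyp_cos (\<alpha> * u) (\<alpha> * v) \<alpha>))) = f u v"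
      proof (cases "v = 0")
        case True
        thus ?thesis by (simp add: f_def s_def hyp_sine_def)
      next
        case False
        hence k: "0 < sine_ratio s u v" using v u by (intro sine_ratio_pos[OF s]) auto
        have "1 - 2 * min (sine_ratio s u v) 1 = max (- 1) (hyp_cos (\<alpha> * u) (\<alpha> * v) \<alpha>)"
          using hyp_cos_eq_sine_ratio[of \<alpha> u v] \<alpha> u False by (simp add: s_def min_def max_def)
        thus ?thesis
          unfolding f_def chord_cdf_plane[OF k] by (simp add: s_def hyp_sine_def)
      qed
    qed
  qed
  have "(\<integral>u. J u \<partial>unif01) = (3 * C * (C + 1) * arccos (C / (C + 1)) + (C - 1) * sqrt (2 * C + 1) - 3 * pi * C + pi) / (pi * \<alpha> ^ 4)"
    (is "_ = ?N / _")
  proof (rule integral_unif01_eq)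
    show Jm: "J \<in> borel_measurable borel"
      unfolding J_def[abs_def] by (rule borel_measurable_integral_unif01) measurable
    show "\<bar>J u\<bar> \<le> s 1 * (s 1 * 1)" if "0 < u" "u < 1" for u
      unfolding J_def by (rule abs_integral_unif01_le[OF measurable_unif01 fb[OF that]]) measurable
    have "((\<lambda>a. sinh a * T a) has_integral ?N) {0..\<alpha>}"
      using has_integral_lens_areas[OF \<alpha>] by (simp add: T_def C_def S_def)
    from has_integral_mult_right[OF has_integral_rescale[OF this \<alpha>], of "1 / (pi * \<alpha> ^ 3)"]
    have "((\<lambda>u. 1 / (pi * \<alpha> ^ 3) * (sinh (\<alpha> * u) * T (\<alpha> * u))) has_integral ?N / (pi * \<alpha> ^ 4)) {0..1}"
      by (simp add: eval_nat_numeral mult_ac)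
    thus "(J has_integral ?N / (pi * \<alpha> ^ 4)) {0..1}"
    proof (rule has_integral_spike_finite[rotated 2])
      show "finite {0, 1 :: real}" by simp
      show "J u = 1 / (pi * \<alpha> ^ 3) * (sinh (\<alpha> * u) * T (\<alpha> * u))" if "u \<in> {0..1} - {0, 1}" for u
        using that J[of u] by (simp add: s_def hyp_sine_def eval_nat_numeral mult_ac)
    qed
  qed
  moreover have "(\<integral>u. s u \<partial>unif01) = (C - 1) / \<alpha>\<^sup>2"
  proof (rule integral_unif01_eq[OF sm])
    show "\<bar>s u\<bar> \<le> s 1" if "0 < u" "u < 1" for u using s01[OF that] by simp
    have "((\<lambda>u. sinh (\<alpha> * u) / \<alpha>) has_integral (cosh (\<alpha> * 1) / \<alpha>\<^sup>2 - cosh (\<alpha> * 0) / \<alpha>\<^sup>2)) {0..1}"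
      using \<alpha> by (intro fundamental_theorem_of_calculus)
        (auto intro!: derivative_eq_intros simp: power2_eq_square simp flip: has_real_derivative_iff_has_vector_derivative)
    thus "(s has_integral (C - 1) / \<alpha>\<^sup>2) {0..1}"
      by (simp add: s_def hyp_sine_def[abs_def] C_def diff_divide_distrib)
  qed
  moreover have "cluster_integral 1 (chord_cdf TYPE(real^2)) s
      = (\<integral>u. J u \<partial>unif01) / (\<integral>u. s u \<partial>unif01)\<^sup>2"
    by (simp add: cluster_integral_def J_def f_def)
  ultimately have "cluster_integral 1 (chord_cdf TYPE(real^2)) s = ?N / (pi * \<alpha> ^ 4) / ((C - 1) / \<alpha>\<^sup>2)\<^sup>2"
    by (simp only:)
  also have "\<dots> = ?N / (pi * (C - 1)\<^sup>2)"
  proof -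
    have "x / (pi * \<alpha> ^ 4) / (y / \<alpha>\<^sup>2)\<^sup>2 = x / (pi * y\<^sup>2)" if "y \<noteq> 0" for x y
      using \<alpha> that by (simp add: power_divide power_mult[symmetric])
    thus ?thesis using C1 by simp
  qed
  finally show ?thesis
    by (simp add: hyperbolic_p_eq_cluster_integral[OF \<alpha>] s_def hyperbolic_plane_p_def C_def)
qed

section \<open>The Euclidean plane as a limit\<close>

text \<open>Dominated convergence, first in the inner and then in the outer integral.\<close>

lemma cluster_integral_tendsto:
  fixes s :: "nat \<Rightarrow> real \<Rightarrow> real" and s0 :: "real \<Rightarrow> real" and G :: "real \<Rightarrow> real"
  assumes G: "link_law G" and s: "\<And>i. sine_like (s i)" and s0: "sine_like s0"
    and lim: "\<And>x. 0 < x \<Longrightarrow> x < 1 \<Longrightarrow> (\<lambda>i. s i x) \<longlonglongrightarrow> s0 x"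
    and bound: "\<And>i x. 0 < x \<Longrightarrow> x < 1 \<Longrightarrow> s i x \<le> B"
    and cont: "\<And>k. 0 < k \<Longrightarrow> isCont G k"
  shows "(\<lambda>i. cluster_integral m G (s i)) \<longlonglongrightarrow> cluster_integral m G s0"
proof -
  interpret U: prob_space unif01 by (rule prob_space_unif01)
  let ?U = unif01
  interpret L: link_law G by (rule G)
  have sm [measurable]: "s i \<in> borel_measurable borel" "s0 \<in> borel_measurable borel" for i
    using sine_like_measurable[OF s] sine_like_measurable[OF s0] by blast+
  have pos: "0 < s i x" "0 < s0 x" if "0 < x" "x < 1" for i x
    using sine_like_pos[OF s, of x] sine_like_pos[OF s0, of x] that by auto
  have B: "0 \<le> B" using pos(1)[of "1/2" 0] bound[of "1/2" 0] by simp
  define f where "f r u v = r u ^ m * (r v ^ m * G (sine_ratio r u v))" for r :: "real \<Rightarrow> real" and u v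
  have fm [measurable]: "(\<lambda>(u, v). f (s i) u v) \<in> borel_measurable (borel \<Otimes>\<^sub>M borel)"
     "(\<lambda>(u, v). f s0 u v) \<in> borel_measurable (borel \<Otimes>\<^sub>M borel)" for i
    unfolding f_def sine_ratio_def by measurable
  have pb: "s i x ^ m \<le> B ^ m" "0 \<le> s i x ^ m" if "0 < x" "x < 1" for i x
    using pos(1)[OF that, of i] bound[OF that, of i] by (auto intro!: power_mono)
  have fb: "\<bar>f (s i) u v\<bar> \<le> B ^ m * (B ^ m * 1)" if "0 < u" "u < 1" "0 < v" "v < 1" for i u v
    unfolding f_def abs_mult using pb[OF that(1,2), of i] pb[OF that(3,4), of i] L.nonneg L.le_1 B
    by (intro mult_mono) auto
  have flim: "(\<lambda>i. f (s i) u v) \<longlonglongrightarrow> f s0 u v" if uv: "0 < u" "u < 1" "0 < v" "v < 1" for u v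
  proof -
    have "(\<lambda>i. sine_ratio (s i) u v) \<longlonglongrightarrow> sine_ratio s0 u v"
      unfolding sine_ratio_def using uv pos(2)[OF uv(1,2)] pos(2)[OF uv(3,4)]
      by (intro tendsto_intros lim) auto
    moreover have "isCont G (sine_ratio s0 u v)"
      using sine_ratio_pos[OF s0, of u v] uv by (intro cont) auto
    ultimately have "(\<lambda>i. G (sine_ratio (s i) u v)) \<longlonglongrightarrow> G (sine_ratio s0 u v)"
      by (intro isCont_tendsto_compose[of _ G])
    thus ?thesis unfolding f_def using uv by (intro tendsto_intros lim)
  qed
  have sec: "(\<lambda>i. \<integral>v. f (s i) u v \<partial>?U) \<longlonglongrightarrow> (\<integral>v. f s0 u v \<partial>?U)" if u: "0 < u" "u < 1" for u
  proof (rule integral_dominated_convergence[where w = "\<lambda>_. B ^ m * (B ^ m * 1)"])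
    show "f s0 u \<in> borel_measurable ?U" "\<And>i. f (s i) u \<in> borel_measurable ?U"
      by (rule measurable_unif01, measurable)+
    show "AE v in ?U. (\<lambda>i. f (s i) u v) \<longlonglongrightarrow> f s0 u v"
      by (rule AE_I2) (use flim[OF u] in simp)
    show "\<And>i. AE v in ?U. norm (f (s i) u v) \<le> B ^ m * (B ^ m * 1)"
      by (rule AE_I2) (use fb[OF u] in simp)
  qed simp
  have Im: "(\<lambda>u. \<integral>v. f (s i) u v \<partial>?U) \<in> borel_measurable ?U"
     "(\<lambda>u. \<integral>v. f s0 u v \<partial>?U) \<in> borel_measurable ?U" for i
    by (rule measurable_unif01, rule borel_measurable_integral_unif01, rule fm)+
  have "(\<lambda>i. \<integral>u. (\<integral>v. f (s i) u v \<partial>?U) \<partial>?U) \<longlonglongrightarrow> (\<integral>u. (\<integral>v. f s0 u v \<partial>?U) \<partial>?U)"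
  proof (rule integral_dominated_convergence[where w = "\<lambda>_. B ^ m * (B ^ m * 1)"])
    show "AE u in ?U. (\<lambda>i. \<integral>v. f (s i) u v \<partial>?U) \<longlonglongrightarrow> (\<integral>v. f s0 u v \<partial>?U)"
      by (rule AE_I2) (use sec in simp)
    fix i
    have "\<bar>\<integral>v. f (s i) u v \<partial>?U\<bar> \<le> B ^ m * (B ^ m * 1)" if "0 < u" "u < 1" for u
      by (rule abs_integral_unif01_le[OF measurable_unif01 fb[OF that]]) measurable
    thus "AE u in ?U. norm (\<integral>v. f (s i) u v \<partial>?U) \<le> B ^ m * (B ^ m * 1)"
      by (intro AE_I2) simp
  qed (rule Im, rule Im, simp)
  moreover have "(\<lambda>i. \<integral>u. s i u ^ m \<partial>?U) \<longlonglongrightarrow> (\<integral>u. s0 u ^ m \<partial>?U)"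
  proof (rule integral_dominated_convergence[where w = "\<lambda>_. B ^ m"])
    show "(\<lambda>u. s0 u ^ m) \<in> borel_measurable ?U" "\<And>i. (\<lambda>u. s i u ^ m) \<in> borel_measurable ?U"
      by (rule measurable_unif01, measurable)+
    show "AE u in ?U. (\<lambda>i. s i u ^ m) \<longlonglongrightarrow> s0 u ^ m"
      by (rule AE_I2) (use lim in \<open>auto intro!: tendsto_power\<close>)
    show "\<And>i. AE u in ?U. norm (s i u ^ m) \<le> B ^ m"
      by (rule AE_I2) (use pb in auto)
  qed simp
  moreover have "(\<integral>u. s0 u ^ m \<partial>?U) \<noteq> 0"
    using sine_like_power(4)[OF s0, of m] by simp
  ultimately show ?thesis
    unfolding cluster_integral_def f_def by (intro tendsto_divide tendsto_power) auto
qed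

lemma isCont_chord_cdf_plane:
  assumes "0 < k"
  shows "isCont (chord_cdf TYPE(real^2)) k"
proof -
  have "continuous_on {0<..} (\<lambda>k. arccos (1 - 2 * min k 1) / pi)"
    by (intro continuous_intros) auto
  hence "continuous_on {0<..} (chord_cdf TYPE(real^2))"
    by (rule continuous_on_eq) (simp add: chord_cdf_plane)
  thus ?thesis using assms by (simp add: continuous_on_eq_continuous_at)
qed

text \<open>The radii \<open>1 / (i + 1)\<close> are at most \<open>1\<close>, where \<open>sinh (\<alpha> * x) / \<alpha> \<le> sinh 1\<close> gives the dominating constant.\<close>

lemma hyperbolic_p_plane_tendsto_euclidean:
  "(\<lambda>i. hyperbolic_p TYPE(2) (1 / real (Suc i))) \<longlonglongrightarrow> euclidean_p TYPE(2)"
proof -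
  have "(\<lambda>i. cluster_integral 1 (chord_cdf TYPE(real^2)) (hyp_sine (1 / real (Suc i))))
      \<longlonglongrightarrow> cluster_integral 1 (chord_cdf TYPE(real^2)) (\<lambda>x. x)"
  proof (rule cluster_integral_tendsto[OF link_law_chord_cdf])
    show "sine_like (hyp_sine (1 / real (Suc i)))" for i by (rule sine_like_hyp_sine) simp
    show "sine_like (\<lambda>x. x)" by (rule sine_like_ident)
    show "(\<lambda>i. hyp_sine (1 / real (Suc i)) x) \<longlonglongrightarrow> x" if "0 < x" "x < 1" for x
      unfolding hyp_sine_def sinh_field_def by real_asymp
    show "hyp_sine (1 / real (Suc i)) x \<le> sinh 1" if x: "0 < x" "x < 1" for i x
    proof -
      define \<beta> where "\<beta> = 1 / real (Suc i)"
      have b: "0 < \<beta>" "\<beta> \<le> 1" by (auto simp: \<beta>_def)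
      have "sinh (\<beta> * x) \<le> sinh \<beta>" using b x by (simp add: mult_le_cancel_left1)
      also have "\<dots> \<le> \<beta> * sinh 1"
        using sinh_over_ident_increasing[of 1 \<beta> 1] b by (cases "\<beta> = 1") auto
      finally show ?thesis unfolding \<beta>_def[symmetric] hyp_sine_def using b by (simp add: pos_divide_le_eq mult.commute)
    qed
    show "isCont (chord_cdf TYPE(real^2)) k" if "0 < k" for k
      using that by (rule isCont_chord_cdf_plane)
  qed
  thus ?thesis
    by (simp add: hyperbolic_p_eq_cluster_integral euclidean_p_eq_cluster_integral)
qed

section \<open>Asymptotics of the closed form\<close>

text \<open>Integration of a one-sided order bound, by the mean value theorem.\<close>

lemma bigo_primitive:
  fixes Q q :: "real \<Rightarrow> real"
  assumes q: "q \<in> O[at_right 0](\<lambda>x. x ^ n)" and Q0: "Q 0 = 0"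
    and der: "\<And>x. 0 \<le> x \<Longrightarrow> (Q has_real_derivative q x) (at x)"
  shows "Q \<in> O[at_right 0](\<lambda>x. x ^ (n + 1))"
proof -
  obtain c where c: "c > 0" "\<forall>\<^sub>F x in at_right 0. norm (q x) \<le> c * norm (x ^ n)"
    using q by (elim landau_o.bigE)
  then obtain \<epsilon> where \<epsilon>: "\<epsilon> > 0" "\<And>x. 0 < x \<Longrightarrow> x < \<epsilon> \<Longrightarrow> \<bar>q x\<bar> \<le> c * \<bar>x ^ n\<bar>"
    unfolding eventually_at_right_field by auto
  have "\<bar>Q x\<bar> \<le> c * \<bar>x ^ (n + 1)\<bar>" if x: "0 < x" "x < \<epsilon>" for x
  proof -
    obtain z where z: "0 < z" "z < x" "Q x - Q 0 = (x - 0) * q z"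
      using MVT2[OF x(1), of Q q] der by auto
    have "\<bar>q z\<bar> \<le> c * \<bar>z ^ n\<bar>" using \<epsilon>(2)[of z] z x by simp
    also have "\<dots> \<le> c * \<bar>x ^ n\<bar>" using z x c(1) by (intro mult_left_mono) (auto intro: power_mono)
    finally have "\<bar>x * q z\<bar> \<le> x * (c * \<bar>x ^ n\<bar>)" using x by (simp add: abs_mult)
    thus ?thesis using z(3) Q0 x by (simp add: mult_ac abs_mult)
  qed
  thus ?thesis
    by (intro landau_o.bigI[OF c(1)]) (auto simp: eventually_at_right_field intro!: exI[of _ \<epsilon>] \<epsilon>(1))
qed

text \<open>Put \<open>C = 1 + 2 * X\<close>. The deviation from the claimed expansion is \<open>sqrt 3 * P X * Q X / (4 * pi * X\<^sup>2)\<close>, where dividing by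
the polynomial \<open>P\<close>, the coefficient of the angle \<open>\<Omega> X\<close>, isolates this angle in \<open>Q\<close>. Hence the derivative \<open>q\<close> of \<open>Q\<close>
is algebraic. Dividing by \<open>sqrt 3\<close> as well, and writing \<open>sqrt (3 + 4 * X) = sqrt 3 * t X\<close>, makes its power series
rational, so that \<open>q\<close> is seen to be of order \<open>X ^ 3\<close> by mechanical expansion. Integration gives order \<open>4\<close> for \<open>Q\<close>.\<close>

lemma hyperbolic_plane_p_expansion:
  "(\<lambda>X. hyperbolic_plane_p (1 + 2 * X) - (1 - 3 * sqrt 3 / (4 * pi) - sqrt 3 / (4 * pi) * X)) \<in> O[at_right 0](\<lambda>X. X\<^sup>2)"
proof -
  define P where "P X = 6 * (1 + X) * (1 + 2 * X)" for X :: real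
  define t where "t X = sqrt (1 + 4 * X / 3)" for X :: real
  define \<Omega> where "\<Omega> X = arccos ((1 + 2 * X) / (2 + 2 * X))" for X :: real
  define Q where "Q X = (\<Omega> X - pi / 3) / sqrt 3 + (2 * X * t X + 3 * X\<^sup>2 + X ^ 3) / P X" for X
  define q where "q X = - (1 / (3 * (1 + X) * t X)) + ((2 * t X + 4 * X / (3 * t X) + 6 * X + 3 * X\<^sup>2) * P X
      - (2 * X * t X + 3 * X\<^sup>2 + X ^ 3) * (6 * (3 + 4 * X))) / (P X)\<^sup>2" for X
  have t3: "sqrt (3 + 4 * X) = sqrt 3 * t X" for X
    by (simp add: t_def real_sqrt_mult[symmetric] algebra_simps)
  have qO: "q \<in> O[at_right 0](\<lambda>x. x ^ 3)"
    unfolding q_def P_def t_def by real_asymp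
  have Q0: "Q 0 = 0"
    using arccos_cos[of "pi / 3"] by (simp add: Q_def \<Omega>_def cos_60)
  have der: "(Q has_real_derivative q X) (at X)" if X: "0 \<le> X" for X
  proof -
    have tX: "0 < t X" using X by (simp add: t_def add_pos_nonneg)
    have PX: "P X \<noteq> 0" using X by (simp add: P_def)
    have f: "((\<lambda>X. (1 + 2 * X) / (2 + 2 * X)) has_real_derivative 2 / (2 + 2 * X)\<^sup>2) (at X)"
      using X by (auto intro!: derivative_eq_intros simp: power2_eq_square)
    have d\<Omega>: "(\<Omega> has_real_derivative - (1 / ((1 + X) * (sqrt 3 * t X)))) (at X)"
      unfolding \<Omega>_def[abs_def]
    proof (rule DERIV_cong[OF DERIV_arccos_quotient[OF f]])
      show "(1 + 2 * X) / (2 + 2 * X) = (1 + 2 * X) / (2 + 2 * X)" ..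
      show "0 < 2 + 2 * X" "0 < sqrt 3 * t X" using X tX by auto
      show "(2 + 2 * X)\<^sup>2 - (1 + 2 * X)\<^sup>2 = (sqrt 3 * t X)\<^sup>2"
        unfolding t3[symmetric] using X by (simp add: power2_eq_square algebra_simps)
      have "2 / (2 + 2 * X)\<^sup>2 * (2 + 2 * X) = 1 / (1 + X)"
        using X by (simp add: power2_eq_square divide_simps) (simp add: algebra_simps)
      thus "- (2 / (2 + 2 * X)\<^sup>2 * (2 + 2 * X) / (sqrt 3 * t X)) = - (1 / ((1 + X) * (sqrt 3 * t X)))"
        by (simp only: divide_divide_eq_left)
    qed
    have d1: "((\<lambda>X. (\<Omega> X - pi / 3) / sqrt 3) has_real_derivative - (1 / (3 * (1 + X) * t X))) (at X)"
      by (rule DERIV_cong[OF DERIV_cdivide[OF DERIV_diff[OF d\<Omega> DERIV_const]]]) (simp add: mult_ac)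
    have dt: "(t has_real_derivative 2 / (3 * t X)) (at X)"
      unfolding t_def[abs_def] using X by (auto intro!: derivative_eq_intros simp: inverse_eq_divide)
    have dP: "(P has_real_derivative 6 * (3 + 4 * X)) (at X)"
      unfolding P_def[abs_def] by (auto intro!: derivative_eq_intros simp: algebra_simps)
    have dN: "((\<lambda>X. 2 * X * t X + 3 * X\<^sup>2 + X ^ 3) has_real_derivative 2 * t X + 4 * X / (3 * t X) + 6 * X + 3 * X\<^sup>2) (at X)"
      by (auto intro!: derivative_eq_intros dt)
    show ?thesis
      unfolding Q_def[abs_def] q_def
      by (rule DERIV_cong[OF DERIV_add[OF d1 DERIV_divide[OF dN dP PX]]]) (simp add: power2_eq_square)
  qed
  have QO: "Q \<in> O[at_right 0](\<lambda>x. x ^ 4)"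
    using bigo_primitive[OF qO Q0 der] by simp
  have "(\<lambda>X. sqrt 3 * P X / (4 * pi * X\<^sup>2) * Q X) \<in> O[at_right 0](\<lambda>X. 1 / X\<^sup>2 * X ^ 4)"
  proof (rule landau_o.big.mult[OF _ QO])
    show "(\<lambda>X. sqrt 3 * P X / (4 * pi * X\<^sup>2)) \<in> O[at_right 0](\<lambda>X. 1 / X\<^sup>2)"
      unfolding P_def by real_asymp
  qed
  also have "(\<lambda>X::real. 1 / X\<^sup>2 * X ^ 4) \<in> O[at_right 0](\<lambda>X. X\<^sup>2)" by real_asymp
  finally have *: "(\<lambda>X. sqrt 3 * P X / (4 * pi * X\<^sup>2) * Q X) \<in> O[at_right 0](\<lambda>X. X\<^sup>2)" .
  show ?thesis
  proof (rule landau_o.big.in_cong[THEN iffD2, OF _ *])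
    show "\<forall>\<^sub>F X in at_right 0. hyperbolic_plane_p (1 + 2 * X) - (1 - 3 * sqrt 3 / (4 * pi) - sqrt 3 / (4 * pi) * X)
        = sqrt 3 * P X / (4 * pi * X\<^sup>2) * Q X"
    proof (rule eventually_mono[OF eventually_at_right_less[of 0]])
      fix X :: real assume X: "0 < X"
      have PX: "P X \<noteq> 0" using X by (simp add: P_def)
      have e1: "(1 + 2 * X) / (1 + 2 * X + 1) = (1 + 2 * X) / (2 + 2 * X)" by (simp add: add_ac)
      have e2: "sqrt (2 * (1 + 2 * X) + 1) = sqrt 3 * t X"
        unfolding t3[symmetric] by (simp add: algebra_simps)
      have h: "hyperbolic_plane_p (1 + 2 * X) = (P X * \<Omega> X + 2 * X * (sqrt 3 * t X) - 2 * pi - 6 * pi * X) / (4 * pi * X\<^sup>2)"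
        unfolding hyperbolic_plane_p_def e1 e2 \<Omega>_def[symmetric]
        by (rule arg_cong2[where f="(/)"]) (simp_all add: P_def power2_eq_square algebra_simps)
      have r: "1 - 3 * sqrt 3 / (4 * pi) - sqrt 3 / (4 * pi) * X
         = (4 * pi * X\<^sup>2 - 3 * sqrt 3 * X\<^sup>2 - sqrt 3 * X ^ 3) / (4 * pi * X\<^sup>2)"
        using X by (simp add: divide_simps power2_eq_square power3_eq_cube) (simp add: algebra_simps)
      have "sqrt 3 * P X * Q X = P X * (\<Omega> X - pi / 3) + sqrt 3 * (2 * X * t X + 3 * X\<^sup>2 + X ^ 3)"
        unfolding Q_def using PX by (simp add: field_simps)
      also have "\<dots> = (P X * \<Omega> X + 2 * X * (sqrt 3 * t X) - 2 * pi - 6 * pi * X) - (4 * pi * X\<^sup>2 - 3 * sqrt 3 * X\<^sup>2 - sqrt 3 * X ^ 3)"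
        unfolding P_def by (simp add: power2_eq_square algebra_simps)
      finally show "hyperbolic_plane_p (1 + 2 * X) - (1 - 3 * sqrt 3 / (4 * pi) - sqrt 3 / (4 * pi) * X)
        = sqrt 3 * P X / (4 * pi * X\<^sup>2) * Q X"
        unfolding h r by (simp only: diff_divide_distrib[symmetric] times_divide_eq_left)
    qed
  qed
qed

text \<open>Here \<open>X = (cosh \<alpha> - 1) / 2\<close>, which is \<open>\<alpha>\<^sup>2 / 4\<close> up to order \<open>4\<close>.\<close>

lemma hyperbolic_plane_p_small:
  "(\<lambda>\<alpha>. hyperbolic_plane_p (cosh \<alpha>) - (1 - 3 * sqrt 3 / (4 * pi) - sqrt 3 / (16 * pi) * \<alpha>\<^sup>2)) \<in> O[at_right 0](\<lambda>\<alpha>. \<alpha> ^ 4)"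
proof -
  define X where "X \<alpha> = (cosh \<alpha> - 1) / 2" for \<alpha> :: real
  have lim: "filterlim X (at_right 0) (at_right 0)"
    unfolding X_def cosh_field_def by real_asymp
  have "(\<lambda>\<alpha>. hyperbolic_plane_p (1 + 2 * X \<alpha>) - (1 - 3 * sqrt 3 / (4 * pi) - sqrt 3 / (4 * pi) * X \<alpha>)) \<in> O[at_right 0](\<lambda>\<alpha>. (X \<alpha>)\<^sup>2)"
    by (rule landau_o.big.compose[OF hyperbolic_plane_p_expansion lim])
  also have "(\<lambda>\<alpha>. (X \<alpha>)\<^sup>2) \<in> O[at_right 0](\<lambda>\<alpha>. \<alpha> ^ 4)"
    unfolding X_def cosh_field_def by real_asymp
  finally have 1: "(\<lambda>\<alpha>. hyperbolic_plane_p (1 + 2 * X \<alpha>) - (1 - 3 * sqrt 3 / (4 * pi) - sqrt 3 / (4 * pi) * X \<alpha>)) \<in> O[at_right 0](\<lambda>\<alpha>. \<alpha> ^ 4)" .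
  have "(\<lambda>\<alpha>. X \<alpha> - \<alpha>\<^sup>2 / 4) \<in> O[at_right 0](\<lambda>\<alpha>. \<alpha> ^ 4)"
    unfolding X_def cosh_field_def by real_asymp
  hence 2: "(\<lambda>\<alpha>. sqrt 3 / (4 * pi) * (X \<alpha> - \<alpha>\<^sup>2 / 4)) \<in> O[at_right 0](\<lambda>\<alpha>. \<alpha> ^ 4)" by simp
  have "(\<lambda>\<alpha>. hyperbolic_plane_p (1 + 2 * X \<alpha>) - (1 - 3 * sqrt 3 / (4 * pi) - sqrt 3 / (4 * pi) * X \<alpha>)
       - sqrt 3 / (4 * pi) * (X \<alpha> - \<alpha>\<^sup>2 / 4)) \<in> O[at_right 0](\<lambda>\<alpha>. \<alpha> ^ 4)"
    by (rule sum_in_bigo(2)[OF 1 2])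
  moreover have "1 + 2 * X \<alpha> = cosh \<alpha>" for \<alpha> by (simp add: X_def field_simps)
  ultimately show ?thesis by (simp add: algebra_simps)
qed

text \<open>The half-angle form has an argument that tends to \<open>0\<close> as \<open>C\<close> tends to infinity, which suits asymptotic expansion.\<close>

lemma arccos_eq_arctan_half:
  assumes "1 \<le> C"
  shows "arccos (C / (C + 1)) = 2 * arctan (1 / sqrt (2 * C + 1))"
proof -
  define z where "z = 1 / sqrt (2 * C + 1)"
  have z: "0 \<le> z" "z\<^sup>2 = 1 / (2 * C + 1)" using assms by (simp_all add: z_def power_divide)
  have "cos (2 * arctan z) = 2 * (1 / sqrt (1 + z\<^sup>2))\<^sup>2 - 1"
    by (simp add: cos_double_cos cos_arctan)
  also have "\<dots> = 2 / (1 + z\<^sup>2) - 1" by (simp add: power_divide)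
  also have "\<dots> = C / (C + 1)" unfolding z(2) using assms by (simp add: field_simps)
  finally have "C / (C + 1) = cos (2 * arctan z)" ..
  moreover have "0 \<le> 2 * arctan z" "2 * arctan z \<le> pi"
    using z(1) arctan_ubound[of z] by auto
  ultimately show ?thesis by (simp add: arccos_cos z_def)
qed

lemma hyperbolic_plane_p_large:
  "(\<lambda>\<alpha>. hyperbolic_plane_p (cosh \<alpha>) - 8 / pi * exp (- \<alpha> / 2)) \<in> o[at_top](\<lambda>\<alpha>. exp (- \<alpha> / 2))"
proof -
  define p where "p C = (6 * C * (C + 1) * arctan (1 / sqrt (2 * C + 1)) + (C - 1) * sqrt (2 * C + 1) - 3 * pi * C + pi)
     / (pi * (C - 1)\<^sup>2)" for C :: real
  have "((\<lambda>\<alpha>. (p (cosh \<alpha>) - 8 / pi * exp (- \<alpha> / 2)) / exp (- \<alpha> / 2)) \<longlongrightarrow> 0) at_top"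
    unfolding p_def cosh_field_def by real_asymp (simp add: power2_eq_square divide_simps)
  hence "(\<lambda>\<alpha>. p (cosh \<alpha>) - 8 / pi * exp (- \<alpha> / 2)) \<in> o[at_top](\<lambda>\<alpha>. exp (- \<alpha> / 2))"
    by (intro smalloI_tendsto) auto
  moreover have "hyperbolic_plane_p (cosh \<alpha>) = p (cosh \<alpha>)" for \<alpha>
    using arccos_eq_arctan_half[OF cosh_real_ge_1[of \<alpha>]] by (simp add: hyperbolic_plane_p_def p_def)
  ultimately show ?thesis by simp
qed

section \<open>The theorem\<close>

text \<open>The clustering tendency is continuous at curvature \<open>0\<close>, so the constant term of the hyperbolic expansion is the
Euclidean value.\<close>

theorem euclidean_p_plane: "euclidean_p TYPE(2) = 1 - 3 * sqrt 3 / (4 * pi)"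
proof -
  define E where "E = 1 - 3 * sqrt 3 / (4 * pi)"
  define r where "r \<alpha> = hyperbolic_plane_p (cosh \<alpha>) - (E - sqrt 3 / (16 * pi) * \<alpha>\<^sup>2)" for \<alpha>
  have "r \<in> O[at_right 0](\<lambda>\<alpha>. \<alpha> ^ 4)"
    unfolding r_def E_def by (rule hyperbolic_plane_p_small)
  also have "(\<lambda>\<alpha>::real. \<alpha> ^ 4) \<in> o[at_right 0](\<lambda>_. 1)" by real_asymp
  finally have r: "(r \<longlongrightarrow> 0) (at_right 0)"
    using smalloD_tendsto by fastforce
  have "((\<lambda>\<alpha>. E - sqrt 3 / (16 * pi) * \<alpha>\<^sup>2) \<longlongrightarrow> E - sqrt 3 / (16 * pi) * 0\<^sup>2) (at_right 0)"
    by (intro tendsto_intros)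
  from tendsto_add[OF r this] have "((\<lambda>\<alpha>. hyperbolic_plane_p (cosh \<alpha>)) \<longlongrightarrow> E) (at_right 0)"
    by (simp add: r_def)
  moreover have "filterlim (\<lambda>i. 1 / real (Suc i)) (at_right 0) sequentially"
    by real_asymp
  ultimately have "(\<lambda>i. hyperbolic_plane_p (cosh (1 / real (Suc i)))) \<longlonglongrightarrow> E"
    by (rule filterlim_compose)
  hence "(\<lambda>i. hyperbolic_p TYPE(2) (1 / real (Suc i))) \<longlonglongrightarrow> E"
    by (simp add: hyperbolic_p_plane)
  thus ?thesis
    unfolding E_def by (rule LIMSEQ_unique[OF hyperbolic_p_plane_tendsto_euclidean])
qed

theorem proposition35:
  assumes "CARD('d::finite) \<ge> 2"
  shows "(\<forall>\<alpha>>0. hyperbolic_p TYPE('d) \<alpha> < euclidean_p TYPE('d)) \<and>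
         (\<forall>\<alpha> \<beta>. 0 < \<alpha> \<and> \<alpha> < \<beta> \<longrightarrow> hyperbolic_p TYPE('d) \<beta> < hyperbolic_p TYPE('d) \<alpha>) \<and>
         (\<lambda>\<alpha>. hyperbolic_p TYPE(2) \<alpha> - (euclidean_p TYPE(2) - sqrt 3 / (16 * pi) * \<alpha>\<^sup>2))
           \<in> O[at_right 0](\<lambda>\<alpha>. \<alpha> ^ 4) \<and>
         (\<lambda>\<alpha>. hyperbolic_p TYPE(2) \<alpha> - 8 / pi * exp (- \<alpha> / 2))
           \<in> o[at_top](\<lambda>\<alpha>. exp (- \<alpha> / 2))"
proof (intro conjI allI impI)
  interpret link_law "chord_cdf TYPE(real^'d)" by (rule link_law_chord_cdf)
  have "2 \<le> DIM(real^'d)" using assms by simp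
  note less = cluster_integral_less[OF chord_cdf_strict_mono[OF this]]
  show "hyperbolic_p TYPE('d) \<alpha> < euclidean_p TYPE('d)" if \<alpha>: "0 < \<alpha>" for \<alpha>
    unfolding hyperbolic_p_eq_cluster_integral[OF \<alpha>] euclidean_p_eq_cluster_integral
  proof (rule less[OF _ _ _ sine_like_ident sine_like_hyp_sine[OF \<alpha>]])
    show "hyp_sine \<alpha> x * y < x * hyp_sine \<alpha> y" if "0 < x" "x < y" for x y
      using divide_strict_right_mono[OF sinh_over_ident_increasing[OF \<alpha> that] \<alpha>]
      by (simp add: hyp_sine_def)
  qed
  show "hyperbolic_p TYPE('d) \<beta> < hyperbolic_p TYPE('d) \<alpha>" if "0 < \<alpha> \<and> \<alpha> < \<beta>" for \<alpha> \<beta>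
  proof -
    have \<alpha>: "0 < \<alpha>" and \<alpha>\<beta>: "\<alpha> < \<beta>" and \<beta>: "0 < \<beta>" using that by auto
    show ?thesis
      unfolding hyperbolic_p_eq_cluster_integral[OF \<alpha>] hyperbolic_p_eq_cluster_integral[OF \<beta>]
    proof (rule less[OF _ _ _ sine_like_hyp_sine[OF \<alpha>] sine_like_hyp_sine[OF \<beta>]])
      show "hyp_sine \<beta> x * hyp_sine \<alpha> y < hyp_sine \<alpha> x * hyp_sine \<beta> y" if "0 < x" "x < y" for x y
        using divide_strict_right_mono[OF sinh_ratio_increasing[OF \<alpha> \<alpha>\<beta> that] mult_pos_pos[OF \<beta> \<alpha>]]
        by (simp add: hyp_sine_def mult_ac)
    qed
  qed
  have "\<forall>\<^sub>F \<alpha> in at_right 0. hyperbolic_plane_p (cosh \<alpha>) = hyperbolic_p TYPE(2) \<alpha>"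
    using eventually_at_right_less[of "0::real"] by eventually_elim (simp add: hyperbolic_p_plane)
  hence "\<forall>\<^sub>F \<alpha> in at_right 0. hyperbolic_plane_p (cosh \<alpha>) - (1 - 3 * sqrt 3 / (4 * pi) - sqrt 3 / (16 * pi) * \<alpha>\<^sup>2)
      = hyperbolic_p TYPE(2) \<alpha> - (euclidean_p TYPE(2) - sqrt 3 / (16 * pi) * \<alpha>\<^sup>2)"
    by eventually_elim (simp only: euclidean_p_plane)
  from landau_o.big.in_cong[OF this] hyperbolic_plane_p_small
  show "(\<lambda>\<alpha>. hyperbolic_p TYPE(2) \<alpha> - (euclidean_p TYPE(2) - sqrt 3 / (16 * pi) * \<alpha>\<^sup>2)) \<in> O[at_right 0](\<lambda>\<alpha>. \<alpha> ^ 4)"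
    by blast
  have "\<forall>\<^sub>F \<alpha> in at_top. hyperbolic_plane_p (cosh \<alpha>) = hyperbolic_p TYPE(2) \<alpha>"
    using eventually_gt_at_top[of "0::real"] by eventually_elim (simp add: hyperbolic_p_plane)
  hence "\<forall>\<^sub>F \<alpha> in at_top. hyperbolic_plane_p (cosh \<alpha>) - 8 / pi * exp (- \<alpha> / 2)
      = hyperbolic_p TYPE(2) \<alpha> - 8 / pi * exp (- \<alpha> / 2)"
    by eventually_elim simp
  from landau_o.small.in_cong[OF this] hyperbolic_plane_p_large
  show "(\<lambda>\<alpha>. hyperbolic_p TYPE(2) \<alpha> - 8 / pi * exp (- \<alpha> / 2)) \<in> o[at_top](\<lambda>\<alpha>. exp (- \<alpha> / 2))"
    by blast
qed

end
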